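(* Let $\phi:\sum_W(A_n)\rightarrow PB(W(A_n))$ be the map given by $\phi([x_J])=W/W_J$ for $J\subseteq\Pi$, where $W=W(A_n)$. This is an isomorphism.
   Context: Let $e_1,\dots,e_{n+1}$ be an orthonormal basis of a Euclidean space of dimension $n+1$. The root system of type $A_n$ is $\Phi=\{e_i-e_j\mid i\ne j,\ i,j=1,\dots,n+1\}$ with fundamental system $\Pi=\{e_1-e_2,\dots,e_n-e_{n+1}\}$ and corresponding positive system $\Phi^+$; the Weyl group $W=W(A_n)$ is the group generated by the reflections $w_r$, $r\in\Phi$. For $J\subseteq\Pi$, $W_J$ is the standard parabolic subgroup generated by the $w_r$, $r\in J$, and $X_J=\{w\in W\mid w(J)\subseteq\Phi^+\}$ is the set of distinguished representatives of the left cosets $wW_J$ in $W$. Put $X_J^{-1}=\{w^{-1}\mid w\in X_J\}$ and $X_{JK}=X_J^{-1}\cap X_K$, a set of distinguished representatives of the double cosets $W_JwW_K$. Let $x_J=\sum_{d\in X_J}d$. For $J,K,L\subseteq\Pi$, $a_{JKL}$ is the number of elements $w\in X_{JK}$ such that $w^{-1}(J)\cap K=L$. Write $J\sim K$ if $w(J)=K$ for some $w\in W$; define $x_J\sim x_K$ if and only if $J\sim K$, and let $[x_J]=\{x_K\mid K\subseteq\Pi,\ x_K\sim x_J\}$ be the equivalence class of $x_J$. The new descent algebra $\sum_W(A_n)$ is the algebra over the field of rationals $\mathbb{Q}$ having as basis the distinct classes $[x_J]$, $J\subseteq\Pi$, with multiplication $[x_J][x_K]=\sum_{L\subseteq K}a_{JKL}[x_L]$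 and identity $[x_\Pi]$. The parabolic Burnside ring $PB(W)$ is the subring of the Burnside ring $B(W)$ of $W$ spanned by the permutation representations $W/W_J$, $J\subseteq\Pi$. Its multiplication is given by $W/W_J\times W/W_K=\sum_{L\subseteq K}a_{JKL}\,W/W_L$. *)

theory Defs
  imports "HOL-Analysis.Linear_Algebra" "HOL-Algebra.Algebra" "HOL-Library.Poly_Mapping"
begin

section \<open>Free modules\<close>

text \<open>
  Elements of the free module over \<open>'k\<close> on a set \<open>S\<close> are the finitely supported functions
  \<open>f :: 'x \<Rightarrow>\<^sub>0 'k\<close> with \<open>keys f \<subseteq> S\<close>; the basis vector of \<open>s \<in> S\<close> is \<open>Poly_Mapping.single s 1\<close>.
\<close>

definition scale :: "'k::comm_ring_1 \<Rightarrow> ('x \<Rightarrow>\<^sub>0 'k) \<Rightarrow> ('x \<Rightarrow>\<^sub>0 'k)" where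
  "scale c f = Poly_Mapping.map ((*) c) f"


section \<open>The Burnside ring of a group\<close>

type_synonym ('g, 'x) gset = "'x set \<times> ('g \<Rightarrow> 'x \<Rightarrow> 'x)"

definition finite_gset :: "('g, 'b) monoid_scheme \<Rightarrow> ('g, 'x) gset \<Rightarrow> bool" where
  "finite_gset G A \<longleftrightarrow> finite (fst A) \<and> group_action G (fst A) (snd A)"

definition gset_isomorphic ::
  "('g, 'b) monoid_scheme \<Rightarrow> ('g, 'x) gset \<Rightarrow> ('g, 'y) gset \<Rightarrow> bool" where
  "gset_isomorphic G A B \<longleftrightarrow>
     (\<exists>f. bij_betw f (fst A) (fst B) \<and>
          (\<forall>g\<in>carrier G. \<forall>x\<in>fst A. f (snd A g x) = snd B g (f x)))"

text \<open>The actions are restricted because \<open>group_action\<close> asks for extensional bijections.\<close>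

definition gset_prod :: "('g, 'x) gset \<Rightarrow> ('g, 'y) gset \<Rightarrow> ('g, 'x \<times> 'y) gset" where
  "gset_prod A B =
     (fst A \<times> fst B, \<lambda>g. restrict (map_prod (snd A g) (snd B g)) (fst A \<times> fst B))"

definition gset_sum :: "('g, 'x) gset \<Rightarrow> ('g, 'y) gset \<Rightarrow> ('g, 'x + 'y) gset" where
  "gset_sum A B =
     (fst A <+> fst B, \<lambda>g. restrict (map_sum (snd A g) (snd B g)) (fst A <+> fst B))"

definition gset_point :: "('g, unit) gset" where
  "gset_point = ({()}, \<lambda>g x. x)"

definition gset_cosets :: "('g, 'b) monoid_scheme \<Rightarrow> 'g set \<Rightarrow> ('g, 'g set) gset" where
  "gset_cosets G H =
     (lcosets\<^bsub>G\<^esub> H, \<lambda>g. restrict (\<lambda>C. g <#\<^bsub>G\<^esub> C) (lcosets\<^bsub>G\<^esub> H))"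

text \<open>
  Every finite \<open>G\<close>-set is isomorphic to one whose points are natural numbers, so isomorphism classes
  of finite \<open>G\<close>-sets of arbitrary type are represented by sets of \<open>G\<close>-sets on natural numbers.
\<close>

definition gset_class :: "('g, 'b) monoid_scheme \<Rightarrow> ('g, 'x) gset \<Rightarrow> ('g, nat) gset set" where
  "gset_class G A = {B. finite_gset G B \<and> gset_isomorphic G A B}"

definition gset_classes :: "('g, 'b) monoid_scheme \<Rightarrow> ('g, nat) gset set set" where
  "gset_classes G = gset_class G ` {A :: ('g, nat) gset. finite_gset G A}"

definition gset_class_prod ::
  "('g, 'b) monoid_scheme \<Rightarrow> ('g, nat) gset set \<Rightarrow> ('g, nat) gset set \<Rightarrow> ('g, nat) gset set" where
  "gset_class_prod G C D = (\<Union>A\<in>C. \<Union>B\<in>D. gset_class G (gset_prod A B))"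

text \<open>The free \<open>'k\<close>-module on the isomorphism classes, with the Cartesian product extended bilinearly.\<close>

definition gset_ring :: "('g, 'b) monoid_scheme \<Rightarrow> (('g, nat) gset set \<Rightarrow>\<^sub>0 'k::comm_ring_1) ring" where
  "gset_ring G =
     \<lparr> carrier = {f. Poly_Mapping.keys f \<subseteq> gset_classes G},
       monoid.mult = (\<lambda>f h. \<Sum>C\<in>Poly_Mapping.keys f. \<Sum>D\<in>Poly_Mapping.keys h.
                 Poly_Mapping.single (gset_class_prod G C D)
                   (Poly_Mapping.lookup f C * Poly_Mapping.lookup h D)),
       one = Poly_Mapping.single (gset_class G gset_point) 1,
       ring.zero = 0,
       add = (+) \<rparr>"

definition gset_basis ::
  "('g, 'b) monoid_scheme \<Rightarrow> ('g, 'x) gset \<Rightarrow> (('g, nat) gset set \<Rightarrow>\<^sub>0 'k::comm_ring_1)" where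
  "gset_basis G A = Poly_Mapping.single (gset_class G A) 1"

definition burnside_relations ::
  "('g, 'b) monoid_scheme \<Rightarrow> (('g, nat) gset set \<Rightarrow>\<^sub>0 'k::comm_ring_1) set" where
  "burnside_relations G =
     {gset_basis G (gset_sum A B) - (gset_basis G A + gset_basis G B) |
        (A :: ('g, nat) gset) (B :: ('g, nat) gset). finite_gset G A \<and> finite_gset G B}"

definition burnside_ideal ::
  "('g, 'b) monoid_scheme \<Rightarrow> (('g, nat) gset set \<Rightarrow>\<^sub>0 'k::comm_ring_1) set" where
  "burnside_ideal G = Idl\<^bsub>gset_ring G\<^esub> (burnside_relations G)"

text \<open>
  The Burnside ring with coefficients in \<open>'k\<close>, as a \<open>'k\<close>-algebra. For \<open>'k = int\<close> this is the usual
  Burnside ring \<open>B(G)\<close>, the Grothendieck ring of finite \<open>G\<close>-sets; in general it is \<open>'k \<otimes> B(G)\<close>.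
\<close>

definition burnside ::
  "('g, 'b) monoid_scheme \<Rightarrow> ('k::comm_ring_1, (('g, nat) gset set \<Rightarrow>\<^sub>0 'k) set) module" where
  "burnside G =
     (let Q = gset_ring G Quot burnside_ideal G in
     \<lparr> carrier = carrier Q,
       monoid.mult = monoid.mult Q,
       one = one Q,
       ring.zero = ring.zero Q,
       add = add Q,
       smult = (\<lambda>c Y. \<Union>f\<in>Y. burnside_ideal G +>\<^bsub>gset_ring G\<^esub> scale c f) \<rparr>)"

definition burnside_class ::
  "('g, 'b) monoid_scheme \<Rightarrow> ('g, 'x) gset \<Rightarrow> (('g, nat) gset set \<Rightarrow>\<^sub>0 'k::comm_ring_1) set" where
  "burnside_class G A = burnside_ideal G +>\<^bsub>gset_ring G\<^esub> gset_basis G A"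


section \<open>Root systems and their Weyl groups\<close>

text \<open>
  Throughout, \<open>\<Phi>\<close> is a root system and \<open>\<Delta>\<close> a fundamental system of \<open>\<Phi>\<close>.
\<close>

definition reflection :: "'a::euclidean_space \<Rightarrow> 'a \<Rightarrow> 'a" where
  "reflection r x = x - (2 * (x \<bullet> r) / (r \<bullet> r)) *\<^sub>R r"

definition weyl_group :: "'a::euclidean_space set \<Rightarrow> ('a \<Rightarrow> 'a) monoid" where
  "weyl_group \<Phi> = subgroup_generated (BijGroup UNIV) (reflection ` \<Phi>)"

definition pos_roots :: "'a::euclidean_space set \<Rightarrow> 'a set \<Rightarrow> 'a set" where
  "pos_roots \<Phi> \<Delta> = {r \<in> \<Phi>. \<exists>c. (\<forall>s\<in>\<Delta>. 0 \<le> c s) \<and> r = (\<Sum>s\<in>\<Delta>. c s *\<^sub>R s)}"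

definition parabolic :: "'a::euclidean_space set \<Rightarrow> 'a set \<Rightarrow> ('a \<Rightarrow> 'a) set" where
  "parabolic \<Phi> J = generate (weyl_group \<Phi>) (reflection ` J)"

definition coset_reps :: "'a::euclidean_space set \<Rightarrow> 'a set \<Rightarrow> 'a set \<Rightarrow> ('a \<Rightarrow> 'a) set" where
  "coset_reps \<Phi> \<Delta> J = {w \<in> carrier (weyl_group \<Phi>). w ` J \<subseteq> pos_roots \<Phi> \<Delta>}"

definition double_coset_reps ::
  "'a::euclidean_space set \<Rightarrow> 'a set \<Rightarrow> 'a set \<Rightarrow> 'a set \<Rightarrow> ('a \<Rightarrow> 'a) set" where
  "double_coset_reps \<Phi> \<Delta> J K =
     (\<lambda>w. inv\<^bsub>weyl_group \<Phi>\<^esub> w) ` coset_reps \<Phi> \<Delta> J \<inter> coset_reps \<Phi> \<Delta> K"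

definition descent_coeff ::
  "'a::euclidean_space set \<Rightarrow> 'a set \<Rightarrow> 'a set \<Rightarrow> 'a set \<Rightarrow> 'a set \<Rightarrow> nat" where
  "descent_coeff \<Phi> \<Delta> J K L =
     card {w \<in> double_coset_reps \<Phi> \<Delta> J K. (inv\<^bsub>weyl_group \<Phi>\<^esub> w) ` J \<inter> K = L}"

definition weyl_equiv :: "'a::euclidean_space set \<Rightarrow> 'a set \<Rightarrow> 'a set \<Rightarrow> bool" where
  "weyl_equiv \<Phi> J K \<longleftrightarrow> (\<exists>w\<in>carrier (weyl_group \<Phi>). w ` J = K)"


section \<open>The new descent algebra\<close>

text \<open>\<open>descent_elem \<Phi> \<Delta> J\<close> is the element \<open>x\<^sub>J\<close> of the rational group algebra of \<open>W\<close>.\<close>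

definition descent_elem ::
  "'a::euclidean_space set \<Rightarrow> 'a set \<Rightarrow> 'a set \<Rightarrow> (('a \<Rightarrow> 'a) \<Rightarrow>\<^sub>0 rat)" where
  "descent_elem \<Phi> \<Delta> J = (\<Sum>d\<in>coset_reps \<Phi> \<Delta> J. Poly_Mapping.single d 1)"

definition descent_class ::
  "'a::euclidean_space set \<Rightarrow> 'a set \<Rightarrow> 'a set \<Rightarrow> (('a \<Rightarrow> 'a) \<Rightarrow>\<^sub>0 rat) set" where
  "descent_class \<Phi> \<Delta> J = {descent_elem \<Phi> \<Delta> K | K. K \<subseteq> \<Delta> \<and> weyl_equiv \<Phi> J K}"

definition descent_basis ::
  "'a::euclidean_space set \<Rightarrow> 'a set \<Rightarrow> 'a set \<Rightarrow> ((('a \<Rightarrow> 'a) \<Rightarrow>\<^sub>0 rat) set \<Rightarrow>\<^sub>0 rat)" where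
  "descent_basis \<Phi> \<Delta> J = Poly_Mapping.single (descent_class \<Phi> \<Delta> J) 1"

definition class_rep ::
  "'a::euclidean_space set \<Rightarrow> 'a set \<Rightarrow> (('a \<Rightarrow> 'a) \<Rightarrow>\<^sub>0 rat) set \<Rightarrow> 'a set" where
  "class_rep \<Phi> \<Delta> C = (SOME J. J \<subseteq> \<Delta> \<and> descent_class \<Phi> \<Delta> J = C)"

definition descent_product ::
  "'a::euclidean_space set \<Rightarrow> 'a set \<Rightarrow> 'a set \<Rightarrow> 'a set \<Rightarrow> ((('a \<Rightarrow> 'a) \<Rightarrow>\<^sub>0 rat) set \<Rightarrow>\<^sub>0 rat)" where
  "descent_product \<Phi> \<Delta> J K =
     (\<Sum>L\<in>Pow K. scale (of_nat (descent_coeff \<Phi> \<Delta> J K L)) (descent_basis \<Phi> \<Delta> L))"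

text \<open>
  The multiplication is the bilinear extension of \<open>[x\<^sub>J] [x\<^sub>K] = descent_product \<Phi> \<Delta> J K\<close>. The right-hand
  side depends only on the classes; the definition evaluates it at chosen representatives.
\<close>

definition new_descent_algebra ::
  "'a::euclidean_space set \<Rightarrow> 'a set \<Rightarrow> (rat, (('a \<Rightarrow> 'a) \<Rightarrow>\<^sub>0 rat) set \<Rightarrow>\<^sub>0 rat) module" where
  "new_descent_algebra \<Phi> \<Delta> =
     \<lparr> carrier = {f. Poly_Mapping.keys f \<subseteq> descent_class \<Phi> \<Delta> ` Pow \<Delta>},
       monoid.mult = (\<lambda>f h. \<Sum>C\<in>Poly_Mapping.keys f. \<Sum>D\<in>Poly_Mapping.keys h.
                 scale (Poly_Mapping.lookup f C * Poly_Mapping.lookup h D)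
                   (descent_product \<Phi> \<Delta> (class_rep \<Phi> \<Delta> C) (class_rep \<Phi> \<Delta> D))),
       one = descent_basis \<Phi> \<Delta> \<Delta>,
       ring.zero = 0,
       add = (+),
       smult = scale \<rparr>"


section \<open>The parabolic Burnside ring\<close>

definition parabolic_class ::
  "'a::euclidean_space set \<Rightarrow> 'a set \<Rightarrow> (('a \<Rightarrow> 'a, nat) gset set \<Rightarrow>\<^sub>0 'k::comm_ring_1) set" where
  "parabolic_class \<Phi> J =
     burnside_class (weyl_group \<Phi>) (gset_cosets (weyl_group \<Phi>) (parabolic \<Phi> J))"

text \<open>
  Coefficients in \<open>'k\<close>: for \<open>'k = int\<close> this is the subring \<open>PB(W)\<close> of \<open>B(W)\<close>, and for \<open>'k = rat\<close> it is the
  rational span of the same elements, that is \<open>\<rat> \<otimes> PB(W)\<close>.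
\<close>

definition parabolic_burnside ::
  "'a::euclidean_space set \<Rightarrow> 'a set \<Rightarrow>
     ('k::comm_ring_1, (('a \<Rightarrow> 'a, nat) gset set \<Rightarrow>\<^sub>0 'k) set) module" where
  "parabolic_burnside \<Phi> \<Delta> =
     (let B = burnside (weyl_group \<Phi>) in
      B\<lparr>carrier := {finsum B (\<lambda>J. c J \<odot>\<^bsub>B\<^esub> parabolic_class \<Phi> J) (Pow \<Delta>) | c :: 'a set \<Rightarrow> 'k. True}\<rparr>)"


section \<open>The map from the new descent algebra to the parabolic Burnside ring\<close>

text \<open>The linear map sending \<open>[x\<^sub>J]\<close> to \<open>W/W\<^sub>J\<close>.\<close>

definition descent_to_burnside ::
  "'a::euclidean_space set \<Rightarrow> 'a set \<Rightarrow> ((('a \<Rightarrow> 'a) \<Rightarrow>\<^sub>0 rat) set \<Rightarrow>\<^sub>0 rat) \<Rightarrow>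
     (('a \<Rightarrow> 'a, nat) gset set \<Rightarrow>\<^sub>0 rat) set" where
  "descent_to_burnside \<Phi> \<Delta> f =
     (let B = burnside (weyl_group \<Phi>) in
      finsum B (\<lambda>C. Poly_Mapping.lookup f C \<odot>\<^bsub>B\<^esub> parabolic_class \<Phi> (class_rep \<Phi> \<Delta> C))
        (Poly_Mapping.keys f))"

end

theory Submission
  imports Defs
begin

text \<open>
  The theorem holds for every finite root system \<open>\<Phi>\<close> with simple system \<open>\<Delta>\<close> and Weyl group \<open>W\<close>, and it
  is proved in this generality (locale \<open>simple_system\<close>); type A is the special case
  \<open>type_A_simple_system\<close>.

  The map \<open>\<phi>\<close> is multiplicative because of Mackey's formula (\<open>mackey_decomposition\<close>). The orbits of \<open>W\<close> on
  \<open>W/W\<^sub>J \<times> W/W\<^sub>K\<close> correspond to the double cosets \<open>W\<^sub>JwW\<^sub>K\<close>. Each of these contains exactly one element \<open>w\<close>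
  of \<open>X\<^sub>J\<^sub>K\<close>, and the orbit of \<open>w\<close> is a coset space of \<open>W\<^sub>K \<inter> w\<^sup>-\<^sup>1W\<^sub>Jw\<close>. Both the uniqueness of \<open>w\<close> and the
  identification of this intersection with the parabolic subgroup of \<open>w\<^sup>-\<^sup>1(J) \<inter> K\<close> come out of a single
  induction on the number of inversions (\<open>double_coset_unique\<close>). Sorting the orbits by the set
  \<open>w\<^sup>-\<^sup>1(J) \<inter> K = L\<close> gives \<open>W/W\<^sub>J \<times> W/W\<^sub>K = \<Sum> a\<^sub>J\<^sub>K\<^sub>L W/W\<^sub>L\<close>.

  The map is injective because the \<open>W/W\<^sub>J\<close>, one for each class of subsets of \<open>\<Delta>\<close>, are linearly
  independent (\<open>lift_map_kernel\<close>). For a subgroup \<open>H\<close>, counting the \<open>H\<close>-fixed points of a \<open>W\<close>-set defines a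
  functional on the Burnside ring (\<open>mark_hom_burnside_ideal\<close>). If \<open>W\<^sub>J\<close> is at least as large as \<open>W\<^sub>K\<close> and
  has a fixed point on \<open>W/W\<^sub>K\<close>, then the two subgroups are conjugate, and conjugate standard parabolic
  subgroups belong to equivalent subsets of \<open>\<Delta>\<close> (\<open>conjugate_parabolic_equiv\<close>). So the table of marks is
  triangular with nonzero diagonal. Surjectivity is immediate from the definition of the parabolic
  Burnside ring.

  Injectivity also shows that the product \<open>[x\<^sub>J][x\<^sub>K]\<close> does not depend on the representatives of the two
  classes (\<open>descent_basis_mult\<close>): by Mackey's formula \<open>\<phi>\<close> maps it to the class of \<open>W/W\<^sub>J \<times> W/W\<^sub>K\<close>, whatever
  the choice.
\<close>

section \<open>Linear extension in free modules\<close>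

lemma lookup_scale [simp]: "Poly_Mapping.lookup (scale c f) x = c * Poly_Mapping.lookup f x"
  unfolding scale_def by (simp add: Poly_Mapping.map.rep_eq when_def)

lemma keys_scale: "Poly_Mapping.keys (scale c f) \<subseteq> Poly_Mapping.keys f"
  by (auto simp: in_keys_iff)

lemma scale_single [simp]: "scale c (Poly_Mapping.single x a) = Poly_Mapping.single x (c * a)"
  by (rule poly_mapping_eqI) (simp add: lookup_single when_def)

interpretation scale: Modules.module "scale :: 'k::comm_ring_1 \<Rightarrow> ('x \<Rightarrow>\<^sub>0 'k) \<Rightarrow> 'x \<Rightarrow>\<^sub>0 'k"
  by unfold_locales (auto intro!: poly_mapping_eqI simp: lookup_add algebra_simps)

lemma module_mult: "Modules.module ((*) :: 'k::comm_ring_1 \<Rightarrow> 'k \<Rightarrow> 'k)"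
  by unfold_locales (simp_all add: algebra_simps)

text \<open>
  The scalar multiplication \<open>s\<close> of the target is a parameter, so that the same extension serves for
  maps into free modules and for functionals with values in the coefficient ring.
\<close>

definition lin_ext :: "('k::comm_ring_1 \<Rightarrow> 'm \<Rightarrow> 'm) \<Rightarrow> ('x \<Rightarrow> 'm) \<Rightarrow> ('x \<Rightarrow>\<^sub>0 'k) \<Rightarrow> 'm::ab_group_add" where
  "lin_ext s \<beta> f = (\<Sum>x\<in>Poly_Mapping.keys f. s (Poly_Mapping.lookup f x) (\<beta> x))"

context Modules.module
begin

lemma lin_ext_superset:
  assumes "finite S" "Poly_Mapping.keys f \<subseteq> S"
  shows "lin_ext scale \<beta> f = (\<Sum>x\<in>S. Poly_Mapping.lookup f x *s \<beta> x)"
  unfolding lin_ext_def by (rule sum.mono_neutral_left) (use assms in \<open>auto simp: in_keys_iff\<close>)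

lemma lin_ext_add: "lin_ext scale \<beta> (f + g) = lin_ext scale \<beta> f + lin_ext scale \<beta> g"
proof -
  let ?S = "Poly_Mapping.keys f \<union> Poly_Mapping.keys g"
  have "lin_ext scale \<beta> (f + g) = (\<Sum>x\<in>?S. Poly_Mapping.lookup (f + g) x *s \<beta> x)"
    by (rule lin_ext_superset) (use Poly_Mapping.keys_add[of f g] in auto)
  then show ?thesis
    by (simp add: lin_ext_superset[of ?S f] lin_ext_superset[of ?S g] lookup_add scale_left_distrib sum.distrib)
qed

lemma lin_ext_scale: "lin_ext scale \<beta> (Defs.scale c f) = c *s lin_ext scale \<beta> f"
  by (subst lin_ext_superset[OF _ keys_scale])
    (simp_all add: lin_ext_def scale_sum_right scale_scale)

lemma module_hom_lin_ext: "module_hom Defs.scale scale (lin_ext scale \<beta>)"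
  by unfold_locales (simp_all add: lin_ext_add lin_ext_scale scale.scale_right_distrib scale.scale_left_distrib
    scale_right_distrib scale_left_distrib)

lemma lin_ext_single [simp]: "lin_ext scale \<beta> (Poly_Mapping.single x a) = a *s \<beta> x"
  by (simp add: lin_ext_def)

lemma lin_ext_cong:
  "(\<And>x. x \<in> Poly_Mapping.keys f \<Longrightarrow> \<beta> x = \<gamma> x) \<Longrightarrow> lin_ext scale \<beta> f = lin_ext scale \<gamma> f"
  by (simp add: lin_ext_def)

lemma lin_ext_add_fun: "lin_ext scale (\<lambda>x. \<beta> x + \<gamma> x) f = lin_ext scale \<beta> f + lin_ext scale \<gamma> f"
  by (simp add: lin_ext_def scale_right_distrib sum.distrib)

lemma lin_ext_scale_fun: "lin_ext scale (\<lambda>x. c *s \<beta> x) f = c *s lin_ext scale \<beta> f"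
  by (simp add: lin_ext_def scale_sum_right scale_scale mult.commute)

end

lemma (in module_hom) lin_ext_image: "f (lin_ext s1 \<beta> p) = lin_ext s2 (\<lambda>x. f (\<beta> x)) p"
  by (simp add: lin_ext_def sum scale)

lemma lin_ext_single_id [simp]: "lin_ext scale (\<lambda>x. Poly_Mapping.single x 1) f = f"
  by (rule poly_mapping_eqI) (auto simp: lin_ext_def lookup_sum lookup_single when_def in_keys_iff)

lemma lin_ext_diff_fun:
  "lin_ext scale \<beta> f - lin_ext scale \<gamma> f = lin_ext scale (\<lambda>x. \<beta> x - \<gamma> x) f"
  by (simp add: lin_ext_def sum_subtractf scale.scale_right_diff_distrib)

lemma keys_lin_ext:
  assumes "\<And>x. x \<in> Poly_Mapping.keys f \<Longrightarrow> Poly_Mapping.keys (\<beta> x) \<subseteq> S"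
  shows "Poly_Mapping.keys (lin_ext scale \<beta> f) \<subseteq> S"
proof
  fix y assume "y \<in> Poly_Mapping.keys (lin_ext scale \<beta> f)"
  then obtain x where "x \<in> Poly_Mapping.keys f" "Poly_Mapping.lookup (\<beta> x) y \<noteq> 0"
    unfolding lin_ext_def lookup_sum lookup_scale lookup_not_eq_zero_eq_in_keys[symmetric]
    by (metis (no_types, lifting) mult_zero_left mult_zero_right sum.neutral)
  then show "y \<in> S" using assms[of x] by (auto simp: in_keys_iff subset_iff)
qed

text \<open>
  The multiplications of \<open>gset_ring\<close> and of \<open>new_descent_algebra\<close> are both of this form.
\<close>

definition bilin_ext :: "('x \<Rightarrow> 'y \<Rightarrow> 'z \<Rightarrow>\<^sub>0 'k) \<Rightarrow> ('x \<Rightarrow>\<^sub>0 'k) \<Rightarrow> ('y \<Rightarrow>\<^sub>0 'k) \<Rightarrow> 'z \<Rightarrow>\<^sub>0 'k::comm_ring_1" where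
  "bilin_ext \<beta> f g = lin_ext scale (\<lambda>x. lin_ext scale (\<beta> x) g) f"

lemma bilin_ext_alt:
  "bilin_ext \<beta> f g = (\<Sum>x\<in>Poly_Mapping.keys f. \<Sum>y\<in>Poly_Mapping.keys g.
     scale (Poly_Mapping.lookup f x * Poly_Mapping.lookup g y) (\<beta> x y))"
  by (simp add: bilin_ext_def lin_ext_def scale.scale_sum_right)

lemma bilin_ext_linear_left: "module_hom scale scale (\<lambda>f. bilin_ext \<beta> f g)"
  unfolding bilin_ext_def by (rule scale.module_hom_lin_ext)

lemma bilin_ext_linear_right: "module_hom scale scale (bilin_ext \<beta> f)"
  by unfold_locales (simp_all add: bilin_ext_def scale.lin_ext_add scale.lin_ext_scale
      scale.lin_ext_add_fun scale.lin_ext_scale_fun)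

lemma bilin_ext_single [simp]: "bilin_ext \<beta> (Poly_Mapping.single x a) (Poly_Mapping.single y b) = scale (a * b) (\<beta> x y)"
  by (simp add: bilin_ext_def)

lemmas bilin_ext_simps =
  module_hom.add[OF bilin_ext_linear_left] module_hom.add[OF bilin_ext_linear_right]
  module_hom.scale[OF bilin_ext_linear_left] module_hom.scale[OF bilin_ext_linear_right]
  module_hom.zero[OF bilin_ext_linear_left] module_hom.zero[OF bilin_ext_linear_right]

text \<open>
  Both sides are trilinear, so it is enough to compare them on basis elements. The hypothesis is
  restricted to the supports because the product of classes of \<open>G\<close>-sets is associative only on
  actual isomorphism classes.
\<close>

lemma bilin_ext_assoc:
  fixes f :: "'x \<Rightarrow>\<^sub>0 'k::comm_ring_1"
  assumes "\<And>x y z. x \<in> Poly_Mapping.keys f \<Longrightarrow> y \<in> Poly_Mapping.keys g \<Longrightarrow> z \<in> Poly_Mapping.keys h \<Longrightarrow>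
    bilin_ext \<beta> (\<beta>' x y) (Poly_Mapping.single z 1) = bilin_ext \<gamma> (Poly_Mapping.single x 1) (\<gamma>' y z)"
  shows "bilin_ext \<beta> (bilin_ext \<beta>' f g) h = bilin_ext \<gamma> f (bilin_ext \<gamma>' g h)"
proof -
  have left: "bilin_ext \<delta> p q = lin_ext scale (\<lambda>x. bilin_ext \<delta> (Poly_Mapping.single x 1) q) p"
    and right: "bilin_ext \<delta> p q = lin_ext scale (\<lambda>y. bilin_ext \<delta> p (Poly_Mapping.single y 1)) q"
    for \<delta> :: "'p \<Rightarrow> 'q \<Rightarrow> 'r \<Rightarrow>\<^sub>0 'k" and p q
    using module_hom.lin_ext_image[OF bilin_ext_linear_left[of \<delta> q], of "\<lambda>x. Poly_Mapping.single x 1" p]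
      module_hom.lin_ext_image[OF bilin_ext_linear_right[of \<delta> p], of "\<lambda>x. Poly_Mapping.single x 1" q]
    by simp_all
  have "bilin_ext \<beta> (bilin_ext \<beta>' f g) h
      = lin_ext scale (\<lambda>x. lin_ext scale (\<lambda>y. bilin_ext \<beta> (\<beta>' x y) h) g) f"
    unfolding bilin_ext_def[of \<beta>'] by (simp only: module_hom.lin_ext_image[OF bilin_ext_linear_left])
  also have "\<dots> = lin_ext scale (\<lambda>x. lin_ext scale (\<lambda>y. lin_ext scale
          (\<lambda>z. bilin_ext \<beta> (\<beta>' x y) (Poly_Mapping.single z 1)) h) g) f"
    by (intro scale.lin_ext_cong right)
  also have "\<dots> = lin_ext scale (\<lambda>x. lin_ext scale (\<lambda>y. lin_ext scale
          (\<lambda>z. bilin_ext \<gamma> (Poly_Mapping.single x 1) (\<gamma>' y z)) h) g) f"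
    by (intro scale.lin_ext_cong assms)
  also have "\<dots> = lin_ext scale (\<lambda>x. bilin_ext \<gamma> (Poly_Mapping.single x 1) (bilin_ext \<gamma>' g h)) f"
    unfolding bilin_ext_def[of \<gamma>'] by (simp only: module_hom.lin_ext_image[OF bilin_ext_linear_right])
  also have "\<dots> = bilin_ext \<gamma> f (bilin_ext \<gamma>' g h)" by (rule left[symmetric])
  finally show ?thesis .
qed

section \<open>Finite sets with a group action\<close>

lemma finite_gsetD:
  assumes "finite_gset G A"
  shows finite_gset_finite: "finite (fst A)"
    and finite_gset_closed: "g \<in> carrier G \<Longrightarrow> x \<in> fst A \<Longrightarrow> snd A g x \<in> fst A"
    and finite_gset_one: "x \<in> fst A \<Longrightarrow> snd A \<one>\<^bsub>G\<^esub> x = x"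
    and finite_gset_mult: "g \<in> carrier G \<Longrightarrow> h \<in> carrier G \<Longrightarrow> x \<in> fst A \<Longrightarrow>
      snd A (g \<otimes>\<^bsub>G\<^esub> h) x = snd A g (snd A h x)"
proof -
  interpret group_action G "fst A" "snd A" using assms by (simp add: finite_gset_def)
  show "finite (fst A)" using assms by (simp add: finite_gset_def)
  show "g \<in> carrier G \<Longrightarrow> x \<in> fst A \<Longrightarrow> snd A g x \<in> fst A" by (simp add: element_image)
  show "x \<in> fst A \<Longrightarrow> snd A \<one>\<^bsub>G\<^esub> x = x" using id_eq_one by (metis restrict_apply')
  show "g \<in> carrier G \<Longrightarrow> h \<in> carrier G \<Longrightarrow> x \<in> fst A \<Longrightarrow>
      snd A (g \<otimes>\<^bsub>G\<^esub> h) x = snd A g (snd A h x)" by (simp add: composition_rule)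
qed

lemma gset_isomorphic_trans:
  assumes "gset_isomorphic G A B" "gset_isomorphic G B C"
  shows "gset_isomorphic G A C"
proof -
  obtain f h where f: "bij_betw f (fst A) (fst B)" "\<forall>g\<in>carrier G. \<forall>x\<in>fst A. f (snd A g x) = snd B g (f x)"
    and h: "bij_betw h (fst B) (fst C)" "\<forall>g\<in>carrier G. \<forall>x\<in>fst B. h (snd B g x) = snd C g (h x)"
    using assms unfolding gset_isomorphic_def by blast
  show ?thesis unfolding gset_isomorphic_def
    by (rule exI[of _ "h \<circ> f"]) (use f h bij_betw_trans bij_betwE[OF f(1)] in fastforce)
qed

context group
begin

text \<open>
  Each \<open>g\<close> acts bijectively, with the action of its inverse as two-sided inverse.
\<close>

lemma finite_gsetI:
  assumes "finite Y"
    and closed: "\<And>g x. g \<in> carrier G \<Longrightarrow> x \<in> Y \<Longrightarrow> a g x \<in> Y"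
    and one: "\<And>x. x \<in> Y \<Longrightarrow> a \<one> x = x"
    and mult: "\<And>g h x. g \<in> carrier G \<Longrightarrow> h \<in> carrier G \<Longrightarrow> x \<in> Y \<Longrightarrow> a (g \<otimes> h) x = a g (a h x)"
    and ext: "\<And>g x. g \<in> carrier G \<Longrightarrow> x \<notin> Y \<Longrightarrow> a g x = undefined"
  shows "finite_gset G (Y, a)"
proof -
  have bij: "a g \<in> Bij Y" if g: "g \<in> carrier G" for g
  proof -
    have "a (inv g) (a g x) = x" "a g (a (inv g) x) = x" if "x \<in> Y" for x
      using mult[of "inv g" g x] mult[of g "inv g" x] that one g by auto
    then have "bij_betw (a g) Y Y"
      by (intro bij_betw_byWitness[of _ "a (inv g)"]) (use closed g in auto)
    then show ?thesis using ext g by (auto simp: Bij_def extensional_def)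
  qed
  have "a \<in> hom G (BijGroup Y)"
  proof (rule homI)
    show "a g \<in> carrier (BijGroup Y)" if "g \<in> carrier G" for g
      using bij[OF that] by (simp add: BijGroup_def)
    show "a (g \<otimes> h) = a g \<otimes>\<^bsub>BijGroup Y\<^esub> a h" if "g \<in> carrier G" "h \<in> carrier G" for g h
      using that bij mult ext by (auto simp: BijGroup_def compose_def fun_eq_iff restrict_def)
  qed
  then have "group_action G Y a"
    unfolding group_action_def group_hom_def group_hom_axioms_def
    by (simp add: group_BijGroup is_group)
  then show ?thesis using assms(1) by (simp add: finite_gset_def)
qed

lemma gset_isomorphic_sym:
  assumes A: "finite_gset G A" and iso: "gset_isomorphic G A B"
  shows "gset_isomorphic G B A"
proof -
  obtain f where f: "bij_betw f (fst A) (fst B)" "\<And>g x. g\<in>carrier G \<Longrightarrow> x\<in>fst A \<Longrightarrow> f (snd A g x) = snd B g (f x)"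
    using iso unfolding gset_isomorphic_def by blast
  let ?h = "inv_into (fst A) f"
  have "?h (snd B g y) = snd A g (?h y)" if g: "g \<in> carrier G" and y: "y \<in> fst B" for g y
  proof -
    obtain x where x: "x \<in> fst A" "y = f x" using y bij_betw_imp_surj_on[OF f(1)] by blast
    have "inj_on f (fst A)" using f(1) by (simp add: bij_betw_def)
    then show ?thesis
      using x g f(2)[of g x] finite_gset_closed[OF A, of g x]
      by (simp add: inv_into_f_f flip: f(2))
  qed
  moreover have "bij_betw ?h (fst B) (fst A)" using f(1) by (rule bij_betw_inv_into)
  ultimately show ?thesis unfolding gset_isomorphic_def by blast
qed

text \<open>
  The action is transported along a bijection with an initial segment of the natural numbers. This
  is what makes \<open>gset_class\<close> meaningful for \<open>G\<close>-sets of any type.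
\<close>

lemma nat_gset_exists:
  fixes A :: "('a, 'x) gset"
  assumes A: "finite_gset G A"
  obtains N :: "('a, nat) gset" where "finite_gset G N" "gset_isomorphic G A N"
proof -
  obtain f where f: "bij_betw f {0..<card (fst A)} (fst A)"
    using ex_bij_betw_nat_finite[OF finite_gset_finite[OF A]] by blast
  define Y where "Y = {0..<card (fst A)}"
  define k where "k = inv_into Y f"
  have fk: "f (k x) = x" "k x \<in> Y" if "x \<in> fst A" for x
    using f that bij_betw_inv_into[OF f] bij_betw_inv_into_right[OF f] by (auto simp: k_def Y_def bij_betw_def)
  have kf: "k (f i) = i" "f i \<in> fst A" if "i \<in> Y" for i
    using f that bij_betw_inv_into_left[OF f] by (auto simp: k_def Y_def bij_betw_def)
  define a where "a = (\<lambda>g. restrict (\<lambda>i. k (snd A g (f i))) Y)"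
  have "finite_gset G (Y, a)"
    by (rule finite_gsetI) (auto simp: a_def fk kf finite_gsetD[OF A], auto simp: Y_def)
  moreover have "gset_isomorphic G A (Y, a)"
    unfolding gset_isomorphic_def
    by (rule exI[of _ k]) (use bij_betw_inv_into[OF f] in
        \<open>auto simp: a_def fk kf finite_gsetD[OF A] k_def[symmetric] Y_def[symmetric]\<close>)
  ultimately show thesis by (rule that)
qed

lemma gset_class_eqI:
  assumes "finite_gset G A" "gset_isomorphic G A B"
  shows "gset_class G A = gset_class G B"
proof -
  have "gset_isomorphic G A C \<longleftrightarrow> gset_isomorphic G B C" for C :: "('a, nat) gset"
    using gset_isomorphic_trans[OF gset_isomorphic_sym[OF assms]] gset_isomorphic_trans[OF assms(2)] by blast
  then show ?thesis by (simp add: gset_class_def)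
qed

lemma gset_class_in_classes: "finite_gset G A \<Longrightarrow> gset_class G A \<in> gset_classes G"
  by (metis (mono_tags) gset_class_eqI gset_classes_def image_eqI mem_Collect_eq nat_gset_exists)

lemma gset_classesE:
  assumes "C \<in> gset_classes G"
  obtains A :: "('a, nat) gset" where "finite_gset G A" "C = gset_class G A"
  using assms unfolding gset_classes_def by blast

lemma finite_gset_prod:
  assumes A: "finite_gset G A" and B: "finite_gset G B"
  shows "finite_gset G (gset_prod A B)"
  unfolding gset_prod_def
  by (rule finite_gsetI) (auto simp: finite_gsetD[OF A] finite_gsetD[OF B])

lemma Plus_mem_iff [simp]:
  "Inl a \<in> A <+> B \<longleftrightarrow> a \<in> A" "Inr b \<in> A <+> B \<longleftrightarrow> b \<in> B"
  by (auto elim: PlusE)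

lemma finite_gset_sum:
  assumes A: "finite_gset G A" and B: "finite_gset G B"
  shows "finite_gset G (gset_sum A B)"
  unfolding gset_sum_def
proof (rule finite_gsetI)
  let ?Y = "fst A <+> fst B" and ?a = "\<lambda>g. restrict (map_sum (snd A g) (snd B g)) (fst A <+> fst B)"
  show "finite ?Y" by (simp add: finite_gset_finite[OF A] finite_gset_finite[OF B])
  show closed: "?a g x \<in> ?Y" if "g \<in> carrier G" "x \<in> ?Y" for g x
    using that by (cases x) (simp_all add: finite_gset_closed[OF A] finite_gset_closed[OF B])
  show "?a \<one> x = x" if "x \<in> ?Y" for x
    using that by (cases x) (simp_all add: finite_gset_one[OF A] finite_gset_one[OF B])
  show "?a (g \<otimes> h) x = ?a g (?a h x)" if "g \<in> carrier G" "h \<in> carrier G" "x \<in> ?Y" for g h x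
    using that closed[of h x]
    by (cases x) (simp_all add: finite_gset_mult[OF A] finite_gset_mult[OF B])
qed simp

lemma finite_gset_point: "finite_gset G gset_point"
  unfolding gset_point_def by (rule finite_gsetI) auto

lemma finite_gset_restrict:
  assumes A: "finite_gset G A" and Y: "Y \<subseteq> fst A"
    and stable: "\<And>g x. g \<in> carrier G \<Longrightarrow> x \<in> Y \<Longrightarrow> snd A g x \<in> Y"
  shows "finite_gset G (Y, \<lambda>g. restrict (snd A g) Y)"
proof (rule finite_gsetI)
  show "finite Y" by (rule finite_subset[OF Y finite_gset_finite[OF A]])
  show "restrict (snd A \<one>) Y x = x" if "x \<in> Y" for x
    using that Y finite_gset_one[OF A, of x] by auto
  show "restrict (snd A (g \<otimes> h)) Y x = restrict (snd A g) Y (restrict (snd A h) Y x)"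
    if "g \<in> carrier G" "h \<in> carrier G" "x \<in> Y" for g h x
    using that Y stable[of h x] finite_gset_mult[OF A, of g h x] by auto
qed (simp_all add: stable)

lemma gset_prod_isomorphic:
  assumes "gset_isomorphic G A A'" "gset_isomorphic G B B'"
  shows "gset_isomorphic G (gset_prod A B) (gset_prod A' B')"
proof -
  obtain f h where f: "bij_betw f (fst A) (fst A')" "\<forall>g\<in>carrier G. \<forall>x\<in>fst A. f (snd A g x) = snd A' g (f x)"
    and h: "bij_betw h (fst B) (fst B')" "\<forall>g\<in>carrier G. \<forall>x\<in>fst B. h (snd B g x) = snd B' g (h x)"
    using assms unfolding gset_isomorphic_def by blast
  have "bij_betw (map_prod f h) (fst A \<times> fst B) (fst A' \<times> fst B')"
    using f(1) h(1) by (rule bij_betw_map_prod)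
  moreover have "map_prod f h (snd (gset_prod A B) g x) = snd (gset_prod A' B') g (map_prod f h x)"
    if "g \<in> carrier G" "x \<in> fst A \<times> fst B" for g x
    using that f(2) h(2) bij_betwE[OF f(1)] bij_betwE[OF h(1)]
    by (cases x) (simp add: gset_prod_def)
  ultimately show ?thesis unfolding gset_isomorphic_def
    by (intro exI[of _ "map_prod f h"]) (simp add: gset_prod_def)
qed

lemma gset_sum_isomorphic:
  assumes "gset_isomorphic G A A'" "gset_isomorphic G B B'"
  shows "gset_isomorphic G (gset_sum A B) (gset_sum A' B')"
proof -
  obtain f h where f: "bij_betw f (fst A) (fst A')" "\<forall>g\<in>carrier G. \<forall>x\<in>fst A. f (snd A g x) = snd A' g (f x)"
    and h: "bij_betw h (fst B) (fst B')" "\<forall>g\<in>carrier G. \<forall>x\<in>fst B. h (snd B g x) = snd B' g (h x)"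
    using assms unfolding gset_isomorphic_def by blast
  have "inj_on (map_sum f h) (fst A <+> fst B)"
    by (rule inj_onI)
      (auto elim!: PlusE dest: inj_onD[OF bij_betw_imp_inj_on[OF f(1)]] inj_onD[OF bij_betw_imp_inj_on[OF h(1)]])
  moreover have "map_sum f h ` (fst A <+> fst B) = f ` fst A <+> h ` fst B"
    unfolding Plus_def by (simp add: image_Un image_image)
  ultimately have "bij_betw (map_sum f h) (fst A <+> fst B) (fst A' <+> fst B')"
    using f(1) h(1) by (simp add: bij_betw_def)
  moreover have "map_sum f h (snd (gset_sum A B) g x) = snd (gset_sum A' B') g (map_sum f h x)"
    if "g \<in> carrier G" "x \<in> fst A <+> fst B" for g x
    using that f(2) h(2) bij_betwE[OF f(1)] bij_betwE[OF h(1)]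
    by (cases x) (simp_all add: gset_sum_def)
  ultimately show ?thesis unfolding gset_isomorphic_def
    by (intro exI[of _ "map_sum f h"]) (simp add: gset_sum_def)
qed

lemma gset_class_memD: "B \<in> gset_class G A \<Longrightarrow> finite_gset G B \<and> gset_isomorphic G A B"
  by (simp add: gset_class_def)

lemma gset_class_prod_class:
  assumes A: "finite_gset G A" and B: "finite_gset G B"
  shows "gset_class_prod G (gset_class G A) (gset_class G B) = gset_class G (gset_prod A B)"
proof -
  have "gset_class G (gset_prod A' B') = gset_class G (gset_prod A B)"
    if "A' \<in> gset_class G A" "B' \<in> gset_class G B" for A' B'
  proof -
    have "gset_isomorphic G (gset_prod A B) (gset_prod A' B')"
      using that by (intro gset_prod_isomorphic) (simp_all add: gset_class_def)
    from gset_class_eqI[OF finite_gset_prod[OF A B] this] show ?thesis ..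
  qed
  moreover obtain A' where "A' \<in> gset_class G A"
    by (rule nat_gset_exists[OF A]) (simp add: gset_class_def)
  moreover obtain B' where "B' \<in> gset_class G B"
    by (rule nat_gset_exists[OF B]) (simp add: gset_class_def)
  ultimately show ?thesis unfolding gset_class_prod_def by blast
qed

lemma gset_class_prod_closed:
  "C \<in> gset_classes G \<Longrightarrow> D \<in> gset_classes G \<Longrightarrow> gset_class_prod G C D \<in> gset_classes G"
  by (elim gset_classesE) (simp add: gset_class_prod_class finite_gset_prod gset_class_in_classes)

lemma gset_class_prod_assoc:
  assumes "C \<in> gset_classes G" "D \<in> gset_classes G" "E \<in> gset_classes G"
  shows "gset_class_prod G (gset_class_prod G C D) E = gset_class_prod G C (gset_class_prod G D E)"
proof -
  obtain A B F :: "('a, nat) gset" where *: "finite_gset G A" "C = gset_class G A" "finite_gset G B" "D = gset_class G B"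
    "finite_gset G F" "E = gset_class G F" using assms by (elim gset_classesE) auto
  have "gset_isomorphic G (gset_prod (gset_prod A B) F) (gset_prod A (gset_prod B F))"
    unfolding gset_isomorphic_def gset_prod_def
    by (intro exI[of _ "\<lambda>((x,y),z). (x,(y,z))"] conjI bij_betw_byWitness[of _ "\<lambda>(x,(y,z)). ((x,y),z)"])
       (auto simp: finite_gset_closed *)
  then show ?thesis
    by (simp add: * gset_class_prod_class finite_gset_prod gset_class_eqI)
qed

lemma gset_class_prod_one:
  assumes "C \<in> gset_classes G"
  shows "gset_class_prod G (gset_class G gset_point) C = C"
    and "gset_class_prod G C (gset_class G gset_point) = C"
proof -
  obtain A :: "('a, nat) gset" where *: "finite_gset G A" "C = gset_class G A" using assms by (rule gset_classesE)
  have 1: "gset_isomorphic G (gset_prod gset_point A) A"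
    unfolding gset_isomorphic_def gset_prod_def gset_point_def
    by (intro exI[of _ snd] conjI bij_betw_byWitness[of _ "\<lambda>x. ((),x)"]) auto
  have 2: "gset_isomorphic G (gset_prod A gset_point) A"
    unfolding gset_isomorphic_def gset_prod_def gset_point_def
    by (intro exI[of _ fst] conjI bij_betw_byWitness[of _ "\<lambda>x. (x,())"]) auto
  show "gset_class_prod G (gset_class G gset_point) C = C" "gset_class_prod G C (gset_class G gset_point) = C"
    using gset_class_eqI[OF _ 1] gset_class_eqI[OF _ 2]
    by (simp_all add: * gset_class_prod_class finite_gset_prod finite_gset_point)
qed

section \<open>The Burnside ring\<close>

lemma gset_ring_mult:
  "f \<otimes>\<^bsub>gset_ring G\<^esub> h = bilin_ext (\<lambda>C D. Poly_Mapping.single (gset_class_prod G C D) 1) f h"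
  by (simp add: gset_ring_def bilin_ext_alt)

lemma gset_ring_simps [simp]:
  "carrier (gset_ring G) = {f. Poly_Mapping.keys f \<subseteq> gset_classes G}"
  "\<zero>\<^bsub>gset_ring G\<^esub> = 0"
  "f \<oplus>\<^bsub>gset_ring G\<^esub> h = f + h"
  "\<one>\<^bsub>gset_ring G\<^esub> = gset_basis G gset_point"
  by (simp_all add: gset_ring_def gset_basis_def)

lemma gset_ring_is_ring: "ring (gset_ring G :: (('a, nat) gset set \<Rightarrow>\<^sub>0 'k::comm_ring_1) ring)"
  (is "ring ?R")
proof (rule ringI)
  have keys_sub: "Poly_Mapping.keys (f + g) \<subseteq> S" if "Poly_Mapping.keys f \<subseteq> S" "Poly_Mapping.keys g \<subseteq> S"
    for f g :: "('a, nat) gset set \<Rightarrow>\<^sub>0 'k" and S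
    using that Poly_Mapping.keys_add[of f g] by blast
  show "abelian_group ?R"
  proof (rule abelian_groupI)
    show "\<exists>y\<in>carrier ?R. y \<oplus>\<^bsub>?R\<^esub> x = \<zero>\<^bsub>?R\<^esub>" if "x \<in> carrier ?R" for x
      using that by (intro bexI[of _ "- x"]) auto
  next
    show "x \<oplus>\<^bsub>?R\<^esub> y \<in> carrier ?R" if "x \<in> carrier ?R" "y \<in> carrier ?R" for x y
      using that keys_sub by simp
  qed (simp_all add: ac_simps)
  show "Group.monoid ?R"
  proof (rule monoidI)
    fix f g h assume f: "f \<in> carrier ?R" and g: "g \<in> carrier ?R" and h: "h \<in> carrier ?R"
    show "f \<otimes>\<^bsub>?R\<^esub> g \<in> carrier ?R" using f g
      unfolding gset_ring_mult bilin_ext_def gset_ring_simps mem_Collect_eq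
      by (intro keys_lin_ext) (auto intro!: gset_class_prod_closed split: if_splits)
    show "f \<otimes>\<^bsub>?R\<^esub> g \<otimes>\<^bsub>?R\<^esub> h = f \<otimes>\<^bsub>?R\<^esub> (g \<otimes>\<^bsub>?R\<^esub> h)"
      unfolding gset_ring_mult
      by (rule bilin_ext_assoc) (use f g h in \<open>auto simp: gset_class_prod_assoc subset_iff\<close>)
  next
    fix f assume f: "f \<in> carrier ?R"
    have "lin_ext scale (\<lambda>D. Poly_Mapping.single (gset_class_prod G (gset_class G gset_point) D) 1) f
        = lin_ext scale (\<lambda>D. Poly_Mapping.single D 1) f"
      by (rule scale.lin_ext_cong) (use f gset_class_prod_one in auto)
    then show "\<one>\<^bsub>?R\<^esub> \<otimes>\<^bsub>?R\<^esub> f = f"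
      by (simp add: gset_ring_mult bilin_ext_def gset_basis_def)
    have "lin_ext scale (\<lambda>C. Poly_Mapping.single (gset_class_prod G C (gset_class G gset_point)) 1) f
        = lin_ext scale (\<lambda>C. Poly_Mapping.single C 1) f"
      by (rule scale.lin_ext_cong) (use f gset_class_prod_one in auto)
    then show "f \<otimes>\<^bsub>?R\<^esub> \<one>\<^bsub>?R\<^esub> = f"
      by (simp add: gset_ring_mult bilin_ext_def gset_basis_def)
  qed (auto simp: gset_basis_def finite_gset_point gset_class_in_classes)
qed (simp_all add: gset_ring_mult bilin_ext_simps)

lemma gset_basis_carrier: "finite_gset G A \<Longrightarrow> gset_basis G A \<in> carrier (gset_ring G)"
  by (auto simp: gset_basis_def gset_class_in_classes)

lemma gset_basis_iso: "finite_gset G A \<Longrightarrow> gset_isomorphic G A B \<Longrightarrow> gset_basis G A = gset_basis G B"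
  by (simp add: gset_basis_def gset_class_eqI)

lemma gset_basis_mult:
  "finite_gset G A \<Longrightarrow> finite_gset G B \<Longrightarrow>
    gset_basis G A \<otimes>\<^bsub>gset_ring G\<^esub> gset_basis G B = gset_basis G (gset_prod A B)"
  by (simp add: gset_ring_mult gset_basis_def gset_class_prod_class)

lemma gset_ring_minus_closed:
  fixes f h :: "('a, nat) gset set \<Rightarrow>\<^sub>0 'k::comm_ring_1"
  assumes "f \<in> carrier (gset_ring G)" "h \<in> carrier (gset_ring G)"
  shows "f - h \<in> carrier (gset_ring G)"
proof -
  have "t \<in> gset_classes G" if "t \<in> Poly_Mapping.keys (f - h)" for t
  proof -
    have "t \<in> Poly_Mapping.keys f \<union> Poly_Mapping.keys h"
      using that by (auto simp: in_keys_iff lookup_minus)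
    then show ?thesis using assms by auto
  qed
  then show ?thesis by auto
qed

lemma gset_ring_a_minus:
  fixes f h :: "('a, nat) gset set \<Rightarrow>\<^sub>0 'k::comm_ring_1"
  assumes "f \<in> carrier (gset_ring G)" "h \<in> carrier (gset_ring G)"
  shows "f \<ominus>\<^bsub>gset_ring G\<^esub> h = f - h"
proof -
  interpret R: ring "gset_ring G :: (('a, nat) gset set \<Rightarrow>\<^sub>0 'k) ring" by (rule gset_ring_is_ring)
  have "\<ominus>\<^bsub>gset_ring G\<^esub> h = - h"
    by (rule R.minus_equality) (use assms in auto)
  then show ?thesis by (simp add: a_minus_def)
qed

lemma gset_ring_scale_closed:
  "f \<in> carrier (gset_ring G) \<Longrightarrow> scale c f \<in> carrier (gset_ring G)"
  using keys_scale[of c f] by auto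

lemma gset_ring_sum_closed:
  "(\<And>i. i \<in> S \<Longrightarrow> f i \<in> carrier (gset_ring G)) \<Longrightarrow> sum f S \<in> carrier (gset_ring G)"
proof (induction S rule: infinite_finite_induct)
  case (insert i S)
  then show ?case using Poly_Mapping.keys_add[of "f i" "sum f S"] by auto
qed auto

lemma burnside_relations_carrier: "burnside_relations G \<subseteq> carrier (gset_ring G)"
proof
  fix f :: "('a, nat) gset set \<Rightarrow>\<^sub>0 'k::comm_ring_1"
  assume "f \<in> burnside_relations G"
  then obtain A B :: "('a, nat) gset" where *: "finite_gset G A" "finite_gset G B"
    "f = gset_basis G (gset_sum A B) - (gset_basis G A + gset_basis G B)"
    unfolding burnside_relations_def by blast
  interpret R: ring "gset_ring G :: (('a, nat) gset set \<Rightarrow>\<^sub>0 'k) ring" by (rule gset_ring_is_ring)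
  have "gset_basis G A + gset_basis G B \<in> carrier (gset_ring G :: (('a, nat) gset set \<Rightarrow>\<^sub>0 'k) ring)"
    using R.a_closed[OF gset_basis_carrier[OF *(1)] gset_basis_carrier[OF *(2)]] by simp
  then show "f \<in> carrier (gset_ring G)"
    unfolding *(3) by (intro gset_ring_minus_closed gset_basis_carrier finite_gset_sum *)
qed

lemma ideal_burnside: "ideal (burnside_ideal G) (gset_ring G :: (('a, nat) gset set \<Rightarrow>\<^sub>0 'k::comm_ring_1) ring)"
  unfolding burnside_ideal_def by (rule ring.genideal_ideal[OF gset_ring_is_ring burnside_relations_carrier])

lemma burnside_ideal_carrier: "f \<in> burnside_ideal G \<Longrightarrow> f \<in> carrier (gset_ring G)"
  using ideal.Icarr[OF ideal_burnside] .

lemma burnside_ideal_add: "f \<in> burnside_ideal G \<Longrightarrow> h \<in> burnside_ideal G \<Longrightarrow> f + h \<in> burnside_ideal G"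
  using additive_subgroup.a_closed[OF ideal.axioms(1)[OF ideal_burnside]] by simp

lemma burnside_ideal_zero: "0 \<in> burnside_ideal G"
  using additive_subgroup.zero_closed[OF ideal.axioms(1)[OF ideal_burnside]] by simp

text \<open>
  Scaling by \<open>c\<close> is multiplication by \<open>c\<close> times the unit, so the ideal is a submodule.
\<close>

lemma burnside_ideal_scale:
  fixes f :: "('a, nat) gset set \<Rightarrow>\<^sub>0 'k::comm_ring_1"
  assumes f: "f \<in> burnside_ideal G"
  shows "scale c f \<in> burnside_ideal G"
proof -
  interpret R: ring "gset_ring G :: (('a, nat) gset set \<Rightarrow>\<^sub>0 'k) ring" by (rule gset_ring_is_ring)
  have "scale c (\<one>\<^bsub>gset_ring G\<^esub> :: ('a, nat) gset set \<Rightarrow>\<^sub>0 'k) \<otimes>\<^bsub>gset_ring G\<^esub> f = scale c (\<one>\<^bsub>gset_ring G\<^esub> \<otimes>\<^bsub>gset_ring G\<^esub> f)"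
    by (simp only: gset_ring_mult bilin_ext_simps)
  then have "scale c f = scale c \<one>\<^bsub>gset_ring G\<^esub> \<otimes>\<^bsub>gset_ring G\<^esub> f"
    using R.l_one[OF burnside_ideal_carrier[OF f]] by simp
  then show ?thesis
    using ideal.I_l_closed[OF ideal_burnside f gset_ring_scale_closed[OF R.one_closed, of c]] by simp
qed

lemma burnside_ideal_lin_ext:
  assumes "\<And>x. x \<in> Poly_Mapping.keys f \<Longrightarrow> \<beta> x \<in> burnside_ideal G"
  shows "lin_ext scale \<beta> f \<in> burnside_ideal G"
proof -
  have "(\<Sum>x\<in>S. scale (Poly_Mapping.lookup f x) (\<beta> x)) \<in> burnside_ideal G"
    if "finite S" "S \<subseteq> Poly_Mapping.keys f" for S
    using that
    by (induction S rule: finite_induct)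
      (simp_all add: burnside_ideal_zero burnside_ideal_add burnside_ideal_scale assms)
  then show ?thesis by (simp add: lin_ext_def)
qed

abbreviation burnside_proj :: "(('a, nat) gset set \<Rightarrow>\<^sub>0 'k::comm_ring_1) \<Rightarrow> (('a, nat) gset set \<Rightarrow>\<^sub>0 'k) set" where
  "burnside_proj f \<equiv> burnside_ideal G +>\<^bsub>gset_ring G\<^esub> f"

lemma burnside_proj_eq_iff:
  "f \<in> carrier (gset_ring G) \<Longrightarrow> h \<in> carrier (gset_ring G) \<Longrightarrow>
    burnside_proj f = burnside_proj h \<longleftrightarrow> f - h \<in> burnside_ideal G"
  using ring.quotient_eq_iff_same_a_r_cos[OF gset_ring_is_ring ideal_burnside, of f h]
    gset_ring_a_minus[of f h] by simp

lemma burnside_proj_mem: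
  fixes f :: "('a, nat) gset set \<Rightarrow>\<^sub>0 'k::comm_ring_1"
  shows "f' \<in> burnside_proj f \<longleftrightarrow> f' - f \<in> burnside_ideal G"
proof -
  have "f' \<in> burnside_proj f \<longleftrightarrow> (\<exists>i\<in>burnside_ideal G. f' = i + f)"
    by (simp add: a_r_coset_def' gset_ring_def)
  then show ?thesis by (auto intro!: bexI[of _ "f' - f"])
qed

text \<open>
  Every operation of \<open>burnside G\<close> is computed on representatives in the free module. From here on,
  equations in the Burnside ring are handled as membership of differences in the ideal.
\<close>

lemma burnside_simps:
  fixes f h :: "('a, nat) gset set \<Rightarrow>\<^sub>0 'k::comm_ring_1"
  shows burnside_carrier: "carrier (burnside G :: ('k, _) module) = burnside_proj ` carrier (gset_ring G)"
    and burnside_one: "\<one>\<^bsub>burnside G :: ('k, _) module\<^esub> = burnside_proj (gset_basis G gset_point)"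
    and burnside_zero: "\<zero>\<^bsub>burnside G :: ('k, _) module\<^esub> = burnside_proj 0"
    and burnside_add: "f \<in> carrier (gset_ring G) \<Longrightarrow> h \<in> carrier (gset_ring G) \<Longrightarrow>
      burnside_proj f \<oplus>\<^bsub>burnside G :: ('k, _) module\<^esub> burnside_proj h = burnside_proj (f + h)"
    and burnside_mult: "f \<in> carrier (gset_ring G) \<Longrightarrow> h \<in> carrier (gset_ring G) \<Longrightarrow>
      burnside_proj f \<otimes>\<^bsub>burnside G :: ('k, _) module\<^esub> burnside_proj h = burnside_proj (f \<otimes>\<^bsub>gset_ring G\<^esub> h)"
    and burnside_smult: "f \<in> carrier (gset_ring G) \<Longrightarrow>
      c \<odot>\<^bsub>burnside G :: ('k, _) module\<^esub> burnside_proj f = burnside_proj (scale c f)"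
proof -
  interpret I: ideal "burnside_ideal G" "gset_ring G :: (('a, nat) gset set \<Rightarrow>\<^sub>0 'k) ring" by (rule ideal_burnside)
  show "carrier (burnside G :: ('k, _) module) = burnside_proj ` carrier (gset_ring G)"
    by (simp add: burnside_def Let_def FactRing_def A_RCOSETS_def' UNION_singleton_eq_range del: gset_ring_simps)
  show "\<one>\<^bsub>burnside G :: ('k, _) module\<^esub> = burnside_proj (gset_basis G gset_point)"
    by (simp add: burnside_def Let_def FactRing_def)
  show "\<zero>\<^bsub>burnside G :: ('k, _) module\<^esub> = burnside_proj 0"
    using I.a_rcos_zero[OF ideal_burnside burnside_ideal_zero] by (simp add: burnside_def Let_def FactRing_def)
  show "burnside_proj f \<oplus>\<^bsub>burnside G :: ('k, _) module\<^esub> burnside_proj h = burnside_proj (f + h)"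
    if "f \<in> carrier (gset_ring G)" "h \<in> carrier (gset_ring G)"
    using I.a_rcos_sum[OF that] by (simp add: burnside_def Let_def FactRing_def)
  show "burnside_proj f \<otimes>\<^bsub>burnside G :: ('k, _) module\<^esub> burnside_proj h = burnside_proj (f \<otimes>\<^bsub>gset_ring G\<^esub> h)"
    if "f \<in> carrier (gset_ring G)" "h \<in> carrier (gset_ring G)"
    using I.rcoset_mult_add[OF that] by (simp add: burnside_def Let_def FactRing_def)
  show "c \<odot>\<^bsub>burnside G :: ('k, _) module\<^esub> burnside_proj f = burnside_proj (scale c f)"
    if f: "f \<in> carrier (gset_ring G)"
  proof -
    have "burnside_proj (scale c f') = burnside_proj (scale c f)" if f': "f' \<in> burnside_proj f" for f'
    proof -
      have d: "f' - f \<in> burnside_ideal G" using f' burnside_proj_mem by blast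
      have "f' = (f' - f) \<oplus>\<^bsub>gset_ring G\<^esub> f" by simp
      then have "f' \<in> carrier (gset_ring G)"
        using I.a_closed[OF burnside_ideal_carrier[OF d] f] by simp
      then show ?thesis
        using burnside_ideal_scale[OF d, of c] f burnside_proj_eq_iff[of "scale c f'" "scale c f"]
          gset_ring_scale_closed[of f' c] gset_ring_scale_closed[of f c]
        by (simp only: scale.scale_right_diff_distrib)
    qed
    then have "(\<Union>f'\<in>burnside_proj f. burnside_proj (scale c f')) = (\<Union>f'\<in>burnside_proj f. burnside_proj (scale c f))"
      by (rule SUP_cong[OF refl])
    moreover have "f \<in> burnside_proj f" by (simp add: burnside_proj_mem burnside_ideal_zero)
    ultimately show ?thesis by (auto simp only: burnside_def Let_def module.simps UN_constant split: if_splits)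
  qed
qed

lemma burnside_abelian_monoid: "abelian_monoid (burnside G :: ('k::comm_ring_1, _) module)"
proof -
  interpret Q: ring "gset_ring G Quot burnside_ideal G :: (('a, nat) gset set \<Rightarrow>\<^sub>0 'k) set ring"
    by (rule ideal.quotient_is_ring[OF ideal_burnside])
  show ?thesis
    by (rule abelian_monoidI)
      (simp_all add: burnside_def Let_def Q.a_assoc, simp add: Q.a_comm)
qed

lemma burnside_finsum:
  fixes h :: "'i \<Rightarrow> ('a, nat) gset set \<Rightarrow>\<^sub>0 'k::comm_ring_1"
  assumes "finite S" "\<And>i. i \<in> S \<Longrightarrow> h i \<in> carrier (gset_ring G)"
  shows "finsum (burnside G) (\<lambda>i. burnside_proj (h i)) S = burnside_proj (sum h S)"
proof -
  interpret B: abelian_monoid "burnside G :: ('k, _) module" by (rule burnside_abelian_monoid)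
  show ?thesis using assms
  proof (induction S rule: finite_induct)
    case empty
    then show ?case by (simp add: burnside_zero)
  next
    case (insert i S)
    have "finsum (burnside G) (\<lambda>i. burnside_proj (h i)) (insert i S)
        = burnside_proj (h i) \<oplus>\<^bsub>burnside G\<^esub> finsum (burnside G) (\<lambda>i. burnside_proj (h i)) S"
      by (rule B.finsum_insert) (use insert in \<open>auto simp: burnside_carrier simp del: gset_ring_simps\<close>)
    also have "\<dots> = burnside_proj (h i + sum h S)"
      using insert by (simp add: burnside_add gset_ring_sum_closed del: gset_ring_simps)
    finally show ?case using insert by simp
  qed
qed

section \<open>Decompositions of G-sets\<close>

text \<open>
  The defining relations only involve \<open>G\<close>-sets on the natural numbers; the general case is reduced to
  them by choosing isomorphic copies.
\<close>

lemma gset_sum_relation: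
  fixes A :: "('a, 'x) gset" and B :: "('a, 'y) gset"
  assumes A: "finite_gset G A" and B: "finite_gset G B"
  shows "gset_basis G (gset_sum A B) - (gset_basis G A + gset_basis G B)
    \<in> (burnside_ideal G :: (('a, nat) gset set \<Rightarrow>\<^sub>0 'k::comm_ring_1) set)"
proof -
  obtain A' :: "('a, nat) gset" where A': "finite_gset G A'" "gset_isomorphic G A A'"
    by (rule nat_gset_exists[OF A])
  obtain B' :: "('a, nat) gset" where B': "finite_gset G B'" "gset_isomorphic G B B'"
    by (rule nat_gset_exists[OF B])
  have "gset_basis G (gset_sum A' B') - (gset_basis G A' + gset_basis G B')
      \<in> (burnside_relations G :: (('a, nat) gset set \<Rightarrow>\<^sub>0 'k) set)"
    unfolding burnside_relations_def using A'(1) B'(1) by blast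
  then have "gset_basis G (gset_sum A' B') - (gset_basis G A' + gset_basis G B')
      \<in> (burnside_ideal G :: (('a, nat) gset set \<Rightarrow>\<^sub>0 'k) set)"
    unfolding burnside_ideal_def
    using ring.genideal_self[OF gset_ring_is_ring burnside_relations_carrier] by blast
  then show ?thesis
    unfolding gset_basis_iso[OF A A'(2)] gset_basis_iso[OF B B'(2)]
      gset_basis_iso[OF finite_gset_sum[OF A B] gset_sum_isomorphic[OF A'(2) B'(2)]] .
qed

text \<open>
  Since the empty set is isomorphic to its own double, the relation for it reads
  \<open>[\<emptyset>] - ([\<emptyset>] + [\<emptyset>])\<close>, which is \<open>- [\<emptyset>]\<close>.
\<close>

lemma gset_empty_relation:
  fixes A :: "('a, 'x) gset"
  assumes A: "finite_gset G A" and empty: "fst A = {}"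
  shows "gset_basis G A \<in> (burnside_ideal G :: (('a, nat) gset set \<Rightarrow>\<^sub>0 'k::comm_ring_1) set)"
proof -
  have "gset_isomorphic G (gset_sum A A) A"
    unfolding gset_isomorphic_def gset_sum_def
    by (rule exI[of _ "case_sum id id"]) (simp add: empty bij_betw_def Plus_def)
  note iso = gset_basis_iso[OF finite_gset_sum[OF A A] this]
  have "scale (- 1) (gset_basis G A) = gset_basis G A - (gset_basis G A + gset_basis G A)"
    by (simp add: gset_basis_def single_uminus)
  also have "\<dots> \<in> (burnside_ideal G :: (('a, nat) gset set \<Rightarrow>\<^sub>0 'k) set)"
    using gset_sum_relation[OF A A] unfolding iso .
  finally show ?thesis using burnside_ideal_scale[of "scale (- 1) (gset_basis G A)" "- 1"] by simp
qed

text \<open>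
  Induction on the number of pieces: the complement of the image of one piece is stable, being the
  union of the other images, and the binary relation splits it off.
\<close>

lemma gset_decomposition:
  fixes A :: "('a, 'x) gset" and B :: "'i \<Rightarrow> ('a, 'y) gset"
  assumes "finite S" and A: "finite_gset G A"
    and B: "\<And>i. i \<in> S \<Longrightarrow> finite_gset G (B i)"
    and inj: "\<And>i. i \<in> S \<Longrightarrow> inj_on (f i) (fst (B i))"
    and equivariant: "\<And>i g y. i \<in> S \<Longrightarrow> g \<in> carrier G \<Longrightarrow> y \<in> fst (B i) \<Longrightarrow> f i (snd (B i) g y) = snd A g (f i y)"
    and disjoint: "\<And>i j. i \<in> S \<Longrightarrow> j \<in> S \<Longrightarrow> i \<noteq> j \<Longrightarrow> f i ` fst (B i) \<inter> f j ` fst (B j) = {}"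
    and cover: "(\<Union>i\<in>S. f i ` fst (B i)) = fst A"
  shows "gset_basis G A - (\<Sum>i\<in>S. gset_basis G (B i))
    \<in> (burnside_ideal G :: (('a, nat) gset set \<Rightarrow>\<^sub>0 'k::comm_ring_1) set)"
  using assms
proof (induction S arbitrary: A rule: finite_induct)
  case empty
  then show ?case by (simp add: gset_empty_relation)
next
  case (insert j S)
  note A = \<open>finite_gset G A\<close>
  define Y where "Y = fst A - f j ` fst (B j)"
  define C where "C = (Y, \<lambda>g. restrict (snd A g) Y)"
  have "f j ` fst (B j) \<inter> f i ` fst (B i) = {}" if "i \<in> S" for i
    by (rule insert.prems(5)) (use that insert.hyps(2) in auto)
  then have "f j ` fst (B j) \<inter> (\<Union>i\<in>S. f i ` fst (B i)) = {}" by blast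
  moreover have "fst A = f j ` fst (B j) \<union> (\<Union>i\<in>S. f i ` fst (B i))"
    using insert.prems(6) by (simp only: UN_insert)
  ultimately have Y: "Y = (\<Union>i\<in>S. f i ` fst (B i))"
    unfolding Y_def by (simp only: Un_Diff) blast
  have Bj: "finite_gset G (B j)" using insert.prems by simp
  have YA: "Y \<subseteq> fst A" by (auto simp: Y_def)
  have stable: "snd A g x \<in> Y" if g: "g \<in> carrier G" and x: "x \<in> Y" for g x
  proof -
    obtain i y where i: "i \<in> S" "y \<in> fst (B i)" "x = f i y" using x Y by blast
    then have "snd A g x = f i (snd (B i) g y)" using insert.prems(4)[of i g y] g by simp
    moreover have "snd (B i) g y \<in> fst (B i)"
      by (rule finite_gset_closed[OF insert.prems(2) g i(2)]) (use i in simp)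
    ultimately show ?thesis using Y i by blast
  qed
  have C: "finite_gset G C" unfolding C_def by (rule finite_gset_restrict[OF A YA stable])
  let ?I = "burnside_ideal G :: (('a, nat) gset set \<Rightarrow>\<^sub>0 'k) set"
  have "gset_basis G C - (\<Sum>i\<in>S. gset_basis G (B i)) \<in> ?I"
  proof (rule insert.IH[OF C])
    show "f i (snd (B i) g y) = snd C g (f i y)" if "i \<in> S" "g \<in> carrier G" "y \<in> fst (B i)" for i g y
    proof -
      have "f i y \<in> Y" using that Y by blast
      then show ?thesis using insert.prems(4)[of i g y] that by (simp add: C_def)
    qed
    show "(\<Union>i\<in>S. f i ` fst (B i)) = fst C" by (simp add: C_def Y)
    show "f i ` fst (B i) \<inter> f k ` fst (B k) = {}" if "i \<in> S" "k \<in> S" "i \<noteq> k" for i k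
      by (rule insert.prems(5)) (use that in auto)
  qed (rule insert.prems, simp)+
  moreover have "gset_isomorphic G (gset_sum (B j) C) A"
    unfolding gset_isomorphic_def
  proof (intro exI[of _ "case_sum (f j) id"] conjI ballI)
    have "fst C = Y" by (simp add: C_def)
    have "inj_on (case_sum (f j) id) (fst (B j) <+> Y)"
      using inj_onD[OF insert.prems(3)[of j]] unfolding Y_def
      by (intro inj_onI) (elim PlusE; force)
    moreover have "case_sum (f j) id ` (fst (B j) <+> Y) = f j ` fst (B j) \<union> Y"
      unfolding Plus_def by (auto simp: image_Un image_image)
    moreover have "f j ` fst (B j) \<union> Y = fst A" using insert.prems(6) by (auto simp: Y_def)
    ultimately show "bij_betw (case_sum (f j) id) (fst (gset_sum (B j) C)) (fst A)"
      by (simp add: bij_betw_def gset_sum_def C_def)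
    show "case_sum (f j) id (snd (gset_sum (B j) C) g x) = snd A g (case_sum (f j) id x)"
      if "g \<in> carrier G" "x \<in> fst (gset_sum (B j) C)" for g x
      using that insert.prems(4)[of j] by (cases x) (simp_all add: gset_sum_def C_def)
  qed
  note iso = gset_basis_iso[OF finite_gset_sum[OF Bj C] this]
  have "gset_basis G A - (gset_basis G (B j) + gset_basis G C) \<in> ?I"
    using gset_sum_relation[OF Bj C] unfolding iso .
  ultimately have "(gset_basis G A - (gset_basis G (B j) + gset_basis G C))
      + (gset_basis G C - (\<Sum>i\<in>S. gset_basis G (B i))) \<in> ?I"
    by (intro burnside_ideal_add)
  then show ?case using insert.hyps by (simp add: algebra_simps)
qed

section \<open>Fixed point counts\<close>

text \<open>
  The mark of \<open>H\<close> on a \<open>G\<close>-set, in the terminology of Burnside.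
\<close>

definition mark :: "'a set \<Rightarrow> ('a, 'x) gset \<Rightarrow> nat" where
  "mark H A = card {x \<in> fst A. \<forall>h\<in>H. snd A h x = x}"

lemma mark_isomorphic:
  assumes A: "finite_gset G A" and H: "H \<subseteq> carrier G" and iso: "gset_isomorphic G A B"
  shows "mark H A = mark H B"
proof -
  obtain f where f: "bij_betw f (fst A) (fst B)" "\<And>g x. g \<in> carrier G \<Longrightarrow> x \<in> fst A \<Longrightarrow> f (snd A g x) = snd B g (f x)"
    using iso unfolding gset_isomorphic_def by blast
  have fix_iff: "snd B h (f x) = f x \<longleftrightarrow> snd A h x = x" if "h \<in> H" "x \<in> fst A" for h x
  proof -
    have h: "h \<in> carrier G" using that H by blast
    have "f (snd A h x) = f x \<longleftrightarrow> snd A h x = x"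
      using inj_on_eq_iff[OF bij_betw_imp_inj_on[OF f(1)] finite_gset_closed[OF A h that(2)] that(2)] .
    then show ?thesis using f(2)[OF h that(2)] by simp
  qed
  have "bij_betw f {x \<in> fst A. \<forall>h\<in>H. snd A h x = x} {y \<in> fst B. \<forall>h\<in>H. snd B h y = y}"
  proof (rule bij_betw_subset[OF f(1)])
    show "f ` {x \<in> fst A. \<forall>h\<in>H. snd A h x = x} = {y \<in> fst B. \<forall>h\<in>H. snd B h y = y}"
    proof (intro equalityI subsetI)
      fix y assume "y \<in> f ` {x \<in> fst A. \<forall>h\<in>H. snd A h x = x}"
      then show "y \<in> {y \<in> fst B. \<forall>h\<in>H. snd B h y = y}" using fix_iff bij_betwE[OF f(1)] by auto
    next
      fix y assume y: "y \<in> {y \<in> fst B. \<forall>h\<in>H. snd B h y = y}"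
      then obtain x where "x \<in> fst A" "y = f x" using bij_betw_imp_surj_on[OF f(1)] by blast
      then show "y \<in> f ` {x \<in> fst A. \<forall>h\<in>H. snd A h x = x}" using y fix_iff by auto
    qed
  qed auto
  then show ?thesis unfolding mark_def by (rule bij_betw_same_card)
qed

lemma mark_prod: "mark H (gset_prod A B) = mark H A * mark H B"
proof -
  have "{x \<in> fst (gset_prod A B). \<forall>h\<in>H. snd (gset_prod A B) h x = x}
      = {x \<in> fst A. \<forall>h\<in>H. snd A h x = x} \<times> {x \<in> fst B. \<forall>h\<in>H. snd B h x = x}"
    by (auto simp: gset_prod_def)
  then show ?thesis by (simp add: mark_def card_cartesian_product)
qed

lemma mark_sum:
  assumes "finite_gset G A" "finite_gset G B"
  shows "mark H (gset_sum A B) = mark H A + mark H B"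
proof -
  have "{x \<in> fst (gset_sum A B). \<forall>h\<in>H. snd (gset_sum A B) h x = x}
      = {x \<in> fst A. \<forall>h\<in>H. snd A h x = x} <+> {x \<in> fst B. \<forall>h\<in>H. snd B h x = x}"
    by (auto simp: gset_sum_def elim!: PlusE)
  then show ?thesis
    using finite_gset_finite[OF assms(1)] finite_gset_finite[OF assms(2)] by (simp add: mark_def card_Plus)
qed

definition class_mark :: "'a set \<Rightarrow> ('a, nat) gset set \<Rightarrow> 'k::comm_ring_1" where
  "class_mark H C = of_nat (mark H (SOME A. A \<in> C))"

lemma class_mark_class:
  assumes A: "finite_gset G A" and H: "H \<subseteq> carrier G"
  shows "class_mark H (gset_class G A) = of_nat (mark H A)"
proof -
  obtain B where "B \<in> gset_class G A"
    by (rule nat_gset_exists[OF A]) (simp add: gset_class_def)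
  then have "(SOME B. B \<in> gset_class G A) \<in> gset_class G A" by (rule someI)
  then have "gset_isomorphic G A (SOME B. B \<in> gset_class G A)" using gset_class_memD by blast
  then show ?thesis by (simp only: class_mark_def mark_isomorphic[OF A H])
qed

lemma class_mark_prod:
  assumes "C \<in> gset_classes G" "D \<in> gset_classes G" "H \<subseteq> carrier G"
  shows "class_mark H (gset_class_prod G C D) = class_mark H C * class_mark H D"
proof -
  obtain A B :: "('a, nat) gset" where "finite_gset G A" "C = gset_class G A" "finite_gset G B" "D = gset_class G B"
    using assms by (elim gset_classesE) auto
  then show ?thesis
    using assms(3) by (simp add: gset_class_prod_class class_mark_class finite_gset_prod mark_prod)
qed

definition mark_hom :: "'a set \<Rightarrow> (('a, nat) gset set \<Rightarrow>\<^sub>0 'k) \<Rightarrow> 'k::comm_ring_1" where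
  "mark_hom H = lin_ext (*) (class_mark H)"

lemma mark_hom_linear: "module_hom scale (*) (mark_hom H)"
  unfolding mark_hom_def by (rule module.module_hom_lin_ext[OF module_mult])

lemma mark_hom_basis:
  "finite_gset G A \<Longrightarrow> H \<subseteq> carrier G \<Longrightarrow> mark_hom H (gset_basis G A) = of_nat (mark H A)"
  by (simp add: mark_hom_def gset_basis_def module.lin_ext_single[OF module_mult] class_mark_class)

lemma mark_hom_mult:
  fixes f h :: "('a, nat) gset set \<Rightarrow>\<^sub>0 'k::comm_ring_1"
  assumes f: "f \<in> carrier (gset_ring G)" and h: "h \<in> carrier (gset_ring G)" and H: "H \<subseteq> carrier G"
  shows "mark_hom H (f \<otimes>\<^bsub>gset_ring G\<^esub> h) = mark_hom H f * mark_hom H h"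
proof -
  have "mark_hom H (f \<otimes>\<^bsub>gset_ring G\<^esub> h)
      = lin_ext (*) (\<lambda>C. lin_ext (*) (\<lambda>D. class_mark H (gset_class_prod G C D)) h) f"
    unfolding gset_ring_mult bilin_ext_def module_hom.lin_ext_image[OF mark_hom_linear]
    by (simp add: mark_hom_def module.lin_ext_single[OF module_mult])
  also have "\<dots> = lin_ext (*) (\<lambda>C. lin_ext (*) (\<lambda>D. class_mark H C * class_mark H D) h) f"
    using f h H by (intro module.lin_ext_cong[OF module_mult] class_mark_prod) auto
  also have "\<dots> = lin_ext (*) (\<lambda>C. mark_hom H h * class_mark H C) f"
    by (simp only: module.lin_ext_scale_fun[OF module_mult] mark_hom_def mult.commute)
  also have "\<dots> = mark_hom H h * mark_hom H f"
    by (simp only: module.lin_ext_scale_fun[OF module_mult] mark_hom_def[of H])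
  finally have "mark_hom H (f \<otimes>\<^bsub>gset_ring G\<^esub> h) = mark_hom H h * mark_hom H f" .
  then show ?thesis by (simp only: mult.commute)
qed

text \<open>
  Fixed points add up over disjoint unions and multiply over products. Hence the kernel of a mark is
  an ideal that contains the defining relations, and marks are well defined on the Burnside ring.
\<close>

lemma mark_hom_burnside_ideal:
  fixes f :: "('a, nat) gset set \<Rightarrow>\<^sub>0 'k::comm_ring_1"
  assumes H: "H \<subseteq> carrier G" and f: "f \<in> burnside_ideal G"
  shows "mark_hom H f = 0"
proof -
  let ?R = "gset_ring G :: (('a, nat) gset set \<Rightarrow>\<^sub>0 'k) ring"
  interpret R: ring ?R by (rule gset_ring_is_ring)
  let ?N = "{f \<in> carrier ?R. mark_hom H f = 0}"
  note add = module_hom.add[OF mark_hom_linear] and neg = module_hom.neg[OF mark_hom_linear]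
    and zero = module_hom.zero[OF mark_hom_linear] and diff = module_hom.diff[OF mark_hom_linear]
  have "ideal ?N ?R"
  proof (rule idealI[OF R.ring_axioms])
    show "subgroup ?N (add_monoid ?R)"
    proof (rule R.add.subgroupI)
      show "?N \<subseteq> carrier ?R" by auto
      show "?N \<noteq> {}" by (auto simp: zero intro!: exI[of _ 0])
      show "\<ominus>\<^bsub>?R\<^esub> a \<in> ?N" if "a \<in> ?N" for a
      proof -
        have "\<ominus>\<^bsub>?R\<^esub> a = - a" by (rule R.minus_equality) (use that in auto)
        then show ?thesis using that R.a_inv_closed[of a] by (auto simp: neg)
      qed
      show "a \<oplus>\<^bsub>?R\<^esub> b \<in> ?N" if "a \<in> ?N" "b \<in> ?N" for a b
        using that R.a_closed[of a b] by (auto simp: add)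
    qed
  qed (auto simp: mark_hom_mult[OF _ _ H] simp del: gset_ring_simps)
  moreover have "burnside_relations G \<subseteq> ?N"
  proof
    fix f :: "('a, nat) gset set \<Rightarrow>\<^sub>0 'k" assume f: "f \<in> burnside_relations G"
    then obtain A B :: "('a, nat) gset" where *: "finite_gset G A" "finite_gset G B"
      "f = gset_basis G (gset_sum A B) - (gset_basis G A + gset_basis G B)"
      unfolding burnside_relations_def by blast
    have "mark_hom H f = 0"
      unfolding *(3) diff add using * H by (simp add: mark_hom_basis finite_gset_sum mark_sum)
    then show "f \<in> ?N" using f burnside_relations_carrier by blast
  qed
  ultimately have "burnside_ideal G \<subseteq> ?N"
    unfolding burnside_ideal_def by (rule R.genideal_minimal)
  then show ?thesis using f by blast
qed

section \<open>Coset spaces\<close>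

lemma lcos_eq_iff:
  assumes H: "subgroup H G" and a: "a \<in> carrier G" and b: "b \<in> carrier G"
  shows "a <# H = b <# H \<longleftrightarrow> inv a \<otimes> b \<in> H"
proof
  assume "a <# H = b <# H"
  then have "b \<in> a <# H" using lcos_self[OF b H] by simp
  then show "inv a \<otimes> b \<in> H" using subgroup.lcos_module_imp[OF H is_group a] by blast
next
  assume "inv a \<otimes> b \<in> H"
  then have "b \<in> a <# H" using subgroup.lcos_module_rev[OF H is_group a b] by blast
  then show "a <# H = b <# H" using l_repr_independence a H by blast
qed

lemma lcosets_iff: "C \<in> lcosets H \<longleftrightarrow> (\<exists>a\<in>carrier G. C = a <# H)"
  by (auto simp: LCOSETS_def)

lemma gset_cosets_apply:
  "subgroup H G \<Longrightarrow> g \<in> carrier G \<Longrightarrow> a \<in> carrier G \<Longrightarrow> snd (gset_cosets G H) g (a <# H) = (g \<otimes> a) <# H"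
  using subgroup.subset by (auto simp: gset_cosets_def lcosets_iff lcos_m_assoc)

lemma finite_gset_cosets:
  assumes "finite (carrier G)" and H: "subgroup H G"
  shows "finite_gset G (gset_cosets G H)"
  unfolding gset_cosets_def
proof (rule finite_gsetI)
  let ?a = "\<lambda>g. restrict (\<lambda>C. g <# C) (lcosets H)"
  have app: "?a g (a <# H) = (g \<otimes> a) <# H" if "g \<in> carrier G" "a \<in> carrier G" for g a
    using gset_cosets_apply[OF H that] by (simp add: gset_cosets_def)
  show "finite (lcosets H)" using assms(1) by (simp add: LCOSETS_def)
  show "?a g C \<in> lcosets H" if "g \<in> carrier G" "C \<in> lcosets H" for g C
    using that app by (metis lcosets_iff m_closed)
  show "?a \<one> C = C" if "C \<in> lcosets H" for C
    using that app by (metis lcosets_iff l_one one_closed)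
  show "?a (g \<otimes> h) C = ?a g (?a h C)" if gh: "g \<in> carrier G" "h \<in> carrier G" "C \<in> lcosets H" for g h C
  proof -
    obtain a where a: "a \<in> carrier G" "C = a <# H" using gh lcosets_iff by blast
    show ?thesis unfolding a(2)
      using app[of "g \<otimes> h" a] app[of h a] app[of g "h \<otimes> a"] gh a by (simp only: m_closed m_assoc)
  qed
qed simp

text \<open>
  A function on the group that is constant on left cosets descends to the coset space.
\<close>

definition coset_lift :: "('a \<Rightarrow> 'y) \<Rightarrow> 'a set \<Rightarrow> 'y" where
  "coset_lift \<phi> C = \<phi> (SOME c. c \<in> C)"

lemma coset_lift:
  assumes H: "subgroup H G" and a: "a \<in> carrier G"
    and const: "\<And>h. h \<in> H \<Longrightarrow> \<phi> (a \<otimes> h) = \<phi> a"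
  shows "coset_lift \<phi> (a <# H) = \<phi> a"
proof -
  have "(SOME c. c \<in> a <# H) \<in> a <# H" using lcos_self[OF a H] by (rule someI)
  then show ?thesis using const by (auto simp: coset_lift_def l_coset_def)
qed

text \<open>
  The isomorphism sends \<open>aH\<close> to \<open>aw\<^sup>-\<^sup>1K\<close>, where \<open>K = wHw\<^sup>-\<^sup>1\<close>.
\<close>

lemma gset_cosets_conjugate:
  assumes H: "subgroup H G" and K: "subgroup K G" and w: "w \<in> carrier G"
    and conj: "\<And>h. h \<in> carrier G \<Longrightarrow> h \<in> H \<longleftrightarrow> w \<otimes> h \<otimes> inv w \<in> K"
  shows "gset_isomorphic G (gset_cosets G H) (gset_cosets G K)"
proof -
  define \<phi> where "\<phi> a = (a \<otimes> inv w) <# K" for a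
  have HK: "\<phi> a = \<phi> b \<longleftrightarrow> a <# H = b <# H" if "a \<in> carrier G" "b \<in> carrier G" for a b
  proof -
    have "inv (a \<otimes> inv w) \<otimes> (b \<otimes> inv w) = w \<otimes> (inv a \<otimes> b) \<otimes> inv w"
      using that w by (simp add: inv_mult_group m_assoc)
    then show ?thesis using that w conj[of "inv a \<otimes> b"] by (simp add: \<phi>_def lcos_eq_iff H K)
  qed
  have lift: "coset_lift \<phi> (a <# H) = \<phi> a" if a: "a \<in> carrier G" for a
  proof (rule coset_lift[OF H a])
    fix h assume h: "h \<in> H"
    then have hG: "h \<in> carrier G" using subgroup.subset[OF H] by blast
    have "inv a \<otimes> (a \<otimes> h) = h" using a hG by (simp flip: m_assoc)
    then have "a <# H = (a \<otimes> h) <# H" using h hG a by (simp add: lcos_eq_iff H)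
    then show "\<phi> (a \<otimes> h) = \<phi> a" using HK a hG by simp
  qed
  have fst: "fst (gset_cosets G H') = lcosets H'" for H' by (simp add: gset_cosets_def)
  have "inj_on (coset_lift \<phi>) (lcosets H)"
    by (rule inj_onI) (auto simp: lcosets_iff lift HK)
  moreover have "coset_lift \<phi> ` (lcosets H) = lcosets K"
  proof (intro equalityI subsetI)
    fix C assume "C \<in> coset_lift \<phi> ` (lcosets H)"
    then obtain a where "a \<in> carrier G" "C = (a \<otimes> inv w) <# K" by (auto simp: lcosets_iff lift \<phi>_def)
    then show "C \<in> lcosets K" using w by (auto simp: lcosets_iff intro!: bexI[of _ "a \<otimes> inv w"])
  next
    fix C assume "C \<in> lcosets K"
    then obtain b where b: "b \<in> carrier G" "C = b <# K" by (auto simp: lcosets_iff)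
    have "\<phi> (b \<otimes> w) = C" using b w by (simp add: \<phi>_def m_assoc)
    then show "C \<in> coset_lift \<phi> ` (lcosets H)"
      using b w lift[of "b \<otimes> w"] by (intro image_eqI[of _ _ "(b \<otimes> w) <# H"]) (auto simp: lcosets_iff)
  qed
  moreover have "coset_lift \<phi> (snd (gset_cosets G H) g C) = snd (gset_cosets G K) g (coset_lift \<phi> C)"
    if "g \<in> carrier G" "C \<in> lcosets H" for g C
    using that w by (auto simp: lcosets_iff gset_cosets_apply H K lift \<phi>_def m_assoc)
  ultimately show ?thesis
    unfolding gset_isomorphic_def fst by (intro exI[of _ "coset_lift \<phi>"]) (simp add: bij_betw_def)
qed

text \<open>
  The coset \<open>H\<close> itself is fixed by \<open>H\<close>.
\<close>

lemma mark_cosets_pos: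
  assumes H: "subgroup H G" and fin: "finite (carrier G)"
  shows "0 < mark H (gset_cosets G H)"
proof -
  have "\<one> <# H \<in> {C \<in> fst (gset_cosets G H). \<forall>h\<in>H. snd (gset_cosets G H) h C = C}"
    using subgroup.subset[OF H]
    by (auto simp: gset_cosets_apply H subset_iff lcos_eq_iff subgroup.m_inv_closed)
      (auto simp: gset_cosets_def lcosets_iff)
  moreover have "finite (fst (gset_cosets G H))"
    using finite_gset_finite[OF finite_gset_cosets[OF fin H]] .
  ultimately show ?thesis by (auto simp: mark_def card_gt_0_iff)
qed

text \<open>
  The coset \<open>gH\<close> is fixed by \<open>K\<close> exactly when \<open>g\<^sup>-\<^sup>1Kg\<close> is contained in \<open>H\<close>.
\<close>

lemma mark_cosets_nonzero:
  assumes H: "subgroup H G" and K: "K \<subseteq> carrier G" and "mark K (gset_cosets G H) \<noteq> 0"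
  obtains g where "g \<in> carrier G" "\<And>k. k \<in> K \<Longrightarrow> inv g \<otimes> k \<otimes> g \<in> H"
proof -
  have "{C \<in> fst (gset_cosets G H). \<forall>h\<in>K. snd (gset_cosets G H) h C = C} \<noteq> {}"
  proof
    assume "{C \<in> fst (gset_cosets G H). \<forall>h\<in>K. snd (gset_cosets G H) h C = C} = {}"
    then show False using assms(3) by (simp only: mark_def card.empty)
  qed
  then obtain a where a: "a \<in> carrier G" "\<forall>k\<in>K. snd (gset_cosets G H) k (a <# H) = a <# H"
    by (auto simp: gset_cosets_def lcosets_iff)
  have "inv a \<otimes> k \<otimes> a \<in> H" if "k \<in> K" for k
  proof -
    have k: "k \<in> carrier G" using that K by blast
    have "a <# H = (k \<otimes> a) <# H" using a that k gset_cosets_apply[OF H k a(1)] by simp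
    then show ?thesis using a k by (simp add: lcos_eq_iff H m_assoc)
  qed
  then show thesis using that a(1) by blast
qed

text \<open>
  Mackey's formula. The orbits of \<open>G\<close> on \<open>G/H \<times> G/K\<close> correspond to the double cosets \<open>HdK\<close>, and
  the point \<open>(d\<^sup>-\<^sup>1H, K)\<close> of the orbit of \<open>d\<close> has stabilizer \<open>K \<inter> d\<^sup>-\<^sup>1Hd\<close>, here called \<open>L d\<close>. The piece of
  the decomposition with index \<open>d\<close> is the equivariant map that sends \<open>aL\<close> to \<open>(ad\<^sup>-\<^sup>1H, aK)\<close>.
\<close>

lemma mackey_decomposition:
  assumes fin: "finite (carrier G)" and H: "subgroup H G" and K: "subgroup K G" and D: "D \<subseteq> carrier G"
    and cover: "\<And>x. x \<in> carrier G \<Longrightarrow> \<exists>h\<in>H. \<exists>d\<in>D. \<exists>k\<in>K. x = h \<otimes> d \<otimes> k"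
    and unique: "\<And>d d' h k. d \<in> D \<Longrightarrow> d' \<in> D \<Longrightarrow> h \<in> H \<Longrightarrow> k \<in> K \<Longrightarrow> h \<otimes> d = d' \<otimes> k \<Longrightarrow> d = d'"
    and L: "\<And>d. d \<in> D \<Longrightarrow> subgroup (L d) G"
    and L_iff: "\<And>d k. d \<in> D \<Longrightarrow> k \<in> carrier G \<Longrightarrow> k \<in> L d \<longleftrightarrow> k \<in> K \<and> d \<otimes> k \<otimes> inv d \<in> H"
  shows "gset_basis G (gset_prod (gset_cosets G H) (gset_cosets G K))
    - (\<Sum>d\<in>D. gset_basis G (gset_cosets G (L d))) \<in> burnside_ideal G"
proof -
  define \<phi> where "\<phi> d a = ((a \<otimes> inv d) <# H, a <# K)" for d a
  have DG: "d \<in> carrier G" if "d \<in> D" for d using that D by blast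
  have eq_iff: "\<phi> d a = \<phi> d b \<longleftrightarrow> a <# L d = b <# L d" if "d \<in> D" "a \<in> carrier G" "b \<in> carrier G" for d a b
  proof -
    have "inv (a \<otimes> inv d) \<otimes> (b \<otimes> inv d) = d \<otimes> (inv a \<otimes> b) \<otimes> inv d"
      using that DG by (simp add: inv_mult_group m_assoc)
    then show ?thesis
      using that DG L_iff[of d "inv a \<otimes> b"] by (auto simp: \<phi>_def lcos_eq_iff H K L)
  qed
  have lift: "coset_lift (\<phi> d) (a <# L d) = \<phi> d a" if d: "d \<in> D" and a: "a \<in> carrier G" for d a
  proof (rule coset_lift[OF L[OF d] a])
    fix h assume h: "h \<in> L d"
    then have hG: "h \<in> carrier G" using subgroup.subset[OF L[OF d]] by blast
    have "inv a \<otimes> (a \<otimes> h) = h" using a hG by (simp flip: m_assoc)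
    then have "a <# L d = (a \<otimes> h) <# L d" using h hG a by (simp add: lcos_eq_iff L d)
    then show "\<phi> d (a \<otimes> h) = \<phi> d a" using eq_iff d a hG by simp
  qed
  have fst: "fst (gset_cosets G H') = lcosets H'" for H' by (simp add: gset_cosets_def)
  show ?thesis
  proof (rule gset_decomposition[where f = "\<lambda>d. coset_lift (\<phi> d)"])
    show "finite D" using finite_subset[OF D fin] .
    show "finite_gset G (gset_prod (gset_cosets G H) (gset_cosets G K))"
      by (intro finite_gset_prod finite_gset_cosets fin H K)
    show "finite_gset G (gset_cosets G (L d))" if "d \<in> D" for d
      by (intro finite_gset_cosets fin L that)
    show "inj_on (coset_lift (\<phi> d)) (fst (gset_cosets G (L d)))" if "d \<in> D" for d
      unfolding fst by (rule inj_onI) (use that in \<open>auto simp: lcosets_iff lift eq_iff\<close>)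
    show "coset_lift (\<phi> d) (snd (gset_cosets G (L d)) g C)
        = snd (gset_prod (gset_cosets G H) (gset_cosets G K)) g (coset_lift (\<phi> d) C)"
      if d: "d \<in> D" and g: "g \<in> carrier G" and C: "C \<in> fst (gset_cosets G (L d))" for d g C
    proof -
      obtain a where a: "a \<in> carrier G" "C = a <# L d" using C by (auto simp: fst lcosets_iff)
      have "\<phi> d a \<in> fst (gset_cosets G H) \<times> fst (gset_cosets G K)"
        using a d DG by (auto simp: \<phi>_def fst lcosets_iff)
      then have "snd (gset_prod (gset_cosets G H) (gset_cosets G K)) g (\<phi> d a) = \<phi> d (g \<otimes> a)"
        using g a d DG by (simp add: gset_prod_def) (simp add: \<phi>_def gset_cosets_apply H K m_assoc)
      then show ?thesis using a g d by (simp add: gset_cosets_apply L lift)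
    qed
    show "coset_lift (\<phi> d) ` fst (gset_cosets G (L d)) \<inter> coset_lift (\<phi> d') ` fst (gset_cosets G (L d')) = {}"
      if d: "d \<in> D" and d': "d' \<in> D" and neq: "d \<noteq> d'" for d d'
    proof -
      have "\<phi> d a \<noteq> \<phi> d' b" if a: "a \<in> carrier G" and b: "b \<in> carrier G" for a b
      proof
        assume eq: "\<phi> d a = \<phi> d' b"
        let ?k = "inv a \<otimes> b" and ?h = "inv (b \<otimes> inv d') \<otimes> (a \<otimes> inv d)"
        have "?k \<in> K" using eq a b by (simp add: \<phi>_def lcos_eq_iff K)
        then have k: "inv ?k \<in> K" using K by (simp add: subgroup.m_inv_closed)
        have "(b \<otimes> inv d') <# H = (a \<otimes> inv d) <# H" using eq by (simp add: \<phi>_def)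
        then have h: "?h \<in> H" using a b DG[OF d] DG[OF d'] lcos_eq_iff[OF H] by simp
        have "?h \<otimes> d = d' \<otimes> inv ?k"
          using a b d d' DG by (simp add: inv_mult_group m_assoc)
        then show False using unique[OF d d' h k] neq by blast
      qed
      moreover from this have "\<phi> d' b \<noteq> \<phi> d a" if "a \<in> carrier G" "b \<in> carrier G" for a b
        using that by metis
      ultimately show ?thesis using d d' by (auto simp: fst lcosets_iff lift)
    qed
    show "(\<Union>d\<in>D. coset_lift (\<phi> d) ` fst (gset_cosets G (L d))) = fst (gset_prod (gset_cosets G H) (gset_cosets G K))"
    proof (intro equalityI subsetI)
      fix p assume "p \<in> (\<Union>d\<in>D. coset_lift (\<phi> d) ` fst (gset_cosets G (L d)))"
      then obtain d a where "d \<in> D" "a \<in> carrier G" "p = ((a \<otimes> inv d) <# H, a <# K)"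
        by (auto simp: fst lcosets_iff lift \<phi>_def)
      moreover from this have "a \<otimes> inv d \<in> carrier G" using DG by simp
      ultimately show "p \<in> fst (gset_prod (gset_cosets G H) (gset_cosets G K))"
        unfolding gset_prod_def fst lcosets_iff by (auto simp: lcosets_iff)
    next
      fix p assume "p \<in> fst (gset_prod (gset_cosets G H) (gset_cosets G K))"
      then obtain a b where ab: "a \<in> carrier G" "b \<in> carrier G" "p = (a <# H, b <# K)"
        by (auto simp: gset_prod_def fst lcosets_iff)
      obtain h d k where hdk: "h \<in> H" "d \<in> D" "k \<in> K" "inv a \<otimes> b = h \<otimes> d \<otimes> k"
        using cover[of "inv a \<otimes> b"] ab by auto
      have G: "h \<in> carrier G" "k \<in> carrier G" "d \<in> carrier G"
        using hdk H K DG subgroup.subset by blast+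
      have b: "b = a \<otimes> (h \<otimes> d \<otimes> k)" using hdk(4) ab G by (metis inv_solve_left m_closed)
      let ?c = "a \<otimes> h \<otimes> d"
      have c: "?c \<in> carrier G" using ab G by simp
      have "inv a \<otimes> (?c \<otimes> inv d) = h" "inv ?c \<otimes> b = k"
        unfolding b using ab G by (simp_all add: m_assoc inv_mult_group)
          (simp_all flip: m_assoc)
      then have "\<phi> d ?c = p"
        using ab G hdk c lcos_eq_iff[OF H ab(1), of "?c \<otimes> inv d"] lcos_eq_iff[OF K c ab(2)]
        by (simp add: \<phi>_def)
      then show "p \<in> (\<Union>d\<in>D. coset_lift (\<phi> d) ` fst (gset_cosets G (L d)))"
        using hdk(2) lift[OF hdk(2) c] c
        by (intro UN_I[OF hdk(2)] image_eqI[of _ _ "?c <# L d"]) (auto simp: fst lcosets_iff)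
    qed
  qed
qed

end

section \<open>Products of reflections\<close>

lemma linear_reflection: "linear (reflection r)"
  unfolding reflection_def
  by (rule linearI) (simp_all add: inner_add_left algebra_simps add_divide_distrib)

lemma reflection_self: "reflection r r = - r"
  by (cases "r = 0") (simp_all add: reflection_def scaleR_2)

lemma reflection_uminus: "reflection (- r) = reflection r"
  by (simp add: reflection_def fun_eq_iff)

lemma reflection_involution [simp]: "reflection r (reflection r x) = x"
  by (cases "r = 0") (simp_all add: reflection_def inner_diff_left algebra_simps flip: scaleR_left_distrib)

lemma reflection_comp_self [simp]: "reflection r \<circ> reflection r = id"
  by (simp add: fun_eq_iff)

lemma orthogonal_reflection: "orthogonal_transformation (reflection r)"
  unfolding orthogonal_transformation_def
  by (cases "r = 0")
    (simp_all add: linear_reflection reflection_def inner_diff_left inner_diff_right inner_commute field_simps)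

lemma reflection_conjugate:
  assumes "orthogonal_transformation w"
  shows "w \<circ> reflection r = reflection (w r) \<circ> w"
proof -
  have "linear w" "w x \<bullet> w y = x \<bullet> y" for x y
    using assms by (auto simp: orthogonal_transformation_def)
  then show ?thesis by (simp add: fun_eq_iff reflection_def linear_diff linear_cmul)
qed

text \<open>
  Explicit lists of roots allow induction on the length of an expression, which the exchange
  argument for words in simple reflections needs.
\<close>

definition word :: "'a::euclidean_space list \<Rightarrow> 'a \<Rightarrow> 'a" where
  "word l = foldr (\<lambda>r. (\<circ>) (reflection r)) l id"

lemma word_simps [simp]: "word [] = id" "word (r # l) = reflection r \<circ> word l"
  by (simp_all add: word_def)

lemma word_append: "word (l @ m) = word l \<circ> word m"
  by (induction l) (auto simp: comp_assoc)

lemma orthogonal_word: "orthogonal_transformation (word l)"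
proof (induction l)
  case (Cons r l)
  then show ?case by (metis orthogonal_reflection orthogonal_transformation_compose word_simps(2))
qed (simp add: id_def orthogonal_transformation_id)

lemma linear_word: "linear (word l)"
  using orthogonal_word by (auto simp: orthogonal_transformation_def)

lemma word_rev: "word (rev l) \<circ> word l = id" "word l \<circ> word (rev l) = id"
proof -
  show *: "word (rev l) \<circ> word l = id" for l :: "'a list"
  proof (induction l)
    case (Cons r l)
    then show ?case by (simp add: word_append fun_eq_iff)
  qed simp
  show "word l \<circ> word (rev l) = id" using *[of "rev l"] by simp
qed

lemma word_span: "word l x - x \<in> span (set l)"
proof (induction l)
  case (Cons r l)
  have "word (r # l) x - x = (word l x - x) - (2 * (word l x \<bullet> r) / (r \<bullet> r)) *\<^sub>R r"
    by (simp add: reflection_def algebra_simps)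
  moreover have "word l x - x \<in> span (set (r # l))"
    using Cons span_mono[of "set l" "set (r # l)"] by auto
  moreover have "r \<in> span (set (r # l))" by (simp add: span_base)
  ultimately show ?case by (metis span_diff span_scale)
qed (simp add: span_zero)

lemma word_conjugate:
  assumes "orthogonal_transformation w"
  shows "w \<circ> word l = word (map w l) \<circ> w"
proof (induction l)
  case (Cons r l)
  then show ?case using fun_cong[OF reflection_conjugate[OF assms, of r]] by (simp add: fun_eq_iff)
qed simp

lemma BijGroup_UNIV:
  "carrier (BijGroup UNIV) = {f. bij f}"
  "bij f \<Longrightarrow> bij g \<Longrightarrow> f \<otimes>\<^bsub>BijGroup UNIV\<^esub> g = f \<circ> g"
  "\<one>\<^bsub>BijGroup UNIV\<^esub> = id"
  by (auto simp: BijGroup_def Bij_def extensional_def compose_def fun_eq_iff)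

lemma bij_word: "bij (word l)"
  by (rule o_bij[OF word_rev])

text \<open>
  Reflections are involutions, so products of reflections are closed under inverses. The group \<open>G\<close> is
  general so that this applies both to the Weyl group inside the group of all bijections and to the
  parabolic subgroups inside the Weyl group.
\<close>

lemma generate_reflections:
  assumes G: "group G" "carrier G \<subseteq> {f. bij f}" "monoid.mult G = monoid.mult (BijGroup UNIV)" "\<one>\<^bsub>G\<^esub> = id"
    and J: "reflection ` J \<subseteq> carrier G"
  shows "generate G (reflection ` J) = word ` lists J"
proof -
  interpret group G by fact
  have mult: "f \<otimes>\<^bsub>G\<^esub> g = f \<circ> g" if "f \<in> carrier G" "g \<in> carrier G" for f g
    using that G(2,3) by (simp add: subset_iff BijGroup_UNIV)
  have refl: "reflection r \<in> word ` lists J" if "r \<in> J" for r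
    using that by (intro image_eqI[of _ _ "[r]"]) auto
  have sub: "generate G (reflection ` J) \<subseteq> carrier G" by (rule generate_incl[OF J])
  show ?thesis
  proof (intro equalityI subsetI)
    fix w assume "w \<in> generate G (reflection ` J)"
    then show "w \<in> word ` lists J"
    proof induction
      case one
      show ?case using G(4) by (intro image_eqI[of _ _ "[]"]) auto
    next
      case (incl h)
      then show ?case using refl by auto
    next
      case (inv h)
      then obtain r where r: "r \<in> J" "h = reflection r" "h \<in> carrier G" using J by auto
      then have "inv\<^bsub>G\<^esub> h = h" by (intro inv_equality) (auto simp: mult G(4))
      then show ?case using refl r by auto
    next
      case (eng g h)
      then obtain l m where "g = word l" "l \<in> lists J" "h = word m" "m \<in> lists J" by auto
      then show ?case using sub eng by (intro image_eqI[of _ _ "l @ m"]) (auto simp: mult subset_iff word_append)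
    qed
  next
    fix w assume "w \<in> word ` lists J"
    then obtain l where l: "l \<in> lists J" "w = word l" by auto
    have "word l \<in> generate G (reflection ` J)" using l(1)
    proof (induction l)
      case Nil
      then show ?case by (metis G(4) generate.one word_simps(1))
    next
      case (Cons r l)
      have "reflection r \<otimes>\<^bsub>G\<^esub> word l \<in> generate G (reflection ` J)"
        using Cons by (auto intro!: generate.eng intro: generate.incl)
      moreover have "reflection r \<otimes>\<^bsub>G\<^esub> word l = reflection r \<circ> word l"
        using Cons J sub by (intro mult) auto
      ultimately show ?case by (metis word_simps(2))
    qed
    then show "w \<in> generate G (reflection ` J)" by (simp add: l)
  qed
qed

section \<open>The Weyl group of a root system\<close>

lemma weyl_group_group: "group (weyl_group \<Phi>)"
  unfolding weyl_group_def by (rule group.group_subgroup_generated[OF group_BijGroup])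

lemma bij_reflection: "bij (reflection r)"
  using bij_word[of "[r]"] by simp

lemma weyl_carrier: "carrier (weyl_group \<Phi>) = word ` lists \<Phi>"
proof -
  have "carrier (BijGroup UNIV) \<inter> reflection ` \<Phi> = reflection ` \<Phi>"
    by (auto simp: BijGroup_UNIV bij_reflection)
  then show ?thesis
    unfolding weyl_group_def carrier_subgroup_generated
    by (simp add: generate_reflections group_BijGroup BijGroup_UNIV bij_reflection image_subset_iff)
qed

lemma weyl_one [simp]: "\<one>\<^bsub>weyl_group \<Phi>\<^esub> = id"
  by (simp add: weyl_group_def BijGroup_UNIV)

lemma weyl_mult:
  "w \<in> carrier (weyl_group \<Phi>) \<Longrightarrow> v \<in> carrier (weyl_group \<Phi>) \<Longrightarrow> w \<otimes>\<^bsub>weyl_group \<Phi>\<^esub> v = w \<circ> v"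
  unfolding weyl_carrier by (auto simp: weyl_group_def BijGroup_UNIV bij_word)

lemma reflection_in_weyl: "r \<in> \<Phi> \<Longrightarrow> reflection r \<in> carrier (weyl_group \<Phi>)"
  unfolding weyl_carrier by (intro image_eqI[of _ _ "[r]"]) auto

lemma parabolic_eq_words:
  assumes "J \<subseteq> \<Phi>"
  shows "parabolic \<Phi> J = word ` lists J"
  unfolding parabolic_def
proof (rule generate_reflections[OF weyl_group_group])
  show "carrier (weyl_group \<Phi>) \<subseteq> {f. bij f}" by (auto simp: weyl_carrier bij_word)
  show "monoid.mult (weyl_group \<Phi>) = monoid.mult (BijGroup UNIV)" by (simp add: weyl_group_def)
  show "reflection ` J \<subseteq> carrier (weyl_group \<Phi>)" using assms reflection_in_weyl by auto
qed simp

lemma parabolic_subgroup: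
  assumes "J \<subseteq> \<Phi>"
  shows "subgroup (parabolic \<Phi> J) (weyl_group \<Phi>)"
  unfolding parabolic_def
  by (rule group.generate_is_subgroup[OF weyl_group_group]) (use assms reflection_in_weyl in auto)

text \<open>
  A finite reduced root system, crystallographic or not, with a simple system. Linear independence of \<open>\<Delta>\<close> provides
  the coefficients of a root with respect to the simple roots.
\<close>

locale simple_system =
  fixes \<Phi> \<Delta> :: "'a::euclidean_space set"
  assumes finite_roots: "finite \<Phi>"
    and zero_not_root: "0 \<notin> \<Phi>"
    and reflection_root: "r \<in> \<Phi> \<Longrightarrow> s \<in> \<Phi> \<Longrightarrow> reflection r s \<in> \<Phi>"
    and reduced: "r \<in> \<Phi> \<Longrightarrow> c *\<^sub>R r \<in> \<Phi> \<Longrightarrow> c = 1 \<or> c = - 1"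
    and simple_roots: "\<Delta> \<subseteq> \<Phi>"
    and independent_simple: "independent \<Delta>"
    and root_pos_or_neg: "r \<in> \<Phi> \<Longrightarrow> r \<in> pos_roots \<Phi> \<Delta> \<or> - r \<in> pos_roots \<Phi> \<Delta>"
begin

abbreviation W where "W \<equiv> carrier (weyl_group \<Phi>)"
abbreviation winv where "winv \<equiv> m_inv (weyl_group \<Phi>)"
abbreviation pos where "pos \<equiv> pos_roots \<Phi> \<Delta>"
abbreviation coef where "coef \<equiv> representation \<Delta>"

sublocale weyl: group "weyl_group \<Phi>" by (rule weyl_group_group)

lemma weyl_words: "w \<in> W \<Longrightarrow> \<exists>l\<in>lists \<Phi>. w = word l"
  by (auto simp: weyl_carrier)

lemma weyl_orthogonal: "w \<in> W \<Longrightarrow> orthogonal_transformation w"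
  using weyl_words orthogonal_word by blast

lemma weyl_linear: "w \<in> W \<Longrightarrow> linear w"
  using weyl_words linear_word by blast

lemma weyl_uminus: "w \<in> W \<Longrightarrow> w (- x) = - w x"
  using weyl_linear linear_neg by blast

lemma weyl_root: assumes "w \<in> W" "r \<in> \<Phi>" shows "w r \<in> \<Phi>"
proof -
  obtain l where l: "l \<in> lists \<Phi>" "w = word l" using weyl_words[OF assms(1)] by blast
  have "word l r \<in> \<Phi>" using l(1) by induction (use assms(2) reflection_root in auto)
  then show ?thesis by (simp add: l)
qed

lemma id_weyl: "id \<in> W" using weyl.one_closed by simp

lemma comp_weyl: "w \<in> W \<Longrightarrow> v \<in> W \<Longrightarrow> w \<circ> v \<in> W"
  using weyl.m_closed by (metis weyl_mult)

lemma winv_comp [simp]: assumes "w \<in> W" shows "winv w \<circ> w = id" "w \<circ> winv w = id"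
  using assms weyl.l_inv[OF assms] weyl.r_inv[OF assms] by (simp_all add: weyl_mult)

lemma winv_apply [simp]: assumes "w \<in> W" shows "winv w (w x) = x" "w (winv w x) = x"
  using winv_comp[OF assms] by (metis comp_apply id_apply)+

lemma winv_unique: assumes "w \<in> W" "v \<in> W" "v \<circ> w = id" shows "winv w = v"
  using assms by (intro weyl.inv_equality) (simp_all add: weyl_mult)

lemma simple_root: "s \<in> \<Delta> \<Longrightarrow> s \<in> \<Phi>" using simple_roots by auto

lemma uminus_root: "r \<in> \<Phi> \<Longrightarrow> - r \<in> \<Phi>"
  using reflection_root[of r r] by (simp add: reflection_self)

lemma finite_simple: "finite \<Delta>" using finite_roots simple_roots finite_subset by blast

lemma pos_root: "r \<in> pos \<Longrightarrow> r \<in> \<Phi>" by (simp add: pos_roots_def)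

lemma root_in_span: assumes "r \<in> \<Phi>" shows "r \<in> span \<Delta>"
proof -
  have "r \<in> span \<Delta>" if "r \<in> pos" for r
    using that by (auto simp: pos_roots_def intro: span_sum span_scale span_base)
  then show ?thesis using root_pos_or_neg[OF assms] span_neg[of "- r"] by auto
qed

lemma coef_sum: assumes "t \<in> \<Delta>" shows "coef (\<Sum>s\<in>\<Delta>. c s *\<^sub>R s) t = c t"
proof -
  have "coef (\<Sum>s\<in>\<Delta>. c s *\<^sub>R s) t = (\<Sum>s\<in>\<Delta>. coef (c s *\<^sub>R s) t)"
    by (subst real_vector.representation_sum)
      (auto simp: independent_simple span_base span_scale)
  also have "\<dots> = (\<Sum>s\<in>\<Delta>. if s = t then c t else 0)"
    by (intro sum.cong refl)
      (auto simp: real_vector.representation_scale independent_simple span_base real_vector.representation_basis)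
  finally show ?thesis using assms finite_simple by simp
qed

lemma sum_coef: "r \<in> \<Phi> \<Longrightarrow> (\<Sum>s\<in>\<Delta>. coef r s *\<^sub>R s) = r"
  using real_vector.sum_representation_eq[OF independent_simple root_in_span finite_simple subset_refl] by simp

lemma pos_iff: assumes "r \<in> \<Phi>" shows "r \<in> pos \<longleftrightarrow> (\<forall>s\<in>\<Delta>. 0 \<le> coef r s)"
  using assms sum_coef[OF assms] coef_sum unfolding pos_roots_def by (auto intro!: exI[of _ "coef r"])

lemma coef_uminus: "r \<in> \<Phi> \<Longrightarrow> coef (- r) s = - coef r s"
  by (simp add: real_vector.representation_neg independent_simple root_in_span)

lemma coef_simple: "s \<in> \<Delta> \<Longrightarrow> coef s t = (if t = s then 1 else 0)"
  by (simp add: real_vector.representation_basis independent_simple)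

lemma not_pos_iff: assumes "r \<in> \<Phi>" shows "r \<notin> pos \<longleftrightarrow> - r \<in> pos"
proof
  show "- r \<in> pos" if "r \<notin> pos" using root_pos_or_neg[OF assms] that by simp
  show "r \<notin> pos" if "- r \<in> pos"
  proof
    assume "r \<in> pos"
    then have "\<forall>s\<in>\<Delta>. coef r s = 0"
      using that assms uminus_root by (force simp: pos_iff coef_uminus)
    then have "r = 0" using sum_coef[OF assms] by simp
    then show False using assms zero_not_root by simp
  qed
qed

lemma simple_pos: "s \<in> \<Delta> \<Longrightarrow> s \<in> pos"
  by (simp add: pos_iff simple_root coef_simple)

lemma coef_pos_imp_pos: assumes "r \<in> \<Phi>" "s \<in> \<Delta>" "0 < coef r s" shows "r \<in> pos"
proof (rule ccontr)
  assume "r \<notin> pos"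
  then have "- r \<in> pos" using not_pos_iff assms by simp
  then have "0 \<le> coef (- r) s" using assms uminus_root pos_iff by blast
  then show False using assms coef_uminus by simp
qed

text \<open>
  Such a root is a nonnegative multiple of \<open>s\<close>, so reducedness applies.
\<close>

lemma pos_eq_simple:
  assumes r: "r \<in> pos" and s: "s \<in> \<Delta>" and 0: "\<And>t. t \<in> \<Delta> \<Longrightarrow> t \<noteq> s \<Longrightarrow> coef r t = 0"
  shows "r = s"
proof -
  have "(\<Sum>t\<in>\<Delta>. coef r t *\<^sub>R t) = (\<Sum>t\<in>\<Delta>. if t = s then coef r s *\<^sub>R s else 0)"
    by (intro sum.cong refl) (auto simp: 0)
  then have *: "r = coef r s *\<^sub>R s" using sum_coef[OF pos_root[OF r]] s finite_simple by simp
  then have "coef r s = 1 \<or> coef r s = - 1" using reduced[of s] pos_root[OF r] simple_root[OF s] by metis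
  moreover have "0 \<le> coef r s" using r s pos_iff pos_root by blast
  ultimately show ?thesis using * by auto
qed

lemma span_coef: assumes "x \<in> span K" "K \<subseteq> \<Delta>" "t \<notin> K" shows "coef x t = 0"
  using real_vector.representation_extend[OF independent_simple assms(1,2)] assms(3)
  by (metis real_vector.representation_ne_zero)

text \<open>
  Elements of a parabolic subgroup move every vector by an element of the span of its simple roots.
  This is how they control the remaining coefficients.
\<close>

lemma coef_span_shift:
  assumes "y - x \<in> span K" "x \<in> \<Phi>" "y \<in> \<Phi>" "K \<subseteq> \<Delta>" "t \<notin> K"
  shows "coef y t = coef x t"
proof -
  have "coef (y - x) t = coef y t - coef x t"
    by (simp add: real_vector.representation_diff independent_simple root_in_span assms)
  then show ?thesis using span_coef[OF assms(1,4,5)] by simp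
qed

lemma not_in_span: assumes "r \<in> pos" "r \<notin> span K" "K \<subseteq> \<Delta>"
  obtains t where "t \<in> \<Delta>" "t \<notin> K" "0 < coef r t"
proof -
  have "\<exists>t\<in>\<Delta> - K. coef r t \<noteq> 0"
  proof (rule ccontr)
    assume "\<not> ?thesis"
    then have "(\<Sum>t\<in>\<Delta>. coef r t *\<^sub>R t) \<in> span K"
      by (intro span_sum) (metis DiffI scaleR_zero_left span_base span_scale span_zero)
    then show False using assms sum_coef pos_root by simp
  qed
  then show thesis using that assms pos_iff pos_root by (metis DiffE order_le_less)
qed

lemma simple_in_span: "s \<in> \<Delta> \<Longrightarrow> s \<in> span K \<Longrightarrow> K \<subseteq> \<Delta> \<Longrightarrow> s \<in> K"
  using span_coef[of s K s] coef_simple[of s s] by auto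

text \<open>
  Some simple root \<open>t\<close> other than \<open>s\<close> has a positive coefficient in \<open>r\<close>, and the reflection in \<open>s\<close>
  leaves that coefficient alone.
\<close>

lemma simple_reflection_pos:
  assumes s: "s \<in> \<Delta>" and r: "r \<in> pos" "r \<noteq> s"
  shows "reflection s r \<in> pos"
proof -
  obtain t where t: "t \<in> \<Delta>" "t \<noteq> s" "coef r t \<noteq> 0" using pos_eq_simple s r by blast
  then have "0 < coef r t" using r pos_iff pos_root by (metis order_le_less)
  moreover have "coef (reflection s r) t = coef r t"
    using word_span[of "[s]" r] s t r
    by (intro coef_span_shift[where K = "{s}"]) (auto simp: simple_root pos_root reflection_root)
  ultimately show ?thesis using t s r by (metis coef_pos_imp_pos pos_root reflection_root simple_root)
qed

section \<open>Inversions and the exchange condition\<close>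

definition inversions :: "('a \<Rightarrow> 'a) \<Rightarrow> 'a set" where
  "inversions w = {r \<in> pos. w r \<notin> pos}"

lemma finite_inversions: "finite (inversions w)"
  by (rule finite_subset[OF _ finite_roots]) (auto simp: inversions_def pos_root)

text \<open>
  The reflection in \<open>s\<close> permutes the positive roots other than \<open>s\<close>, so it maps the inversions of
  the product into those of \<open>w\<close>, missing \<open>s\<close>.
\<close>

lemma card_inversions_descent:
  assumes w: "w \<in> W" and s: "s \<in> \<Delta>" and neg: "w s \<notin> pos"
  shows "card (inversions (w \<circ> reflection s)) < card (inversions w)"
proof -
  have ws: "- w s \<in> pos" using not_pos_iff neg weyl_root[OF w simple_root[OF s]] by blast
  have "reflection s ` inversions (w \<circ> reflection s) \<subseteq> inversions w - {s}"
  proof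
    fix q assume "q \<in> reflection s ` inversions (w \<circ> reflection s)"
    then obtain r where r: "r \<in> pos" "w (reflection s r) \<notin> pos" "q = reflection s r"
      by (auto simp: inversions_def)
    have "r \<noteq> s" using r ws weyl_uminus[OF w] by (auto simp: reflection_self)
    moreover have "q \<noteq> s"
    proof
      assume "q = s"
      then have "r = - s" using r(3) by (metis reflection_involution reflection_self)
      then show False using r(1) not_pos_iff[of s] simple_pos[OF s] simple_root[OF s] by simp
    qed
    ultimately show "q \<in> inversions w - {s}"
      using r s simple_reflection_pos by (simp add: inversions_def)
  qed
  then have "card (reflection s ` inversions (w \<circ> reflection s)) \<le> card (inversions w - {s})"
    by (intro card_mono) (simp_all add: finite_inversions)
  moreover have "card (reflection s ` inversions (w \<circ> reflection s)) = card (inversions (w \<circ> reflection s))"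
    by (intro card_image inj_on_subset[OF bij_is_inj[OF bij_reflection]]) simp
  moreover have "s \<in> inversions w" using s neg by (simp add: inversions_def simple_pos)
  ultimately show ?thesis
    using finite_inversions[of w] by (metis card_Diff1_less order_le_less_trans)
qed

text \<open>
  The map \<open>r \<mapsto> - w r\<close> sends inversions of \<open>w\<close> to inversions of its inverse.
\<close>

lemma card_inversions_inv_le: assumes "w \<in> W" shows "card (inversions w) \<le> card (inversions (winv w))"
proof (rule card_inj_on_le[where f = "\<lambda>r. - w r"])
  show "inj_on (\<lambda>r. - w r) (inversions w)"
    by (rule inj_on_inverseI[where g = "\<lambda>r. winv w (- r)"]) (simp add: assms)
  show "(\<lambda>r. - w r) ` inversions w \<subseteq> inversions (winv w)"
    using assms by (auto simp: inversions_def weyl_uminus weyl_root pos_root simp flip: not_pos_iff)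
qed (rule finite_inversions)

lemma card_inversions_inv: "w \<in> W \<Longrightarrow> card (inversions (winv w)) = card (inversions w)"
  using card_inversions_inv_le[of w] card_inversions_inv_le[of "winv w"] by simp

lemma word_simple_weyl: "l \<in> lists \<Delta> \<Longrightarrow> word l \<in> W"
  using simple_roots by (auto simp: weyl_carrier)

text \<open>
  The exchange condition. Reading the word from the right, some letter \<open>r\<close> turns the image of \<open>s\<close>
  from positive to negative; that image is then \<open>r\<close> itself, and multiplying by the reflection in \<open>s\<close>
  deletes this letter.
\<close>

lemma exchange:
  assumes "s \<in> \<Delta>" "l \<in> lists \<Delta>" "word l s \<notin> pos"
  shows "\<exists>l'\<in>lists \<Delta>. word l \<circ> reflection s = word l' \<and> length l' < length l"
  using assms(2,3)
proof (induction l)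
  case Nil
  then show ?case using simple_pos assms(1) by simp
next
  case (Cons r l)
  show ?case
  proof (cases "word l s \<in> pos")
    case False
    then obtain l' where "l' \<in> lists \<Delta>" "word l \<circ> reflection s = word l'" "length l' < length l"
      using Cons(3) by blast
    then show ?thesis using Cons(1) by (intro bexI[of _ "r # l'"]) (auto simp: fun_eq_iff)
  next
    case True
    have "word l s = r"
      using simple_reflection_pos[OF _ True, of r] Cons by auto
    then have "word (r # l) \<circ> reflection s = word l"
      using reflection_conjugate[OF orthogonal_word, of l s] by (simp add: fun_eq_iff)
    moreover have "l \<in> lists \<Delta>" "length l < length (r # l)" using Cons(1,2) by auto
    ultimately show ?thesis by blast
  qed
qed

text \<open>
  A nonempty word \<open>m @ [s]\<close> of this kind has \<open>m\<close> sending \<open>s\<close> to a negative root, so the exchange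
  condition replaces it by a shorter word for the same element.
\<close>

lemma word_simple_trivial:
  assumes "l \<in> lists \<Delta>" "\<And>s. s \<in> \<Delta> \<Longrightarrow> word l s \<in> pos"
  shows "word l = id"
  using assms
proof (induction "length l" arbitrary: l rule: less_induct)
  case less
  show ?case
  proof (cases l rule: rev_cases)
    case (snoc m s)
    have m: "m \<in> lists \<Delta>" and s: "s \<in> \<Delta>" using less(2) snoc by auto
    have "- word m s \<in> pos"
      using less(3)[OF s] weyl_uminus[OF word_simple_weyl[OF m]]
      by (simp add: snoc word_append reflection_self)
    then have "word m s \<notin> pos"
      using not_pos_iff weyl_root[OF word_simple_weyl[OF m] simple_root[OF s]] by blast
    then obtain l' where l': "l' \<in> lists \<Delta>" "word m \<circ> reflection s = word l'" "length l' < length m"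
      using exchange[OF s m] by auto
    have "word l = word l'" using l'(2) by (simp add: snoc word_append)
    then show ?thesis using less(1)[of l'] less(3) l' snoc by auto
  qed simp
qed

text \<open>
  Induction on the height: a positive root that is not simple has positive inner product with some
  simple root \<open>s\<close>, and reflecting it in \<open>s\<close> gives a positive root of smaller height whose reflection
  is conjugate to the original one.
\<close>

lemma reflection_simple_word:
  assumes "r \<in> pos"
  shows "reflection r \<in> word ` lists \<Delta>"
proof -
  define ht where "ht r = (\<Sum>s\<in>\<Delta>. coef r s)" for r
  show ?thesis using assms
  proof (induction "card {q \<in> pos. ht q < ht r}" arbitrary: r rule: less_induct)
    case less
    note r = pos_root[OF less(2)]
    show ?case
    proof (cases "r \<in> \<Delta>")
      case True
      then show ?thesis by (intro image_eqI[of _ _ "[r]"]) auto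
    next
      case False
      \<comment> \<open>Since \<open>r \<bullet> r > 0\<close>, one of the terms \<open>coef r s * (s \<bullet> r)\<close> is positive.\<close>
      have "r \<bullet> r = (\<Sum>s\<in>\<Delta>. coef r s * (s \<bullet> r))"
        by (subst sum_coef[OF r, symmetric]) (simp add: inner_sum_left)
      moreover have "0 < r \<bullet> r" using r zero_not_root by auto
      ultimately have "\<not> (\<forall>s\<in>\<Delta>. coef r s * (s \<bullet> r) \<le> 0)"
        using sum_nonpos[of \<Delta> "\<lambda>s. coef r s * (s \<bullet> r)"] by auto
      then obtain s where s: "s \<in> \<Delta>" "0 < coef r s * (s \<bullet> r)" by (auto simp: not_le)
      have "0 \<le> coef r s" using less(2) s(1) pos_iff[OF r] by blast
      then have sr: "0 < s \<bullet> r" using s(2) by (auto simp: zero_less_mult_iff)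
      let ?q = "reflection s r"
      have q: "?q \<in> pos" using simple_reflection_pos s less(2) False by blast
      let ?c = "2 * (r \<bullet> s) / (s \<bullet> s)"
      have "s \<noteq> 0" using s(1) simple_root zero_not_root by auto
      then have c: "0 < ?c" using sr by (simp add: inner_commute)
      have "coef ?q t = coef r t - ?c * coef s t" for t
        unfolding reflection_def
        by (simp add: real_vector.representation_diff real_vector.representation_scale
            independent_simple root_in_span r simple_root[OF s(1)] span_scale)
      moreover have "ht s = 1" using s(1) finite_simple by (simp add: ht_def coef_simple)
      ultimately have "ht ?q = ht r - ?c"
        using sum_distrib_left[of ?c "coef s" \<Delta>] by (simp add: ht_def sum_subtractf)
      then have ht: "ht ?q < ht r" using c by simp
      have "card {p \<in> pos. ht p < ht ?q} < card {p \<in> pos. ht p < ht r}"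
      proof (rule psubset_card_mono)
        show "finite {p \<in> pos. ht p < ht r}"
          by (rule finite_subset[OF _ finite_roots]) (auto simp: pos_root)
        have "?q \<in> {p \<in> pos. ht p < ht r} - {p \<in> pos. ht p < ht ?q}" using ht q by simp
        moreover have "{p \<in> pos. ht p < ht ?q} \<subseteq> {p \<in> pos. ht p < ht r}" using ht by auto
        ultimately show "{p \<in> pos. ht p < ht ?q} \<subset> {p \<in> pos. ht p < ht r}" by blast
      qed
      then obtain l where l: "l \<in> lists \<Delta>" "reflection ?q = word l" using less(1) q by blast
      have "word ([s] @ l @ [s]) = reflection s \<circ> (reflection ?q \<circ> reflection s)"
        by (simp add: word_append l(2) comp_assoc)
      also have "\<dots> = reflection s \<circ> (reflection s \<circ> reflection r)"
        by (simp only: reflection_conjugate[OF orthogonal_reflection, of s r])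
      also have "\<dots> = reflection r" by (simp add: fun_eq_iff)
      finally have "reflection r = word ([s] @ l @ [s])" ..
      moreover have "[s] @ l @ [s] \<in> lists \<Delta>" using l(1) s(1) by simp
      ultimately show ?thesis by blast
    qed
  qed
qed

lemma weyl_simple_words: "W = word ` lists \<Delta>"
proof
  show "word ` lists \<Delta> \<subseteq> W" using word_simple_weyl by auto
  have "word l \<in> word ` lists \<Delta>" if "l \<in> lists \<Phi>" for l
    using that
  proof induction
    case (Cons r l)
    have "reflection r \<in> word ` lists \<Delta>"
      using reflection_simple_word root_pos_or_neg[OF Cons(1)] by (metis reflection_uminus)
    then obtain k m where "reflection r = word k" "word l = word m" "k \<in> lists \<Delta>" "m \<in> lists \<Delta>"
      using Cons by auto
    then show ?case by (intro image_eqI[of _ _ "k @ m"]) (auto simp: word_append)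
  next
    case Nil
    show ?case by (rule image_eqI[of _ _ "[]"]) auto
  qed
  then show "W \<subseteq> word ` lists \<Delta>" by (auto simp: weyl_carrier)
qed

lemma parabolic_simple: "parabolic \<Phi> \<Delta> = W"
  by (simp add: parabolic_eq_words simple_roots weyl_simple_words)

lemma weyl_trivial: "w \<in> W \<Longrightarrow> (\<And>s. s \<in> \<Delta> \<Longrightarrow> w s \<in> pos) \<Longrightarrow> w = id"
  unfolding weyl_simple_words using word_simple_trivial by blast

text \<open>
  An element that fixes all roots is trivial, so the Weyl group acts faithfully on the finite set of
  roots.
\<close>

lemma finite_weyl: "finite W"
proof (rule inj_on_finite)
  show "finite (\<Phi> \<rightarrow>\<^sub>E \<Phi>)" using finite_roots by (simp add: finite_PiE)
  show "(\<lambda>w. restrict w \<Phi>) ` W \<subseteq> \<Phi> \<rightarrow>\<^sub>E \<Phi>" using weyl_root by auto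
  show "inj_on (\<lambda>w. restrict w \<Phi>) W"
  proof (rule inj_onI)
    fix w v assume w: "w \<in> W" and v: "v \<in> W" and eq: "restrict w \<Phi> = restrict v \<Phi>"
    have "(winv v \<circ> w) s = s" if "s \<in> \<Delta>" for s
      using fun_cong[OF eq, of s] simple_root[OF that] v by simp
    then have "winv v \<circ> w = id"
      using weyl_trivial[of "winv v \<circ> w"] comp_weyl w v simple_pos by simp
    then have "v \<circ> (winv v \<circ> w) = v" by simp
    then show "w = v" using winv_comp(2)[OF v] by (simp flip: comp_assoc)
  qed
qed

section \<open>Parabolic subgroups and double cosets\<close>

lemma parabolic_words: "J \<subseteq> \<Delta> \<Longrightarrow> parabolic \<Phi> J = word ` lists J"
  using simple_roots by (intro parabolic_eq_words) auto

lemma parabolic_sub: "J \<subseteq> \<Delta> \<Longrightarrow> parabolic \<Phi> J \<subseteq> W"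
  using parabolic_subgroup[of J \<Phi>] simple_roots subgroup.subset by blast

lemma parabolic_in_weyl: "u \<in> parabolic \<Phi> J \<Longrightarrow> J \<subseteq> \<Delta> \<Longrightarrow> u \<in> W"
  using parabolic_sub by blast

lemma parabolic_mono: "J \<subseteq> K \<Longrightarrow> K \<subseteq> \<Delta> \<Longrightarrow> parabolic \<Phi> J \<subseteq> parabolic \<Phi> K"
  using parabolic_words[of J] parabolic_words[of K] by (auto simp: lists_mono image_mono)

lemma id_parabolic: "J \<subseteq> \<Delta> \<Longrightarrow> id \<in> parabolic \<Phi> J"
  by (simp add: parabolic_words) (rule image_eqI[of _ _ "[]"], auto)

lemma reflection_parabolic: "s \<in> J \<Longrightarrow> J \<subseteq> \<Delta> \<Longrightarrow> reflection s \<in> parabolic \<Phi> J"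
  by (simp add: parabolic_words) (rule image_eqI[of _ _ "[s]"], auto)

lemma comp_parabolic:
  assumes "J \<subseteq> \<Delta>" "u \<in> parabolic \<Phi> J" "v \<in> parabolic \<Phi> J" shows "u \<circ> v \<in> parabolic \<Phi> J"
  using subgroup.m_closed[OF parabolic_subgroup[OF subset_trans[OF assms(1) simple_roots]] assms(2,3)]
    parabolic_in_weyl[OF _ assms(1)] assms(2,3) by (simp add: weyl_mult)

lemma winv_parabolic:
  assumes "J \<subseteq> \<Delta>" "u \<in> parabolic \<Phi> J" shows "winv u \<in> parabolic \<Phi> J"
  using subgroup.m_inv_closed[OF parabolic_subgroup[OF subset_trans[OF assms(1) simple_roots]] assms(2)] .

lemma parabolic_span: assumes "J \<subseteq> \<Delta>" "u \<in> parabolic \<Phi> J" shows "u x - x \<in> span J"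
proof -
  obtain l where "l \<in> lists J" "u = word l" using assms parabolic_words by blast
  then show ?thesis using word_span[of l x] span_mono[of "set l" J] by (auto simp: in_lists_conv_set)
qed

text \<open>
  A root outside the span of \<open>J\<close> has a positive coefficient at some simple root outside \<open>J\<close>, and
  \<open>u\<close> does not change it.
\<close>

lemma parabolic_pos:
  assumes J: "J \<subseteq> \<Delta>" and u: "u \<in> parabolic \<Phi> J" and r: "r \<in> pos" "r \<notin> span J"
  shows "u r \<in> pos"
proof -
  obtain t where t: "t \<in> \<Delta>" "t \<notin> J" "0 < coef r t" using not_in_span r J by blast
  have ur: "u r \<in> \<Phi>" using weyl_root parabolic_in_weyl u J r(1) pos_root by blast
  then have "coef (u r) t = coef r t"
    using coef_span_shift[OF parabolic_span[OF J u]] r(1) pos_root J t by blast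
  then show ?thesis using coef_pos_imp_pos ur t by metis
qed

lemma parabolic_in_span: assumes "J \<subseteq> \<Delta>" "u \<in> parabolic \<Phi> J" "x \<in> span J" shows "u x \<in> span J"
  using span_add[OF parabolic_span[OF assms(1,2), of x] assms(3)] by simp

lemma span_eq_sum_coef:
  assumes "r \<in> \<Phi>" "r \<in> span K" "K \<subseteq> \<Delta>" shows "r = (\<Sum>s\<in>K. coef r s *\<^sub>R s)"
proof -
  have "(\<Sum>s\<in>\<Delta>. coef r s *\<^sub>R s) = (\<Sum>s\<in>K. coef r s *\<^sub>R s)"
    using span_coef[OF assms(2,3)] by (intro sum.mono_neutral_right finite_simple assms(3)) auto
  then show ?thesis using sum_coef assms by simp
qed

lemma coef_weyl_image:
  assumes "w \<in> W" "r \<in> \<Phi>" "r \<in> span K" "K \<subseteq> \<Delta>"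
  shows "coef (w r) t = (\<Sum>s\<in>K. coef r s * coef (w s) t)"
proof -
  have "w r = (\<Sum>s\<in>K. coef r s *\<^sub>R w s)"
    by (subst span_eq_sum_coef[OF assms(2-4)]) (simp add: linear_sum linear_cmul weyl_linear assms)
  moreover have "w s \<in> span \<Delta>" if "s \<in> K" for s
    using that assms weyl_root simple_root root_in_span by blast
  ultimately show ?thesis
    by (simp add: real_vector.representation_sum real_vector.representation_scale independent_simple span_scale)
qed

lemma pos_span_image:
  assumes w: "w \<in> W" and K: "K \<subseteq> \<Delta>" "w ` K \<subseteq> pos" and r: "r \<in> pos" "r \<in> span K"
  shows "w r \<in> pos"
proof -
  have "0 \<le> coef (w r) t" if "t \<in> \<Delta>" for t
    unfolding coef_weyl_image[OF w pos_root[OF r(1)] r(2) K(1)]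
  proof (intro sum_nonneg mult_nonneg_nonneg)
    fix s assume s: "s \<in> K"
    show "0 \<le> coef r s" using r s K pos_iff pos_root by blast
    show "0 \<le> coef (w s) t" using s K that pos_iff pos_root by blast
  qed
  then show ?thesis using pos_iff weyl_root w r pos_root by blast
qed

lemma neg_span_image:
  assumes w: "w \<in> W" and K: "K \<subseteq> \<Delta>" "w ` K \<subseteq> pos" and r: "r \<in> \<Phi>" "r \<notin> pos" "r \<in> span K"
  shows "w r \<notin> pos"
proof -
  have "w (- r) \<in> pos" using pos_span_image[OF w K, of "- r"] r not_pos_iff[OF r(1)] span_neg by blast
  then show ?thesis using not_pos_iff[OF weyl_root[OF w r(1)]] weyl_uminus[OF w] by simp
qed

text \<open>
  Some simple root has a negative image; it cannot lie outside \<open>K\<close>, because \<open>v\<close> keeps positive roots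
  outside the span of \<open>K\<close> positive.
\<close>

lemma parabolic_descent:
  assumes K: "K \<subseteq> \<Delta>" and v: "v \<in> parabolic \<Phi> K" "v \<noteq> id"
  obtains s where "s \<in> K" "v s \<notin> pos"
proof -
  have "\<exists>s\<in>\<Delta>. v s \<notin> pos" using weyl_trivial v parabolic_in_weyl K by blast
  then show thesis using that parabolic_pos[OF K v(1)] simple_pos simple_in_span K by blast
qed

text \<open>
  Apply the inverse of \<open>w\<close> to the expansion of \<open>w s\<close> in \<open>J\<close>: this writes \<open>s\<close> as a nonnegative
  combination of positive roots, which forces every root that occurs to be \<open>s\<close>.
\<close>

lemma simple_image:
  assumes w: "w \<in> W" and J: "J \<subseteq> \<Delta>" and wJ: "winv w ` J \<subseteq> pos"
    and s: "s \<in> \<Delta>" and ws: "w s \<in> pos" "w s \<in> span J"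
  shows "w s \<in> J"
proof -
  have coef: "coef s x = (\<Sum>t\<in>J. coef (w s) t * coef (winv w t) x)" for x
    using coef_weyl_image[of "winv w" "w s" J x] w J ws pos_root by simp
  obtain t where t: "t \<in> J" "coef (w s) t \<noteq> 0"
    using span_eq_sum_coef[OF pos_root[OF ws(1)] ws(2) J] ws(1) pos_root zero_not_root
    by (metis (no_types, lifting) scaleR_zero_left sum.neutral)
  have wt: "winv w t \<in> pos" using t wJ by auto
  have "winv w t = s"
  proof (rule pos_eq_simple[OF wt s])
    fix x assume x: "x \<in> \<Delta>" "x \<noteq> s"
    have nonneg: "0 \<le> coef (w s) t * coef (winv w t) x" if "t \<in> J" for t
      using that J x ws wJ pos_iff pos_root by (intro mult_nonneg_nonneg) blast+
    have "(\<Sum>t\<in>J. coef (w s) t * coef (winv w t) x) = 0"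
      using coef[of x] x s by (simp add: coef_simple)
    then have "coef (w s) t * coef (winv w t) x = 0"
      using nonneg t(1) finite_subset[OF J finite_simple] by (simp add: sum_nonneg_eq_0_iff)
    then show "coef (winv w t) x = 0" using t by simp
  qed
  then have "w s = t" using w by (metis winv_apply(2))
  then show ?thesis using t by simp
qed

lemma double_coset_reps_iff:
  "w \<in> double_coset_reps \<Phi> \<Delta> J K \<longleftrightarrow> w \<in> W \<and> winv w ` J \<subseteq> pos \<and> w ` K \<subseteq> pos"
proof
  assume "w \<in> double_coset_reps \<Phi> \<Delta> J K"
  then show "w \<in> W \<and> winv w ` J \<subseteq> pos \<and> w ` K \<subseteq> pos"
    unfolding double_coset_reps_def coset_reps_def by auto
next
  assume w: "w \<in> W \<and> winv w ` J \<subseteq> pos \<and> w ` K \<subseteq> pos"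
  then have "winv w \<in> coset_reps \<Phi> \<Delta> J" "w = winv (winv w)" by (simp_all add: coset_reps_def)
  then show "w \<in> double_coset_reps \<Phi> \<Delta> J K"
    unfolding double_coset_reps_def using w by (intro IntI image_eqI[of w _ "winv w"]) (simp_all add: coset_reps_def)
qed

lemma double_coset_rep_inv:
  "w \<in> double_coset_reps \<Phi> \<Delta> J K \<Longrightarrow> winv w \<in> double_coset_reps \<Phi> \<Delta> K J"
  by (simp add: double_coset_reps_iff)

text \<open>
  This gives both the uniqueness of distinguished double coset representatives and Solomon's
  description of \<open>W\<^sub>K \<inter> w\<^sup>-\<^sup>1W\<^sub>Jw\<close> (the case \<open>w' = w\<close>). The proof is by induction on the number of inversions of
  \<open>v\<close>. If \<open>v\<close> sends some \<open>s \<in> K\<close> to a negative root, then so does \<open>w'v = uw\<close>. As \<open>w s\<close> is positive, it must be a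
  root in the span of \<open>J\<close>, hence an element of \<open>J\<close>. The reflection in \<open>s\<close> can then be cancelled from \<open>v\<close>
  and the reflection in \<open>w s\<close> from \<open>u\<close>.
\<close>

lemma double_coset_unique:
  assumes J: "J \<subseteq> \<Delta>" and K: "K \<subseteq> \<Delta>"
    and w: "w \<in> double_coset_reps \<Phi> \<Delta> J K" and w': "w' \<in> double_coset_reps \<Phi> \<Delta> J K"
    and "u \<in> parabolic \<Phi> J" "v \<in> parabolic \<Phi> K" "u \<circ> w = w' \<circ> v"
  shows "w = w' \<and> v \<in> parabolic \<Phi> (winv w ` J \<inter> K)"
  using assms(5-)
proof (induction "card (inversions v)" arbitrary: u v rule: less_induct)
  case less
  note u = less(2) and v = less(3) and eq = less(4)
  have wW: "w \<in> W" "winv w ` J \<subseteq> pos" "w ` K \<subseteq> pos" and wW': "w' \<in> W" "winv w' ` J \<subseteq> pos" "w' ` K \<subseteq> pos"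
    using w w' by (auto simp: double_coset_reps_iff)
  have uW: "u \<in> W" and vW: "v \<in> W" using u v J K parabolic_in_weyl by auto
  let ?L = "winv w ` J \<inter> K"
  have L: "?L \<subseteq> \<Delta>" using K by auto
  show ?case
  proof (cases "v = id")
    case True
    have "u = id"
    proof (rule ccontr)
      assume "u \<noteq> id"
      then obtain t where t: "t \<in> J" "u t \<notin> pos" using parabolic_descent[OF J u] by blast
      have "u t \<in> \<Phi>" "u t \<in> span J"
        using weyl_root[OF uW] t J simple_root parabolic_in_span[OF J u] span_base by blast+
      then have "winv w' (u t) \<notin> pos" using neg_span_image[of "winv w'" J] t wW' J by simp
      moreover have "winv w' (u t) = winv w t"
        using arg_cong[OF fun_cong[OF eq, of "winv w t"], of "winv w'"] True wW(1) wW'(1) by simp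
      ultimately show False using wW t by auto
    qed
    then show ?thesis using True eq id_parabolic[OF L] by simp
  next
    case False
    then obtain s where s: "s \<in> K" "v s \<notin> pos" using parabolic_descent[OF K v] by blast
    have s\<Delta>: "s \<in> \<Delta>" using s K by auto
    have "v s \<in> \<Phi>" "v s \<in> span K"
      using weyl_root[OF vW] s K simple_root parabolic_in_span[OF K v] span_base by blast+
    then have "w' (v s) \<notin> pos" using neg_span_image[of w' K] s wW' K by simp
    then have "u (w s) \<notin> pos" using fun_cong[OF eq, of s] by simp
    moreover have ws: "w s \<in> pos" using wW s by auto
    ultimately have "w s \<in> span J" using parabolic_pos[OF J u] by blast
    then have wsJ: "w s \<in> J" using simple_image[OF wW(1) J wW(2) s\<Delta> ws] by blast
    then have sL: "s \<in> ?L" using s wW(1) by (metis IntI image_eqI winv_apply(1))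
    have "(u \<circ> reflection (w s)) \<circ> w = u \<circ> (w \<circ> reflection s)"
      using reflection_conjugate[OF weyl_orthogonal[OF wW(1)], of s] by (simp add: comp_assoc)
    also have "\<dots> = w' \<circ> (v \<circ> reflection s)" using eq by (metis comp_assoc)
    finally have "w = w' \<and> v \<circ> reflection s \<in> parabolic \<Phi> ?L"
      using less(1)[of "v \<circ> reflection s" "u \<circ> reflection (w s)"] card_inversions_descent[OF vW s\<Delta> s(2)]
        comp_parabolic reflection_parabolic u v J K wsJ s by blast
    moreover have "v = (v \<circ> reflection s) \<circ> reflection s" by (simp add: comp_assoc)
    ultimately show ?thesis using comp_parabolic[OF L] reflection_parabolic[OF sL L] by metis
  qed
qed

text \<open>
  An element of the double coset with the fewest inversions is distinguished on both sides. For the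
  left side, inversions are counted for the inverse.
\<close>

lemma double_coset_exists:
  assumes J: "J \<subseteq> \<Delta>" and K: "K \<subseteq> \<Delta>" and g: "g \<in> W"
  obtains u v where "u \<in> parabolic \<Phi> J" "v \<in> parabolic \<Phi> K" "u \<circ> g \<circ> v \<in> double_coset_reps \<Phi> \<Delta> J K"
proof -
  define D where "D = {u \<circ> g \<circ> v | u v. u \<in> parabolic \<Phi> J \<and> v \<in> parabolic \<Phi> K}"
  have "g \<in> D" unfolding D_def using id_parabolic[OF J] id_parabolic[OF K]
    by (intro CollectI exI[of _ id]) simp
  then obtain y where y: "y \<in> D" and min: "\<And>z. z \<in> D \<Longrightarrow> card (inversions y) \<le> card (inversions z)"
    using ex_has_least_nat[of "\<lambda>y. y \<in> D" g "\<lambda>y. card (inversions y)"] by blast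
  obtain u v where uv: "y = u \<circ> g \<circ> v" "u \<in> parabolic \<Phi> J" "v \<in> parabolic \<Phi> K" using y D_def by blast
  have yW: "y \<in> W" using uv g J K parabolic_in_weyl comp_weyl by metis
  have "y s \<in> pos" if s: "s \<in> K" for s
  proof (rule ccontr)
    assume "y s \<notin> pos"
    moreover have "y \<circ> reflection s = u \<circ> g \<circ> (v \<circ> reflection s)" by (simp add: uv comp_assoc)
    then have "y \<circ> reflection s \<in> D"
      unfolding D_def using uv comp_parabolic[OF K uv(3) reflection_parabolic[OF s K]] by blast
    ultimately show False using card_inversions_descent[OF yW, of s] s K min by fastforce
  qed
  moreover have "winv y t \<in> pos" if t: "t \<in> J" for t
  proof (rule ccontr)
    assume "winv y t \<notin> pos"
    then have "card (inversions (winv y \<circ> reflection t)) < card (inversions (winv y))"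
      using card_inversions_descent[of "winv y" t] yW t J by auto
    moreover have tW: "reflection t \<in> W" using t J parabolic_in_weyl reflection_parabolic by blast
    have "winv (reflection t \<circ> y) = winv y \<circ> reflection t"
    proof (rule winv_unique)
      have "(winv y \<circ> reflection t) \<circ> (reflection t \<circ> y) = winv y \<circ> (reflection t \<circ> reflection t) \<circ> y"
        by (simp only: comp_assoc)
      then show "(winv y \<circ> reflection t) \<circ> (reflection t \<circ> y) = id" using yW by simp
    qed (simp_all add: comp_weyl tW yW)
    ultimately have "card (inversions (reflection t \<circ> y)) < card (inversions y)"
      using card_inversions_inv[OF comp_weyl[OF tW yW]] card_inversions_inv[OF yW] by simp
    moreover have "reflection t \<circ> y = (reflection t \<circ> u) \<circ> g \<circ> v" by (simp add: uv comp_assoc)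
    then have "reflection t \<circ> y \<in> D"
      unfolding D_def using uv comp_parabolic[OF J reflection_parabolic[OF t J] uv(2)] by blast
    ultimately show False using min by fastforce
  qed
  ultimately have "y \<in> double_coset_reps \<Phi> \<Delta> J K" using yW by (auto simp: double_coset_reps_iff)
  then show thesis using that uv by blast
qed

text \<open>
  Membership of a reflection in a parabolic subgroup recovers the simple roots of the subgroup,
  since the coefficient of \<open>s\<close> changes from \<open>1\<close> to \<open>- 1\<close>.
\<close>

lemma reflection_parabolic_iff:
  assumes "s \<in> \<Delta>" "M \<subseteq> \<Delta>" shows "reflection s \<in> parabolic \<Phi> M \<longleftrightarrow> s \<in> M"
proof
  assume r: "reflection s \<in> parabolic \<Phi> M"
  show "s \<in> M"
  proof (rule ccontr)
    assume "s \<notin> M"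
    then have "coef (reflection s s) s = coef s s"
      using coef_span_shift[OF parabolic_span[OF assms(2) r]] assms simple_root reflection_root by blast
    then show False using assms by (simp add: reflection_self coef_uminus simple_root coef_simple)
  qed
qed (rule reflection_parabolic[OF _ assms(2)])

text \<open>
  The conjugating element can be replaced by a distinguished representative \<open>w\<close> of its double coset.
  By Solomon's description of intersections, every simple reflection of \<open>W\<^sub>L\<close> lies in the parabolic
  subgroup of \<open>w\<^sup>-\<^sup>1(K) \<inter> L\<close>, so \<open>w\<close> maps \<open>L\<close> into \<open>K\<close>; the inverse of \<open>w\<close> is treated in the same way.
\<close>

lemma conjugate_parabolic_equiv:
  assumes K: "K \<subseteq> \<Delta>" and L: "L \<subseteq> \<Delta>" and g: "g \<in> W"
    and conj: "parabolic \<Phi> K = (\<lambda>v. g \<circ> v \<circ> winv g) ` parabolic \<Phi> L"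
  shows "weyl_equiv \<Phi> L K"
proof -
  obtain u v where uv: "u \<in> parabolic \<Phi> K" "v \<in> parabolic \<Phi> L" and w: "u \<circ> g \<circ> v \<in> double_coset_reps \<Phi> \<Delta> K L"
    using double_coset_exists[OF K L g] by blast
  define w where "w = u \<circ> g \<circ> v"
  have uW: "u \<in> W" and vW: "v \<in> W" using uv K L parabolic_in_weyl by auto
  have wW: "w \<in> W" using uW vW g comp_weyl by (simp add: w_def)
  have winv: "winv w = winv v \<circ> winv g \<circ> winv u"
    by (rule winv_unique[OF wW]) (use uW vW g in \<open>auto simp: comp_weyl w_def fun_eq_iff\<close>)
  have fwd: "w \<circ> b \<circ> winv w \<in> parabolic \<Phi> K" if b: "b \<in> parabolic \<Phi> L" for b
  proof -
    have "v \<circ> b \<circ> winv v \<in> parabolic \<Phi> L" using comp_parabolic[OF L] winv_parabolic[OF L] uv b by blast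
    then have "g \<circ> (v \<circ> b \<circ> winv v) \<circ> winv g \<in> parabolic \<Phi> K" using conj by blast
    then have "u \<circ> (g \<circ> (v \<circ> b \<circ> winv v) \<circ> winv g) \<circ> winv u \<in> parabolic \<Phi> K"
      using comp_parabolic[OF K] winv_parabolic[OF K] uv by blast
    then show ?thesis unfolding winv unfolding w_def by (simp add: comp_assoc)
  qed
  have bwd: "winv w \<circ> a \<circ> w \<in> parabolic \<Phi> L" if a: "a \<in> parabolic \<Phi> K" for a
  proof -
    have "winv u \<circ> a \<circ> u \<in> parabolic \<Phi> K" using comp_parabolic[OF K] winv_parabolic[OF K] uv a by blast
    then obtain b where b: "b \<in> parabolic \<Phi> L" "winv u \<circ> a \<circ> u = g \<circ> b \<circ> winv g" using conj by blast
    then have "winv g \<circ> (winv u \<circ> a \<circ> u) \<circ> g = b" using g by (simp add: fun_eq_iff)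
    then have "winv w \<circ> a \<circ> w = winv v \<circ> b \<circ> v" unfolding winv unfolding w_def by (auto simp: fun_eq_iff)
    then show ?thesis using comp_parabolic[OF L] winv_parabolic[OF L] uv b by metis
  qed
  have rep: "w \<in> double_coset_reps \<Phi> \<Delta> K L" using w by (simp add: w_def)
  have 1: "w s \<in> K" if s: "s \<in> L" for s
  proof -
    have r: "reflection s \<in> parabolic \<Phi> L" using reflection_parabolic s L by blast
    have "(w \<circ> reflection s \<circ> winv w) \<circ> w = w \<circ> reflection s" using wW by (simp add: comp_assoc)
    then have "reflection s \<in> parabolic \<Phi> (winv w ` K \<inter> L)"
      using double_coset_unique[OF K L rep rep fwd[OF r] r] by blast
    then have "s \<in> winv w ` K" using reflection_parabolic_iff[of s "winv w ` K \<inter> L"] s L by blast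
    then show ?thesis using wW by auto
  qed
  have 2: "winv w t \<in> L" if t: "t \<in> K" for t
  proof -
    have r: "reflection t \<in> parabolic \<Phi> K" using reflection_parabolic t K by blast
    have "(winv w \<circ> reflection t \<circ> w) \<circ> winv w = winv w \<circ> reflection t" using wW by (simp add: comp_assoc)
    then have "reflection t \<in> parabolic \<Phi> (winv (winv w) ` L \<inter> K)"
      using double_coset_unique[OF L K double_coset_rep_inv[OF rep] double_coset_rep_inv[OF rep] bwd[OF r] r] by blast
    then have "t \<in> winv (winv w) ` L"
      using reflection_parabolic_iff[of t "winv (winv w) ` L \<inter> K"] t K by blast
    then show ?thesis using wW by auto
  qed
  have "w ` L = K"
  proof
    show "w ` L \<subseteq> K" using 1 by auto
    show "K \<subseteq> w ` L" using 2 wW by (metis image_eqI subsetI winv_apply(2))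
  qed
  then show ?thesis unfolding weyl_equiv_def using wW by blast
qed

lemma parabolic_conjugate:
  assumes w: "w \<in> W" and J: "J \<subseteq> \<Delta>" and wJ: "w ` J \<subseteq> \<Delta>" and u: "u \<in> parabolic \<Phi> J"
  shows "w \<circ> u \<circ> winv w \<in> parabolic \<Phi> (w ` J)"
proof -
  obtain l where l: "l \<in> lists J" "u = word l" using u parabolic_words[OF J] by blast
  then have "w \<circ> u \<circ> winv w = word (map w l)"
    using word_conjugate[OF weyl_orthogonal[OF w], of l] w by (simp add: comp_assoc)
  moreover have "map w l \<in> lists (w ` J)" using l(1) by auto
  ultimately show ?thesis by (simp add: parabolic_words[OF wJ])
qed

lemma weyl_equiv_refl: "weyl_equiv \<Phi> J J"
  unfolding weyl_equiv_def by (rule bexI[OF _ id_weyl]) simp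

lemma weyl_equiv_sym: assumes "weyl_equiv \<Phi> J K" shows "weyl_equiv \<Phi> K J"
proof -
  obtain w where w: "w \<in> W" "w ` J = K" using assms by (auto simp: weyl_equiv_def)
  then have "winv w ` K = J" by (auto simp: image_iff)
  then show ?thesis unfolding weyl_equiv_def using w by blast
qed

lemma weyl_equiv_trans: assumes "weyl_equiv \<Phi> J K" "weyl_equiv \<Phi> K L" shows "weyl_equiv \<Phi> J L"
  using assms unfolding weyl_equiv_def by (metis comp_weyl image_comp)

text \<open>
  For a simple root \<open>s\<close> outside \<open>K\<close>, the reflection in \<open>s\<close> belongs to \<open>X\<^sub>K\<close> and makes \<open>s\<close> negative.
\<close>

lemma coset_reps_inj:
  assumes "K \<subseteq> \<Delta>" "L \<subseteq> \<Delta>" "coset_reps \<Phi> \<Delta> K = coset_reps \<Phi> \<Delta> L"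
  shows "K = L"
proof -
  have "L \<subseteq> K" if K: "K \<subseteq> \<Delta>" and L: "L \<subseteq> \<Delta>" and eq: "coset_reps \<Phi> \<Delta> K = coset_reps \<Phi> \<Delta> L" for K L
  proof
    fix s assume s: "s \<in> L"
    show "s \<in> K"
    proof (rule ccontr)
      assume "s \<notin> K"
      then have "reflection s t \<in> pos" if "t \<in> K" for t
        using that s L K simple_reflection_pos[of s t] simple_pos[of t] by blast
      moreover have "reflection s \<in> W" using s L simple_root reflection_in_weyl by blast
      ultimately have "reflection s \<in> coset_reps \<Phi> \<Delta> K" by (auto simp: coset_reps_def)
      then have "reflection s s \<in> pos" using eq s by (auto simp: coset_reps_def)
      then show False using s L simple_pos simple_root not_pos_iff[of s] by (auto simp: reflection_self)
    qed
  qed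
  then show ?thesis using assms by (metis subset_antisym)
qed

lemma descent_elem_inj:
  assumes "K \<subseteq> \<Delta>" "L \<subseteq> \<Delta>" "descent_elem \<Phi> \<Delta> K = descent_elem \<Phi> \<Delta> L"
  shows "K = L"
proof -
  have "Poly_Mapping.lookup (descent_elem \<Phi> \<Delta> K) w = (if w \<in> coset_reps \<Phi> \<Delta> K then 1 else 0)" for K w
  proof -
    have "finite (coset_reps \<Phi> \<Delta> K)" by (rule finite_subset[OF _ finite_weyl]) (auto simp: coset_reps_def)
    then show ?thesis
      by (simp add: descent_elem_def lookup_sum lookup_single when_def)
  qed
  then have "coset_reps \<Phi> \<Delta> K = coset_reps \<Phi> \<Delta> L" using assms(3) by (metis (no_types, lifting) subsetI subset_antisym zero_neq_one)
  then show ?thesis using coset_reps_inj assms by blast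
qed

text \<open>
  The classes are sets of elements \<open>x\<^sub>K\<close>, so this relies on \<open>x\<^sub>K\<close> determining \<open>K\<close>.
\<close>

lemma descent_class_eq_iff:
  assumes "J \<subseteq> \<Delta>" "K \<subseteq> \<Delta>"
  shows "descent_class \<Phi> \<Delta> J = descent_class \<Phi> \<Delta> K \<longleftrightarrow> weyl_equiv \<Phi> J K"
proof
  assume "descent_class \<Phi> \<Delta> J = descent_class \<Phi> \<Delta> K"
  moreover have "descent_elem \<Phi> \<Delta> K \<in> descent_class \<Phi> \<Delta> K"
    unfolding descent_class_def using assms weyl_equiv_refl by blast
  ultimately have "descent_elem \<Phi> \<Delta> K \<in> descent_class \<Phi> \<Delta> J" by simp
  then show "weyl_equiv \<Phi> J K"
    unfolding descent_class_def using descent_elem_inj assms by blast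
next
  assume "weyl_equiv \<Phi> J K"
  then show "descent_class \<Phi> \<Delta> J = descent_class \<Phi> \<Delta> K"
    unfolding descent_class_def using weyl_equiv_trans weyl_equiv_sym by blast
qed

end

section \<open>Coset spaces of parabolic subgroups\<close>

context simple_system
begin

abbreviation coset_space :: "'a set \<Rightarrow> ('a \<Rightarrow> 'a, ('a \<Rightarrow> 'a) set) gset" where
  "coset_space J \<equiv> gset_cosets (weyl_group \<Phi>) (parabolic \<Phi> J)"

abbreviation coset_basis :: "'a set \<Rightarrow> (('a \<Rightarrow> 'a, nat) gset set \<Rightarrow>\<^sub>0 rat)" where
  "coset_basis J \<equiv> gset_basis (weyl_group \<Phi>) (coset_space J)"

abbreviation rel_ideal :: "(('a \<Rightarrow> 'a, nat) gset set \<Rightarrow>\<^sub>0 rat) set" where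
  "rel_ideal \<equiv> burnside_ideal (weyl_group \<Phi>)"

lemma subgroup_parabolic: "J \<subseteq> \<Delta> \<Longrightarrow> subgroup (parabolic \<Phi> J) (weyl_group \<Phi>)"
  using parabolic_subgroup simple_roots by blast

lemma finite_coset_space: "J \<subseteq> \<Delta> \<Longrightarrow> finite_gset (weyl_group \<Phi>) (coset_space J)"
  by (intro weyl.finite_gset_cosets finite_weyl subgroup_parabolic)

lemma coset_basis_carrier: "J \<subseteq> \<Delta> \<Longrightarrow> coset_basis J \<in> carrier (gset_ring (weyl_group \<Phi>))"
  by (intro weyl.gset_basis_carrier finite_coset_space)

lemma coset_basis_equiv:
  assumes J: "J \<subseteq> \<Delta>" and K: "K \<subseteq> \<Delta>" and "weyl_equiv \<Phi> J K"
  shows "coset_basis J = coset_basis K"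
proof -
  obtain w where w: "w \<in> W" "w ` J = K" using assms(3) by (auto simp: weyl_equiv_def)
  then have wK: "winv w ` K = J" by (auto simp: image_iff)
  have "h \<in> parabolic \<Phi> J \<longleftrightarrow> w \<otimes>\<^bsub>weyl_group \<Phi>\<^esub> h \<otimes>\<^bsub>weyl_group \<Phi>\<^esub> winv w \<in> parabolic \<Phi> K" if h: "h \<in> W" for h
  proof -
    have eq: "w \<otimes>\<^bsub>weyl_group \<Phi>\<^esub> h \<otimes>\<^bsub>weyl_group \<Phi>\<^esub> winv w = w \<circ> h \<circ> winv w"
      using w h by (simp add: weyl_mult comp_weyl)
    have "winv w \<circ> (w \<circ> h \<circ> winv w) \<circ> winv (winv w) = h" using w by (simp add: fun_eq_iff)
    then have conv: "h \<in> parabolic \<Phi> J" if "w \<circ> h \<circ> winv w \<in> parabolic \<Phi> K"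
      using parabolic_conjugate[OF weyl.inv_closed[OF w(1)] K _ that] J unfolding wK by simp
    have "w \<circ> h \<circ> winv w \<in> parabolic \<Phi> K" if "h \<in> parabolic \<Phi> J"
      using parabolic_conjugate[OF w(1) J _ that] K unfolding w(2) by simp
    then show ?thesis unfolding eq using conv by blast
  qed
  then have "gset_isomorphic (weyl_group \<Phi>) (coset_space J) (coset_space K)"
    by (intro weyl.gset_cosets_conjugate[OF subgroup_parabolic[OF J] subgroup_parabolic[OF K] w(1)])
  then show ?thesis by (rule weyl.gset_basis_iso[OF finite_coset_space[OF J]])
qed

lemma coset_basis_simple: "coset_basis \<Delta> = gset_basis (weyl_group \<Phi>) gset_point"
proof (rule weyl.gset_basis_iso[OF finite_coset_space[OF subset_refl]])
  have sub: "subgroup W (weyl_group \<Phi>)" by (rule weyl.subgroup_self)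
  have single: "fst (coset_space \<Delta>) = {id <#\<^bsub>weyl_group \<Phi>\<^esub> W}"
  proof -
    have "a <#\<^bsub>weyl_group \<Phi>\<^esub> W = id <#\<^bsub>weyl_group \<Phi>\<^esub> W" if "a \<in> W" for a
      using weyl.lcos_eq_iff[OF sub that id_weyl] weyl.m_closed[OF weyl.inv_closed[OF that] id_weyl] by blast
    then show ?thesis
      unfolding gset_cosets_def fst_conv parabolic_simple LCOSETS_def using id_weyl by blast
  qed
  show "gset_isomorphic (weyl_group \<Phi>) (coset_space \<Delta>) gset_point"
    unfolding gset_isomorphic_def single
    by (rule exI[of _ "\<lambda>_. ()"]) (simp add: bij_betw_def gset_point_def)
qed

lemma finite_double_coset_reps: "finite (double_coset_reps \<Phi> \<Delta> J K)"
  by (rule finite_subset[OF _ finite_weyl]) (auto simp: double_coset_reps_iff)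

text \<open>
  Mackey's formula with the distinguished representatives as the set of double coset
  representatives; \<open>double_coset_unique\<close> identifies the stabilizers as parabolic subgroups.
\<close>

lemma mackey_parabolic:
  assumes J: "J \<subseteq> \<Delta>" and K: "K \<subseteq> \<Delta>"
  shows "coset_basis J \<otimes>\<^bsub>gset_ring (weyl_group \<Phi>)\<^esub> coset_basis K
    - (\<Sum>w\<in>double_coset_reps \<Phi> \<Delta> J K. coset_basis (winv w ` J \<inter> K)) \<in> rel_ideal"
  unfolding weyl.gset_basis_mult[OF finite_coset_space[OF J] finite_coset_space[OF K]]
proof (rule weyl.mackey_decomposition[OF finite_weyl subgroup_parabolic[OF J] subgroup_parabolic[OF K]])
  show sub: "double_coset_reps \<Phi> \<Delta> J K \<subseteq> W" by (auto simp: double_coset_reps_iff)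
  show "\<exists>h\<in>parabolic \<Phi> J. \<exists>d\<in>double_coset_reps \<Phi> \<Delta> J K. \<exists>k\<in>parabolic \<Phi> K.
      x = h \<otimes>\<^bsub>weyl_group \<Phi>\<^esub> d \<otimes>\<^bsub>weyl_group \<Phi>\<^esub> k" if x: "x \<in> W" for x
  proof -
    obtain u v where uv: "u \<in> parabolic \<Phi> J" "v \<in> parabolic \<Phi> K" and d: "u \<circ> x \<circ> v \<in> double_coset_reps \<Phi> \<Delta> J K"
      using double_coset_exists[OF J K x] by blast
    have uvW: "u \<in> W" "v \<in> W" using uv J K parabolic_in_weyl by auto
    have "x = winv u \<otimes>\<^bsub>weyl_group \<Phi>\<^esub> (u \<circ> x \<circ> v) \<otimes>\<^bsub>weyl_group \<Phi>\<^esub> winv v"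
      using uvW x by (simp add: weyl_mult comp_weyl fun_eq_iff)
    then show ?thesis using winv_parabolic[OF J uv(1)] winv_parabolic[OF K uv(2)] d by blast
  qed
  show "d = d'" if d: "d \<in> double_coset_reps \<Phi> \<Delta> J K" "d' \<in> double_coset_reps \<Phi> \<Delta> J K"
    and h: "h \<in> parabolic \<Phi> J" and k: "k \<in> parabolic \<Phi> K"
    and eq: "h \<otimes>\<^bsub>weyl_group \<Phi>\<^esub> d = d' \<otimes>\<^bsub>weyl_group \<Phi>\<^esub> k" for d d' h k
  proof -
    have "h \<in> W" "k \<in> W" "d \<in> W" "d' \<in> W" using d sub h k J K parabolic_in_weyl by blast+
    then have "h \<circ> d = d' \<circ> k" using eq by (simp add: weyl_mult)
    then show ?thesis using double_coset_unique[OF J K d h k] by blast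
  qed
  fix d assume d: "d \<in> double_coset_reps \<Phi> \<Delta> J K"
  let ?L = "winv d ` J \<inter> K"
  have L: "?L \<subseteq> \<Delta>" using K by auto
  show "subgroup (parabolic \<Phi> ?L) (weyl_group \<Phi>)" by (rule subgroup_parabolic[OF L])
  fix k assume k: "k \<in> W"
  have dW: "d \<in> W" using d sub by blast
  have eq: "d \<otimes>\<^bsub>weyl_group \<Phi>\<^esub> k \<otimes>\<^bsub>weyl_group \<Phi>\<^esub> winv d = d \<circ> k \<circ> winv d"
    using dW k by (simp add: weyl_mult comp_weyl)
  have dL: "d ` ?L \<subseteq> J" using dW by auto
  show "k \<in> parabolic \<Phi> ?L \<longleftrightarrow> k \<in> parabolic \<Phi> K \<and> d \<otimes>\<^bsub>weyl_group \<Phi>\<^esub> k \<otimes>\<^bsub>weyl_group \<Phi>\<^esub> winv d \<in> parabolic \<Phi> J"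
    unfolding eq
  proof
    assume kL: "k \<in> parabolic \<Phi> ?L"
    have "d \<circ> k \<circ> winv d \<in> parabolic \<Phi> (d ` ?L)"
      by (rule parabolic_conjugate[OF dW L _ kL]) (use dL J in blast)
    then show "k \<in> parabolic \<Phi> K \<and> d \<circ> k \<circ> winv d \<in> parabolic \<Phi> J"
      using kL parabolic_mono[OF dL J] parabolic_mono[of ?L K] K by blast
  next
    assume *: "k \<in> parabolic \<Phi> K \<and> d \<circ> k \<circ> winv d \<in> parabolic \<Phi> J"
    moreover have "(d \<circ> k \<circ> winv d) \<circ> d = d \<circ> k" using dW by (simp add: comp_assoc)
    ultimately show "k \<in> parabolic \<Phi> ?L" using double_coset_unique[OF J K d d] by blast
  qed
qed

text \<open>
  Collecting the representatives with the same set \<open>L = w\<^sup>-\<^sup>1(J) \<inter> K\<close> produces the numbers \<open>a\<^sub>J\<^sub>K\<^sub>L\<close>.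
\<close>

lemma sum_double_coset_reps:
  fixes b :: "'a set \<Rightarrow> 'z \<Rightarrow>\<^sub>0 rat"
  assumes "K \<subseteq> \<Delta>"
  shows "(\<Sum>w\<in>double_coset_reps \<Phi> \<Delta> J K. b (winv w ` J \<inter> K))
    = (\<Sum>L\<in>Pow K. scale (of_nat (descent_coeff \<Phi> \<Delta> J K L)) (b L))"
proof -
  let ?D = "double_coset_reps \<Phi> \<Delta> J K"
  have "finite (Pow K)" using assms finite_simple finite_subset by blast
  then have "(\<Sum>w\<in>?D. b (winv w ` J \<inter> K))
      = (\<Sum>L\<in>Pow K. \<Sum>w\<in>{w \<in> ?D. winv w ` J \<inter> K = L}. b (winv w ` J \<inter> K))"
    by (intro sum.group[symmetric] finite_double_coset_reps) auto
  also have "\<dots> = (\<Sum>L\<in>Pow K. \<Sum>w\<in>{w \<in> ?D. winv w ` J \<inter> K = L}. b L)"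
    by (intro sum.cong) auto
  finally show ?thesis by (simp only: scale.sum_constant_scale descent_coeff_def)
qed

section \<open>The map to the parabolic Burnside ring\<close>

abbreviation descent_classes :: "(('a \<Rightarrow> 'a) \<Rightarrow>\<^sub>0 rat) set set" where
  "descent_classes \<equiv> descent_class \<Phi> \<Delta> ` Pow \<Delta>"

abbreviation rep :: "(('a \<Rightarrow> 'a) \<Rightarrow>\<^sub>0 rat) set \<Rightarrow> 'a set" where
  "rep \<equiv> class_rep \<Phi> \<Delta>"

lemma class_rep:
  assumes "C \<in> descent_classes" shows "rep C \<subseteq> \<Delta>" "descent_class \<Phi> \<Delta> (rep C) = C"
proof -
  have "\<exists>J. J \<subseteq> \<Delta> \<and> descent_class \<Phi> \<Delta> J = C" using assms by auto
  from someI_ex[OF this] show "rep C \<subseteq> \<Delta>" "descent_class \<Phi> \<Delta> (rep C) = C"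
    by (auto simp: class_rep_def)
qed

lemma coset_basis_rep:
  assumes "J \<subseteq> \<Delta>" shows "coset_basis (rep (descent_class \<Phi> \<Delta> J)) = coset_basis J"
  using class_rep[of "descent_class \<Phi> \<Delta> J"] assms
  by (intro coset_basis_equiv) (auto simp: descent_class_eq_iff[symmetric])

text \<open>
  The map \<open>\<phi>\<close> factors through the free module on the isomorphism classes of \<open>W\<close>-sets; \<open>lift_map\<close> is the
  first factor and \<open>weyl.burnside_proj\<close> the second.
\<close>

definition lift_map :: "((('a \<Rightarrow> 'a) \<Rightarrow>\<^sub>0 rat) set \<Rightarrow>\<^sub>0 rat) \<Rightarrow> (('a \<Rightarrow> 'a, nat) gset set \<Rightarrow>\<^sub>0 rat)" where
  "lift_map = lin_ext scale (\<lambda>C. coset_basis (rep C))"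

lemma lift_map_linear: "module_hom scale scale lift_map"
  unfolding lift_map_def by (rule scale.module_hom_lin_ext)

lemma lift_map_basis: "J \<subseteq> \<Delta> \<Longrightarrow> lift_map (descent_basis \<Phi> \<Delta> J) = coset_basis J"
  by (simp add: lift_map_def descent_basis_def coset_basis_rep)

lemma lift_map_carrier:
  assumes "Poly_Mapping.keys f \<subseteq> descent_classes"
  shows "lift_map f \<in> carrier (gset_ring (weyl_group \<Phi>))"
  unfolding lift_map_def lin_ext_def
  by (intro weyl.gset_ring_sum_closed weyl.gset_ring_scale_closed coset_basis_carrier class_rep)
    (use assms in auto)

lemma finite_descent_classes: "finite descent_classes" using finite_simple by simp

text \<open>
  A fixed coset gives an element that conjugates \<open>W\<^sub>J\<close> into \<open>W\<^sub>K\<close>, and by the assumption on the orders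
  its image is all of \<open>W\<^sub>K\<close>.
\<close>

lemma mark_parabolic_equiv:
  assumes J: "J \<subseteq> \<Delta>" and K: "K \<subseteq> \<Delta>" and card: "card (parabolic \<Phi> K) \<le> card (parabolic \<Phi> J)"
    and mark: "weyl.mark (parabolic \<Phi> J) (coset_space K) \<noteq> 0"
  shows "weyl_equiv \<Phi> K J"
proof -
  obtain g where g: "g \<in> W"
    and sub: "\<And>k. k \<in> parabolic \<Phi> J \<Longrightarrow> winv g \<otimes>\<^bsub>weyl_group \<Phi>\<^esub> k \<otimes>\<^bsub>weyl_group \<Phi>\<^esub> g \<in> parabolic \<Phi> K"
    using weyl.mark_cosets_nonzero[OF subgroup_parabolic[OF K] parabolic_sub[OF J] mark] by blast
  let ?c = "\<lambda>k. winv g \<circ> k \<circ> g"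
  have "?c k \<in> parabolic \<Phi> K" if "k \<in> parabolic \<Phi> J" for k
    using sub[OF that] g parabolic_in_weyl[OF that J] by (simp add: weyl_mult comp_weyl)
  moreover have c: "g \<circ> ?c k \<circ> winv g = k" for k using g by (simp add: fun_eq_iff)
  then have "inj_on ?c (parabolic \<Phi> J)" by (intro inj_on_inverseI[where g = "\<lambda>v. g \<circ> v \<circ> winv g"])
  then have "card (?c ` parabolic \<Phi> J) = card (parabolic \<Phi> J)" by (rule card_image)
  moreover have "finite (parabolic \<Phi> K)" using finite_subset[OF parabolic_sub[OF K] finite_weyl] .
  ultimately have "?c ` parabolic \<Phi> J = parabolic \<Phi> K"
    using card by (intro card_seteq) auto
  then have "(\<lambda>v. g \<circ> v \<circ> winv g) ` parabolic \<Phi> K = (\<lambda>v. g \<circ> v \<circ> winv g) ` ?c ` parabolic \<Phi> J"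
    by simp
  then have "parabolic \<Phi> J = (\<lambda>v. g \<circ> v \<circ> winv g) ` parabolic \<Phi> K"
    by (simp only: image_image c image_ident)
  then show ?thesis by (rule conjugate_parabolic_equiv[OF J K g])
qed

text \<open>
  Linear independence of the \<open>W/W\<^sub>J\<close> by triangularity of the table of marks. Among the classes in
  the support of \<open>f\<close>, take one whose parabolic subgroup \<open>H\<close> has maximal order. Then \<open>H\<close> has no fixed
  points on the coset spaces of the other classes, but it has one on its own, so the mark of \<open>H\<close> is
  a nonzero multiple of the coefficient of that class.
\<close>

lemma lift_map_kernel:
  assumes f: "Poly_Mapping.keys f \<subseteq> descent_classes" and ker: "lift_map f \<in> rel_ideal"
  shows "f = 0"
proof (rule ccontr)
  assume "f \<noteq> 0"
  define h where "h C = card (parabolic \<Phi> (rep C))" for C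
  have "Poly_Mapping.keys f \<noteq> {}"
  proof
    assume "Poly_Mapping.keys f = {}"
    then have "Poly_Mapping.lookup f C = 0" for C using in_keys_iff[of C f] by blast
    then have "f = 0" by (intro poly_mapping_eqI) simp
    then show False using \<open>f \<noteq> 0\<close> by simp
  qed
  then have "Max (h ` Poly_Mapping.keys f) \<in> h ` Poly_Mapping.keys f" by (intro Max_in) auto
  then obtain C where C: "Max (h ` Poly_Mapping.keys f) = h C" "C \<in> Poly_Mapping.keys f" by (rule imageE)
  have max: "h D \<le> h C" if "D \<in> Poly_Mapping.keys f" for D
    unfolding C(1)[symmetric] using that by (intro Max_ge) auto
  have rep: "rep D \<subseteq> \<Delta>" "descent_class \<Phi> \<Delta> (rep D) = D" if "D \<in> Poly_Mapping.keys f" for D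
    by (rule class_rep[OF subsetD[OF f that]])+
  let ?H = "parabolic \<Phi> (rep C)"
  have H: "subgroup ?H (weyl_group \<Phi>)" by (rule subgroup_parabolic[OF rep(1)[OF C(2)]])
  note HG = subgroup.subset[OF H]
  have other: "weyl.mark ?H (coset_space (rep D)) = 0" if D: "D \<in> Poly_Mapping.keys f" "D \<noteq> C" for D
  proof (rule ccontr)
    assume "weyl.mark ?H (coset_space (rep D)) \<noteq> 0"
    then have "weyl_equiv \<Phi> (rep D) (rep C)"
      using mark_parabolic_equiv[OF rep(1)[OF C(2)] rep(1)[OF D(1)]] max[OF D(1)] by (simp add: h_def)
    then have "descent_class \<Phi> \<Delta> (rep D) = descent_class \<Phi> \<Delta> (rep C)"
      by (simp only: descent_class_eq_iff[OF rep(1)[OF D(1)] rep(1)[OF C(2)]])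
    then show False using rep(2)[OF D(1)] rep(2)[OF C(2)] D(2) by simp
  qed
  have "weyl.mark_hom ?H (lift_map f)
      = lin_ext (*) (\<lambda>D. weyl.mark_hom ?H (coset_basis (rep D))) f"
    unfolding lift_map_def by (rule module_hom.lin_ext_image[OF weyl.mark_hom_linear])
  also have "\<dots> = (\<Sum>D\<in>Poly_Mapping.keys f. Poly_Mapping.lookup f D * of_nat (weyl.mark ?H (coset_space (rep D))))"
    unfolding lin_ext_def
    by (intro sum.cong refl) (simp add: weyl.mark_hom_basis HG finite_coset_space rep)
  also have "\<dots> = (\<Sum>D\<in>{C}. Poly_Mapping.lookup f D * of_nat (weyl.mark ?H (coset_space (rep D))))"
    by (rule sum.mono_neutral_right) (use C(2) other in auto)
  finally have "Poly_Mapping.lookup f C * of_nat (weyl.mark ?H (coset_space (rep C))) = 0"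
    using weyl.mark_hom_burnside_ideal[OF HG ker] by simp
  moreover have "weyl.mark ?H (coset_space (rep C)) \<noteq> 0"
    using weyl.mark_cosets_pos[OF H finite_weyl] by simp
  ultimately show False using C(2) by (simp add: in_keys_iff)
qed

lemma lift_map_product:
  assumes J: "J \<subseteq> \<Delta>" and K: "K \<subseteq> \<Delta>"
  shows "coset_basis J \<otimes>\<^bsub>gset_ring (weyl_group \<Phi>)\<^esub> coset_basis K - lift_map (descent_product \<Phi> \<Delta> J K) \<in> rel_ideal"
proof -
  have "lift_map (descent_product \<Phi> \<Delta> J K)
      = (\<Sum>L\<in>Pow K. scale (of_nat (descent_coeff \<Phi> \<Delta> J K L)) (coset_basis L))"
    unfolding descent_product_def module_hom.sum[OF lift_map_linear] module_hom.scale[OF lift_map_linear]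
    using K by (intro sum.cong refl) (simp add: lift_map_basis)
  then show ?thesis
    using mackey_parabolic[OF J K] by (simp only: sum_double_coset_reps[OF K, where b = coset_basis])
qed

lemma new_descent_mult:
  "f \<otimes>\<^bsub>new_descent_algebra \<Phi> \<Delta>\<^esub> h = bilin_ext (\<lambda>C D. descent_product \<Phi> \<Delta> (rep C) (rep D)) f h"
  by (simp add: new_descent_algebra_def bilin_ext_alt)

lemma lift_map_mult:
  assumes f: "Poly_Mapping.keys f \<subseteq> descent_classes" and h: "Poly_Mapping.keys h \<subseteq> descent_classes"
  shows "lift_map f \<otimes>\<^bsub>gset_ring (weyl_group \<Phi>)\<^esub> lift_map h
    - lift_map (f \<otimes>\<^bsub>new_descent_algebra \<Phi> \<Delta>\<^esub> h) \<in> rel_ideal"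
proof -
  let ?R = "gset_ring (weyl_group \<Phi>) :: (('a \<Rightarrow> 'a, nat) gset set \<Rightarrow>\<^sub>0 rat) ring"
  have "lift_map f \<otimes>\<^bsub>?R\<^esub> lift_map h
      = lin_ext scale (\<lambda>C. lin_ext scale (\<lambda>D. coset_basis (rep C) \<otimes>\<^bsub>?R\<^esub> coset_basis (rep D)) h) f"
    unfolding weyl.gset_ring_mult lift_map_def
      module_hom.lin_ext_image[OF bilin_ext_linear_left]
    unfolding module_hom.lin_ext_image[OF bilin_ext_linear_right] ..
  moreover have "lift_map (f \<otimes>\<^bsub>new_descent_algebra \<Phi> \<Delta>\<^esub> h)
      = lin_ext scale (\<lambda>C. lin_ext scale (\<lambda>D. lift_map (descent_product \<Phi> \<Delta> (rep C) (rep D))) h) f"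
    unfolding new_descent_mult bilin_ext_def module_hom.lin_ext_image[OF lift_map_linear] ..
  ultimately show ?thesis
    by (simp only: lin_ext_diff_fun)
      (intro weyl.burnside_ideal_lin_ext lift_map_product class_rep(1) subsetD[OF f] subsetD[OF h])
qed

lemma new_descent_simps [simp]:
  "carrier (new_descent_algebra \<Phi> \<Delta>) = {f. Poly_Mapping.keys f \<subseteq> descent_classes}"
  "f \<oplus>\<^bsub>new_descent_algebra \<Phi> \<Delta>\<^esub> h = f + h"
  "\<one>\<^bsub>new_descent_algebra \<Phi> \<Delta>\<^esub> = descent_basis \<Phi> \<Delta> \<Delta>"
  "c \<odot>\<^bsub>new_descent_algebra \<Phi> \<Delta>\<^esub> f = scale c f"
  by (simp_all add: new_descent_algebra_def)

lemma descent_basis_keys: "J \<subseteq> \<Delta> \<Longrightarrow> Poly_Mapping.keys (descent_basis \<Phi> \<Delta> J) \<subseteq> descent_classes"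
  by (auto simp: descent_basis_def)

lemma keys_sum_scale:
  assumes "\<And>i. i \<in> S \<Longrightarrow> Poly_Mapping.keys (b i) \<subseteq> descent_classes"
  shows "Poly_Mapping.keys (\<Sum>i\<in>S. scale (c i) (b i) :: _ \<Rightarrow>\<^sub>0 rat) \<subseteq> descent_classes"
  using assms
proof (induction S rule: infinite_finite_induct)
  case (insert i S)
  then show ?case
    using Poly_Mapping.keys_add[of "scale (c i) (b i)" "\<Sum>i\<in>S. scale (c i) (b i)"] keys_scale[of "c i" "b i"]
    by (simp del: Poly_Mapping.keys_add) blast
qed auto

lemma descent_product_keys:
  assumes "K \<subseteq> \<Delta>"
  shows "Poly_Mapping.keys (descent_product \<Phi> \<Delta> J K) \<subseteq> descent_classes"
  unfolding descent_product_def
  by (rule keys_sum_scale, rule descent_basis_keys) (use assms in auto)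

lemma new_descent_mult_closed:
  assumes "Poly_Mapping.keys f \<subseteq> descent_classes" "Poly_Mapping.keys h \<subseteq> descent_classes"
  shows "Poly_Mapping.keys (f \<otimes>\<^bsub>new_descent_algebra \<Phi> \<Delta>\<^esub> h) \<subseteq> descent_classes"
  unfolding new_descent_mult bilin_ext_def
  by (intro keys_lin_ext descent_product_keys class_rep(1)) (use assms in auto)

lemma parabolic_class_proj: "parabolic_class \<Phi> J = weyl.burnside_proj (coset_basis J)"
  by (simp add: parabolic_class_def burnside_class_def)

lemma parabolic_finsum:
  assumes "finite S" "\<And>i. i \<in> S \<Longrightarrow> j i \<subseteq> \<Delta>"
  shows "finsum (burnside (weyl_group \<Phi>)) (\<lambda>i. c i \<odot>\<^bsub>burnside (weyl_group \<Phi>)\<^esub> parabolic_class \<Phi> (j i)) S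
    = weyl.burnside_proj (\<Sum>i\<in>S. scale (c i) (coset_basis (j i)))"
proof -
  let ?B = "burnside (weyl_group \<Phi>) :: (rat, (('a \<Rightarrow> 'a, nat) gset set \<Rightarrow>\<^sub>0 rat) set) module"
  interpret B: abelian_monoid ?B by (rule weyl.burnside_abelian_monoid)
  have closed: "scale (c i) (coset_basis (j i)) \<in> carrier (gset_ring (weyl_group \<Phi>))" if "i \<in> S" for i
    using that assms by (intro weyl.gset_ring_scale_closed coset_basis_carrier)
  have "finsum ?B (\<lambda>i. c i \<odot>\<^bsub>?B\<^esub> parabolic_class \<Phi> (j i)) S
      = finsum ?B (\<lambda>i. weyl.burnside_proj (scale (c i) (coset_basis (j i)))) S"
  proof (rule B.finsum_cong'[OF refl])
    show "(\<lambda>i. weyl.burnside_proj (scale (c i) (coset_basis (j i)))) \<in> S \<rightarrow> carrier ?B"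
      unfolding weyl.burnside_carrier using closed by blast
    show "c i \<odot>\<^bsub>?B\<^esub> parabolic_class \<Phi> (j i) = weyl.burnside_proj (scale (c i) (coset_basis (j i)))"
      if "i \<in> S" for i
      unfolding parabolic_class_proj
      by (rule weyl.burnside_smult[OF coset_basis_carrier[OF assms(2)[OF that]]])
  qed
  also have "\<dots> = weyl.burnside_proj (\<Sum>i\<in>S. scale (c i) (coset_basis (j i)))"
    by (rule weyl.burnside_finsum[OF assms(1) closed])
  finally show ?thesis .
qed

lemma descent_to_burnside_proj:
  assumes "Poly_Mapping.keys f \<subseteq> descent_classes"
  shows "descent_to_burnside \<Phi> \<Delta> f = weyl.burnside_proj (lift_map f)"
  unfolding descent_to_burnside_def Let_def lift_map_def lin_ext_def
  by (rule parabolic_finsum) (use assms class_rep(1) in auto)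

text \<open>
  The parabolic Burnside ring consists of combinations indexed by subsets of \<open>\<Delta>\<close>, while \<open>f\<close> has one
  coefficient for each class. A combination of the second kind is turned into one of the first kind
  by putting the coefficient of a class on its chosen representative and zero elsewhere.
\<close>

lemma parabolic_burnside_carrier:
  "carrier (parabolic_burnside \<Phi> \<Delta> :: (rat, _) module)
    = (\<lambda>f. weyl.burnside_proj (lift_map f)) ` {f. Poly_Mapping.keys f \<subseteq> descent_classes}"
proof -
  have carrier: "carrier (parabolic_burnside \<Phi> \<Delta> :: (rat, _) module)
      = range (\<lambda>c. weyl.burnside_proj (\<Sum>J\<in>Pow \<Delta>. scale (c J) (coset_basis J)))"
  proof -
    have "finsum (burnside (weyl_group \<Phi>)) (\<lambda>J. c J \<odot>\<^bsub>burnside (weyl_group \<Phi>)\<^esub> parabolic_class \<Phi> J) (Pow \<Delta>)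
        = weyl.burnside_proj (\<Sum>J\<in>Pow \<Delta>. scale (c J) (coset_basis J))" for c :: "'a set \<Rightarrow> rat"
      by (rule parabolic_finsum[where j = "\<lambda>J. J"]) (use finite_simple in auto)
    then show ?thesis unfolding parabolic_burnside_def Let_def by (simp add: full_SetCompr_eq)
  qed
  show ?thesis
  proof (intro equalityI subsetI)
    fix y assume "y \<in> carrier (parabolic_burnside \<Phi> \<Delta> :: (rat, _) module)"
    then obtain c where y: "y = weyl.burnside_proj (\<Sum>J\<in>Pow \<Delta>. scale (c J) (coset_basis J))"
      unfolding carrier by blast
    let ?f = "\<Sum>J\<in>Pow \<Delta>. scale (c J) (descent_basis \<Phi> \<Delta> J)"
    have "lift_map ?f = (\<Sum>J\<in>Pow \<Delta>. scale (c J) (coset_basis J))"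
      unfolding module_hom.sum[OF lift_map_linear] module_hom.scale[OF lift_map_linear]
      by (intro sum.cong refl) (simp add: lift_map_basis)
    moreover have "Poly_Mapping.keys ?f \<subseteq> descent_classes"
      by (rule keys_sum_scale, rule descent_basis_keys) auto
    ultimately show "y \<in> (\<lambda>f. weyl.burnside_proj (lift_map f)) ` {f. Poly_Mapping.keys f \<subseteq> descent_classes}"
      using y by (intro image_eqI[of _ _ ?f]) auto
  next
    fix y assume "y \<in> (\<lambda>f. weyl.burnside_proj (lift_map f)) ` {f. Poly_Mapping.keys f \<subseteq> descent_classes}"
    then obtain f where f: "Poly_Mapping.keys f \<subseteq> descent_classes" "y = weyl.burnside_proj (lift_map f)" by auto
    define c where "c J = (if J \<in> rep ` descent_classes then Poly_Mapping.lookup f (descent_class \<Phi> \<Delta> J) else 0)" for J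
    have inj: "inj_on rep descent_classes" by (rule inj_on_inverseI) (rule class_rep(2))
    have "lift_map f = (\<Sum>C\<in>descent_classes. scale (Poly_Mapping.lookup f C) (coset_basis (rep C)))"
      unfolding lift_map_def by (rule scale.lin_ext_superset[OF finite_descent_classes f(1)])
    also have "\<dots> = (\<Sum>C\<in>descent_classes. scale (c (rep C)) (coset_basis (rep C)))"
      by (intro sum.cong refl) (simp add: c_def class_rep(2))
    also have "\<dots> = (\<Sum>J\<in>rep ` descent_classes. scale (c J) (coset_basis J))"
      by (simp only: sum.reindex[OF inj] comp_def)
    also have "\<dots> = (\<Sum>J\<in>Pow \<Delta>. scale (c J) (coset_basis J))"
      by (rule sum.mono_neutral_left) (use finite_simple class_rep(1) in \<open>auto simp: c_def\<close>)
    finally show "y \<in> carrier (parabolic_burnside \<Phi> \<Delta> :: (rat, _) module)"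
      unfolding carrier f(2) by (intro range_eqI[of _ _ c]) (simp only:)
  qed
qed

lemma parabolic_burnside_simps [simp]:
  "x \<otimes>\<^bsub>parabolic_burnside \<Phi> \<Delta>\<^esub> y = x \<otimes>\<^bsub>burnside (weyl_group \<Phi>)\<^esub> y"
  "x \<oplus>\<^bsub>parabolic_burnside \<Phi> \<Delta>\<^esub> y = x \<oplus>\<^bsub>burnside (weyl_group \<Phi>)\<^esub> y"
  "\<one>\<^bsub>parabolic_burnside \<Phi> \<Delta>\<^esub> = \<one>\<^bsub>burnside (weyl_group \<Phi>)\<^esub>"
  "c \<odot>\<^bsub>parabolic_burnside \<Phi> \<Delta>\<^esub> x = c \<odot>\<^bsub>burnside (weyl_group \<Phi>)\<^esub> x"
  by (simp_all add: parabolic_burnside_def Let_def)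

lemma lift_map_inj:
  assumes f: "Poly_Mapping.keys f \<subseteq> descent_classes" and h: "Poly_Mapping.keys h \<subseteq> descent_classes"
    and "lift_map f - lift_map h \<in> rel_ideal"
  shows "f = h"
proof -
  have "Poly_Mapping.keys (f - h) \<subseteq> descent_classes"
    using f h by (auto simp: in_keys_iff lookup_minus subset_iff) metis
  moreover have "lift_map (f - h) \<in> rel_ideal"
    using assms(3) by (simp only: module_hom.diff[OF lift_map_linear])
  ultimately have "f - h = 0" by (rule lift_map_kernel)
  then show ?thesis by simp
qed

theorem descent_to_burnside_iso:
  "descent_to_burnside \<Phi> \<Delta> \<in> ring_iso (new_descent_algebra \<Phi> \<Delta>) (parabolic_burnside \<Phi> \<Delta>)"
proof -
  let ?A = "{f :: (('a \<Rightarrow> 'a) \<Rightarrow>\<^sub>0 rat) set \<Rightarrow>\<^sub>0 rat. Poly_Mapping.keys f \<subseteq> descent_classes}"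
  let ?\<phi> = "descent_to_burnside \<Phi> \<Delta>" and ?\<Sigma> = "new_descent_algebra \<Phi> \<Delta>"
  let ?PB = "parabolic_burnside \<Phi> \<Delta> :: (rat, _) module"
  have image: "?\<phi> ` ?A = carrier ?PB"
    unfolding parabolic_burnside_carrier
    by (intro image_cong refl) (simp add: descent_to_burnside_proj)
  have add: "Poly_Mapping.keys (f + h) \<subseteq> descent_classes" if "f \<in> ?A" "h \<in> ?A" for f h
    using that Poly_Mapping.keys_add[of f h] by blast
  have "?\<phi> \<in> ring_hom ?\<Sigma> ?PB"
  proof (rule ring_hom_memI)
    show "?\<phi> f \<in> carrier ?PB" if "f \<in> carrier ?\<Sigma>" for f
      using that image by (simp only: new_descent_simps) blast
    show "?\<phi> (f \<otimes>\<^bsub>?\<Sigma>\<^esub> h) = ?\<phi> f \<otimes>\<^bsub>?PB\<^esub> ?\<phi> h" if "f \<in> carrier ?\<Sigma>" "h \<in> carrier ?\<Sigma>" for f h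
    proof -
      have f: "Poly_Mapping.keys f \<subseteq> descent_classes" and h: "Poly_Mapping.keys h \<subseteq> descent_classes" using that by auto
      note fh = new_descent_mult_closed[OF f h]
      interpret R: ring "gset_ring (weyl_group \<Phi>) :: (('a \<Rightarrow> 'a, nat) gset set \<Rightarrow>\<^sub>0 rat) ring"
        by (rule weyl.gset_ring_is_ring)
      have "weyl.burnside_proj (lift_map f \<otimes>\<^bsub>gset_ring (weyl_group \<Phi>)\<^esub> lift_map h)
          = weyl.burnside_proj (lift_map (f \<otimes>\<^bsub>?\<Sigma>\<^esub> h))"
        using weyl.burnside_proj_eq_iff[OF R.m_closed[OF lift_map_carrier[OF f] lift_map_carrier[OF h]] lift_map_carrier[OF fh]]
          lift_map_mult[OF f h] by blast
      then show ?thesis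
        by (simp only: parabolic_burnside_simps descent_to_burnside_proj f h fh
            weyl.burnside_mult lift_map_carrier)
    qed
    show "?\<phi> (f \<oplus>\<^bsub>?\<Sigma>\<^esub> h) = ?\<phi> f \<oplus>\<^bsub>?PB\<^esub> ?\<phi> h" if "f \<in> carrier ?\<Sigma>" "h \<in> carrier ?\<Sigma>" for f h
    proof -
      have f: "Poly_Mapping.keys f \<subseteq> descent_classes" and h: "Poly_Mapping.keys h \<subseteq> descent_classes"
        and fh: "Poly_Mapping.keys (f + h) \<subseteq> descent_classes" using that add by auto
      show ?thesis
        by (simp only: parabolic_burnside_simps new_descent_simps descent_to_burnside_proj f h fh
            weyl.burnside_add lift_map_carrier module_hom.add[OF lift_map_linear])
    qed
    show "?\<phi> \<one>\<^bsub>?\<Sigma>\<^esub> = \<one>\<^bsub>?PB\<^esub>"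
      by (simp only: parabolic_burnside_simps new_descent_simps descent_to_burnside_proj descent_basis_keys
          subset_refl weyl.burnside_one lift_map_basis coset_basis_simple)
  qed
  moreover have "inj_on ?\<phi> ?A"
  proof (rule inj_onI)
    fix f h assume "f \<in> ?A" "h \<in> ?A" and eq: "?\<phi> f = ?\<phi> h"
    then have f: "Poly_Mapping.keys f \<subseteq> descent_classes" and h: "Poly_Mapping.keys h \<subseteq> descent_classes" by auto
    then have "lift_map f - lift_map h \<in> rel_ideal"
      using eq weyl.burnside_proj_eq_iff[OF lift_map_carrier[OF f] lift_map_carrier[OF h]]
      by (simp only: descent_to_burnside_proj)
    then show "f = h" by (rule lift_map_inj[OF f h])
  qed
  ultimately show ?thesis
    using image by (simp add: ring_iso_def bij_betw_def)
qed

lemma descent_to_burnside_basis: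
  "J \<subseteq> \<Delta> \<Longrightarrow> descent_to_burnside \<Phi> \<Delta> (descent_basis \<Phi> \<Delta> J) = parabolic_class \<Phi> J"
  by (simp only: descent_to_burnside_proj descent_basis_keys lift_map_basis parabolic_class_proj)

lemma descent_to_burnside_smult:
  assumes "f \<in> carrier (new_descent_algebra \<Phi> \<Delta>)"
  shows "descent_to_burnside \<Phi> \<Delta> (c \<odot>\<^bsub>new_descent_algebra \<Phi> \<Delta>\<^esub> f)
    = c \<odot>\<^bsub>parabolic_burnside \<Phi> \<Delta>\<^esub> descent_to_burnside \<Phi> \<Delta> f"
proof -
  have f: "Poly_Mapping.keys f \<subseteq> descent_classes" using assms by simp
  have cf: "Poly_Mapping.keys (scale c f) \<subseteq> descent_classes" using f keys_scale[of c f] by blast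
  show ?thesis
    by (simp only: parabolic_burnside_simps new_descent_simps descent_to_burnside_proj f cf
        weyl.burnside_smult lift_map_carrier module_hom.scale[OF lift_map_linear])
qed

text \<open>
  The product is defined through chosen representatives of the classes of \<open>J\<close> and \<open>K\<close>. Its independence
  of the choice follows from the injectivity of \<open>lift_map\<close> modulo the relations: by Mackey's formula
  both sides are mapped to the class of \<open>W/W\<^sub>J \<times> W/W\<^sub>K\<close>, which only depends on the conjugacy classes of
  the two subgroups.
\<close>

lemma descent_basis_mult:
  assumes J: "J \<subseteq> \<Delta>" and K: "K \<subseteq> \<Delta>"
  shows "descent_basis \<Phi> \<Delta> J \<otimes>\<^bsub>new_descent_algebra \<Phi> \<Delta>\<^esub> descent_basis \<Phi> \<Delta> K = descent_product \<Phi> \<Delta> J K"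
proof (rule lift_map_inj)
  show "Poly_Mapping.keys (descent_product \<Phi> \<Delta> J K) \<subseteq> descent_classes" by (rule descent_product_keys[OF K])
  note JK = descent_basis_keys[OF J] descent_basis_keys[OF K]
  show "Poly_Mapping.keys (descent_basis \<Phi> \<Delta> J \<otimes>\<^bsub>new_descent_algebra \<Phi> \<Delta>\<^esub> descent_basis \<Phi> \<Delta> K) \<subseteq> descent_classes"
    by (rule new_descent_mult_closed[OF JK])
  let ?m = "coset_basis J \<otimes>\<^bsub>gset_ring (weyl_group \<Phi>)\<^esub> coset_basis K"
  let ?l = "lift_map (descent_basis \<Phi> \<Delta> J \<otimes>\<^bsub>new_descent_algebra \<Phi> \<Delta>\<^esub> descent_basis \<Phi> \<Delta> K)"
  have "?m - ?l \<in> rel_ideal"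
    using lift_map_mult[OF JK] by (simp only: lift_map_basis[OF J] lift_map_basis[OF K])
  then have "scale (- 1) (?m - ?l) + (?m - lift_map (descent_product \<Phi> \<Delta> J K)) \<in> rel_ideal"
    by (intro weyl.burnside_ideal_add weyl.burnside_ideal_scale lift_map_product[OF J K])
  moreover have "scale (- 1) x = - x" for x :: "('a \<Rightarrow> 'a, nat) gset set \<Rightarrow>\<^sub>0 rat"
    by (rule poly_mapping_eqI) simp
  ultimately show "?l - lift_map (descent_product \<Phi> \<Delta> J K) \<in> rel_ideal" by simp
qed

end

section \<open>The root system of type A\<close>

text \<open>
  A positive root \<open>e\<^sub>i - e\<^sub>j\<close> with \<open>i < j\<close> is the telescoping sum of consecutive differences, and the
  simple roots are independent because they are dual to the partial sums \<open>\<omega> i = e\<^sub>1 + \<dots> + e\<^sub>i\<close>. The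
  reflection in \<open>e\<^sub>i - e\<^sub>j\<close> interchanges the basis vectors \<open>e\<^sub>i\<close> and \<open>e\<^sub>j\<close>.
\<close>

lemma type_A_simple_system:
  fixes n :: nat and e :: "nat \<Rightarrow> 'a::euclidean_space"
  assumes ortho: "\<forall>i\<in>{1..n+1}. \<forall>j\<in>{1..n+1}. e i \<bullet> e j = (if i = j then 1 else 0)"
    and \<Phi>: "\<Phi> = {e i - e j | i j. i \<in> {1..n+1} \<and> j \<in> {1..n+1} \<and> i \<noteq> j}"
    and \<Delta>: "\<Delta> = {e i - e (i + 1) | i. i \<in> {1..n}}"
  shows "simple_system \<Phi> \<Delta>"
proof -
  let ?N = "{1..n+1}"
  have ee: "e i \<bullet> e j = (if i = j then 1 else 0)" if "i \<in> ?N" "j \<in> ?N" for i j using ortho that by blast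
  have rootI: "e i - e j \<in> \<Phi>" if "i \<in> ?N" "j \<in> ?N" "i \<noteq> j" for i j using that \<Phi> by blast
  have rootE: "\<exists>i j. i \<in> ?N \<and> j \<in> ?N \<and> i \<noteq> j \<and> r = e i - e j" if "r \<in> \<Phi>" for r using that \<Phi> by blast
  have refl: "reflection (e i - e j) (e k) = e (transpose i j k)"
    if "i \<in> ?N" "j \<in> ?N" "i \<noteq> j" "k \<in> ?N" for i j k
    using that by (auto simp: reflection_def ee inner_diff_left inner_diff_right Transposition.transpose_def)
  define \<omega> where "\<omega> i = (\<Sum>k\<in>{1..i}. e k)" for i
  have e\<omega>: "e j \<bullet> \<omega> i = (if j \<le> i then 1 else 0)" if "j \<in> ?N" "i \<in> {1..n}" for i j
  proof -
    have "e j \<bullet> \<omega> i = (\<Sum>k\<in>{1..i}. if k = j then 1 else 0)"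
      unfolding \<omega>_def inner_sum_right using that by (intro sum.cong) (auto simp: ee)
    then show ?thesis using that by auto
  qed
  have dual: "(e j - e (j + 1)) \<bullet> \<omega> i = (if j = i then 1 else 0)" if "j \<in> {1..n}" "i \<in> {1..n}" for i j
    using that by (auto simp: inner_diff_left e\<omega>)
  have e_inj: "i = j" if "e i = e j" "i \<in> ?N" "j \<in> ?N" for i j
    using ee[of i i] ee[of i j] that by (auto split: if_splits)
  have pos: "e i - e j \<in> pos_roots \<Phi> \<Delta>" if "i \<in> ?N" "j \<in> ?N" "i < j" for i j
  proof -
    let ?s = "\<lambda>k. e k - e (k + 1)"
    have inj: "inj_on ?s {1..n}"
    proof (rule inj_onI)
      fix k l assume "k \<in> {1..n}" "l \<in> {1..n}" "?s k = ?s l"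
      then show "k = l" using dual[of k k] dual[of l k] by (auto split: if_splits)
    qed
    have \<Delta>': "\<Delta> = ?s ` {1..n}" using \<Delta> by auto
    define c where "c r = (if r \<in> ?s ` {i..<j} then 1 else 0 :: real)" for r
    have sub: "{i..<j} \<subseteq> {1..n}" using that by auto
    have "e i - e j = (\<Sum>k\<in>{i..<j}. ?s k)"
      using that(3) sum_Suc_diff'[of i j "\<lambda>k. - e k"] by simp
    also have "\<dots> = (\<Sum>k\<in>{i..<j}. c (?s k) *\<^sub>R ?s k)"
      by (intro sum.cong refl) (auto simp: c_def)
    also have "\<dots> = (\<Sum>k\<in>{1..n}. c (?s k) *\<^sub>R ?s k)"
      using inj_on_image_mem_iff[OF inj _ sub] sub
      by (intro sum.mono_neutral_left) (auto simp: c_def)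
    also have "\<dots> = (\<Sum>r\<in>\<Delta>. c r *\<^sub>R r)" unfolding \<Delta>' by (simp only: sum.reindex[OF inj] comp_def)
    finally have "e i - e j = (\<Sum>r\<in>\<Delta>. c r *\<^sub>R r)" .
    moreover have "\<forall>r\<in>\<Delta>. 0 \<le> c r" by (simp add: c_def)
    moreover have "e i - e j \<in> \<Phi>" using rootI that by simp
    ultimately show ?thesis unfolding pos_roots_def by blast
  qed
  show ?thesis
  proof
    have "\<Phi> \<subseteq> (\<lambda>(i, j). e i - e j) ` (?N \<times> ?N)" using rootE by force
    then show "finite \<Phi>" by (rule finite_subset) simp
    show "0 \<notin> \<Phi>" using rootE e_inj by (metis eq_iff_diff_eq_0)
    show "reflection r s \<in> \<Phi>" if rs: "r \<in> \<Phi>" "s \<in> \<Phi>" for r s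
    proof -
      obtain i j where ij: "i \<in> ?N" "j \<in> ?N" "i \<noteq> j" "r = e i - e j" using rootE rs by blast
      obtain k l where kl: "k \<in> ?N" "l \<in> ?N" "k \<noteq> l" "s = e k - e l" using rootE rs by blast
      have "reflection r s = e (transpose i j k) - e (transpose i j l)"
        unfolding ij(4) kl(4) using linear_diff[OF linear_reflection] refl[OF ij(1-3)] kl by metis
      moreover have "transpose i j k \<in> ?N" "transpose i j l \<in> ?N"
        using ij kl by (auto simp: Transposition.transpose_def)
      moreover have "transpose i j k \<noteq> transpose i j l"
      proof
        assume "transpose i j k = transpose i j l"
        from arg_cong[OF this, of "transpose i j"] show False using kl(3) by simp
      qed
      ultimately show ?thesis using rootI by metis
    qed
    show "c = 1 \<or> c = - 1" if r: "r \<in> \<Phi>" and cr: "c *\<^sub>R r \<in> \<Phi>" for r c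
    proof -
      have norm: "s \<bullet> s = 2" if s: "s \<in> \<Phi>" for s
      proof -
        obtain i j where "i \<in> ?N" "j \<in> ?N" "i \<noteq> j" "s = e i - e j" using rootE[OF s] by blast
        then show ?thesis by (simp add: inner_diff_left inner_diff_right ee)
      qed
      \<comment> \<open>All roots have the same length, so multiples of a root can only differ by sign.\<close>
      have "c * c = 1" using norm[OF r] norm[OF cr] by simp
      then show ?thesis by (simp add: square_eq_1_iff)
    qed
    show "\<Delta> \<subseteq> \<Phi>" using \<Delta> rootI by auto
    show "independent \<Delta>"
    proof
      assume "dependent \<Delta>"
      moreover have "finite \<Delta>" unfolding \<Delta> by simp
      ultimately obtain u v where v: "v \<in> \<Delta>" "u v \<noteq> 0" and sum: "(\<Sum>r\<in>\<Delta>. u r *\<^sub>R r) = 0"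
        using dependent_finite by blast
      obtain i where i: "i \<in> {1..n}" "v = e i - e (i + 1)" using v(1) \<Delta> by blast
      have "r \<bullet> \<omega> i = (if r = v then 1 else 0)" if r: "r \<in> \<Delta>" for r
      proof -
        obtain j where j: "j \<in> {1..n}" "r = e j - e (j + 1)" using r \<Delta> by blast
        show ?thesis
        proof (cases "j = i")
          case False
          then have "r \<noteq> v" using dual[OF j(1) i(1)] dual[OF i(1) i(1)] i j by auto
          then show ?thesis using dual[OF j(1) i(1)] False j by simp
        qed (use dual i j in simp)
      qed
      then have "(\<Sum>r\<in>\<Delta>. u r *\<^sub>R r) \<bullet> \<omega> i = (\<Sum>r\<in>\<Delta>. if r = v then u v else 0)"
        unfolding inner_sum_left by (intro sum.cong) auto
      also have "\<dots> = u v" using \<open>finite \<Delta>\<close> v(1) by simp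
      finally show False using sum v(2) by simp
    qed
    show "r \<in> pos_roots \<Phi> \<Delta> \<or> - r \<in> pos_roots \<Phi> \<Delta>" if r: "r \<in> \<Phi>" for r
    proof -
      obtain i j where ij: "i \<in> ?N" "j \<in> ?N" "i \<noteq> j" "r = e i - e j" using rootE r by blast
      then show ?thesis using pos[of i j] pos[of j i] by (cases "i < j") auto
    qed
  qed
qed

theorem proposition2p10:
  fixes n :: nat and e :: "nat \<Rightarrow> 'a::euclidean_space" and \<Phi> \<Delta> :: "'a set"
  assumes "DIM('a) = n + 1"
    and "\<forall>i\<in>{1..n+1}. \<forall>j\<in>{1..n+1}. e i \<bullet> e j = (if i = j then 1 else 0)"
    and "\<Phi> = {e i - e j | i j. i \<in> {1..n+1} \<and> j \<in> {1..n+1} \<and> i \<noteq> j}"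
    and "\<Delta> = {e i - e (i + 1) | i. i \<in> {1..n}}"
  defines "\<Sigma> \<equiv> new_descent_algebra \<Phi> \<Delta>"
    and "PB \<equiv> parabolic_burnside \<Phi> \<Delta> :: (rat, _) module"
    and "\<phi> \<equiv> descent_to_burnside \<Phi> \<Delta>"
  shows "(\<forall>J\<subseteq>\<Delta>. \<forall>K\<subseteq>\<Delta>. descent_basis \<Phi> \<Delta> J \<otimes>\<^bsub>\<Sigma>\<^esub> descent_basis \<Phi> \<Delta> K = descent_product \<Phi> \<Delta> J K)
    \<and> (\<forall>J\<subseteq>\<Delta>. \<phi> (descent_basis \<Phi> \<Delta> J) = parabolic_class \<Phi> J)
    \<and> \<phi> \<in> ring_iso \<Sigma> PB
    \<and> (\<forall>c. \<forall>x\<in>carrier \<Sigma>. \<phi> (c \<odot>\<^bsub>\<Sigma>\<^esub> x) = c \<odot>\<^bsub>PB\<^esub> \<phi> x)"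
proof -
  interpret simple_system \<Phi> \<Delta> by (rule type_A_simple_system[OF assms(2-4)])
  show ?thesis
    unfolding \<Sigma>_def PB_def \<phi>_def
    by (intro conjI allI impI ballI descent_basis_mult descent_to_burnside_basis
        descent_to_burnside_iso descent_to_burnside_smult)
qed

end
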